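(* Let $b\in L^\infty(Q)$ satisfy $|b(x,t)|\leq K\sqrt{a(x)}$ for $(x,t)\in Q$, for some constant $K>0$. There exists a constant $\lambda_0>0$ such that for each $\lambda>\lambda_0$ there are constants $s_0(\lambda)>0$ and $C>0$ such that, with $\varphi(t)=e^{\lambda t}$, $$\begin{aligned} &\int_{Q} \left(\frac{1}{a(x)}| u_{t}|^2+ a(x)| u_{xx}|^2+ s\lambda \varphi | u_{x}|^2+ \frac{s^2\lambda^2\varphi^2}{a(x)}| u|^2\right)e^{2s\varphi}\,dx\,dt\\ &\leq C \int_{Q}s\varphi\frac{1}{a(x)}| F|^2 e^{2s\varphi}\,dx\,dt +Cs\left( s\lambda\varphi(T)\| u(\cdot,T)\|_{\frac{1}{a}}^2+\| u(\cdot,T)\|_{1,\frac{1}{a}}^2 \right)e^{2s\varphi(T)}\\ &\quad +Cs\left( s\lambda\| u(\cdot,0)\|_{\frac{1}{a}}^2+\| u(\cdot,0)\|_{1,\frac{1}{a}}^2\right)e^{2s} \end{aligned}$$ for all $s\geq s_0(\lambda)$ and all $u\in H^1(0,T;L^2_{\frac1a}(0,1))\cap L^2(0,T;H^2_{\frac1a}(0,1))$ solving $$u_t(x,t)+a(x)u_{xx}(x,t)+b(x,t)u_x(x,t)=F(x,t)\ \text{ in } Q,\qquad u=0\ \text{ on }\Sigma,\qquad u(\cdot,T)=u_T\ \text{ in }(0,1).$$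
   Context: Let $T>0$, $Q=(0,1)\times(0,T)$, $\Sigma=\{0,1\}\times(0,T)$. The coefficient $a$ satisfies $a\in C([0,1])\cap C^1(0,1)$, $a(x)>0$ for $x\in(0,1)$ and $a(0)=a(1)=0$. All functions are real-valued. The constants $\lambda_0,s_0(\lambda),C$ do not depend on $u$, $F$ or $u_T$, and $C$ does not depend on $s$. Weighted spaces: $L^2_{\frac1a}(0,1)=\{u\in L^2(0,1): \|u\|_{\frac1a}<\infty\}$ with $\|u\|_{\frac1a}^2=\int_0^1 \frac{u^2}{a}\,dx$; $H^1_{\frac1a}(0,1)=L^2_{\frac1a}(0,1)\cap H^1_0(0,1)$ with $\|u\|_{1,\frac1a}^2=\|u\|_{\frac1a}^2+\|u_x\|_{L^2(0,1)}^2$; $H^2_{\frac1a}(0,1)=\{u\in H^1_{\frac1a}(0,1): a u_{xx}\in L^2_{\frac1a}(0,1)\}$ with $\|u\|_{2,\frac1a}^2=\|u\|_{1,\frac1a}^2+\int_0^1 a\,u_{xx}^2\,dx$. *)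

theory Defs
  imports "HOL-Analysis.Analysis"
begin

text \<open>
  Elements of the function spaces are represented by functions whose values matter only almost
  everywhere. Norms are extended nonnegative reals and are given squared. The point \<open>(x, t)\<close> of
  \<open>QT T\<close> has the space variable first.
\<close>

definition QT :: "real \<Rightarrow> (real \<times> real) set" where
  "QT T = {0<..<1} \<times> {0<..<T}"

definition test_function :: "real \<Rightarrow> real \<Rightarrow> (real \<Rightarrow> real) \<Rightarrow> bool" where
  "test_function l r \<phi> \<longleftrightarrow>
     (\<forall>n x. (deriv ^^ n) \<phi> differentiable (at x)) \<and>
     (\<exists>c d. l < c \<and> d < r \<and> (\<forall>x. x \<notin> {c..d} \<longrightarrow> \<phi> x = 0))"

definition locally_integrable :: "real \<Rightarrow> real \<Rightarrow> (real \<Rightarrow> real) \<Rightarrow> bool" where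
  "locally_integrable l r f \<longleftrightarrow>
     (\<forall>c d. l < c \<and> d < r \<longrightarrow> set_integrable lebesgue {c..d} f)"

definition has_weak_deriv :: "real \<Rightarrow> real \<Rightarrow> (real \<Rightarrow> real) \<Rightarrow> (real \<Rightarrow> real) \<Rightarrow> bool" where
  "has_weak_deriv l r f g \<longleftrightarrow>
     locally_integrable l r f \<and> locally_integrable l r g \<and>
     (\<forall>\<phi>. test_function l r \<phi> \<longrightarrow>
        (LINT x|lebesgue_on {l<..<r}. f x * deriv \<phi> x) =
        - (LINT x|lebesgue_on {l<..<r}. g x * \<phi> x))"

text \<open>A representative of the weak derivative on \<open>(0,1)\<close>; meaningful only if there is one.\<close>

definition wderiv :: "(real \<Rightarrow> real) \<Rightarrow> real \<Rightarrow> real" where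
  "wderiv f = (SOME g. has_weak_deriv 0 1 f g)"

definition L2_normsq :: "(real \<Rightarrow> real) \<Rightarrow> ennreal" where
  "L2_normsq f = (\<integral>\<^sup>+ x. ennreal ((f x)\<^sup>2) \<partial>lebesgue_on {0<..<1})"

definition L2_space :: "(real \<Rightarrow> real) set" where
  "L2_space = {f \<in> borel_measurable (lebesgue_on {0<..<1}). L2_normsq f < \<infinity>}"

definition H1_space :: "(real \<Rightarrow> real) set" where
  "H1_space = {f \<in> L2_space. \<exists>g \<in> L2_space. has_weak_deriv 0 1 f g}"

text \<open>Closure of the test functions in the \<open>H\<^sup>1\<close> norm.\<close>

definition H10_space :: "(real \<Rightarrow> real) set" where
  "H10_space = {f \<in> H1_space. \<exists>\<phi> :: nat \<Rightarrow> real \<Rightarrow> real.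
     (\<forall>n. test_function 0 1 (\<phi> n)) \<and>
     (\<lambda>n. L2_normsq (\<lambda>x. \<phi> n x - f x) + L2_normsq (\<lambda>x. deriv (\<phi> n) x - wderiv f x))
       \<longlonglongrightarrow> 0}"

definition L2w_normsq :: "(real \<Rightarrow> real) \<Rightarrow> (real \<Rightarrow> real) \<Rightarrow> ennreal" where
  "L2w_normsq a f = (\<integral>\<^sup>+ x. ennreal ((f x)\<^sup>2 / a x) \<partial>lebesgue_on {0<..<1})"

definition L2w_space :: "(real \<Rightarrow> real) \<Rightarrow> (real \<Rightarrow> real) set" where
  "L2w_space a = {f \<in> L2_space. L2w_normsq a f < \<infinity>}"

definition H1w_space :: "(real \<Rightarrow> real) \<Rightarrow> (real \<Rightarrow> real) set" where
  "H1w_space a = L2w_space a \<inter> H10_space"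

definition H1w_normsq :: "(real \<Rightarrow> real) \<Rightarrow> (real \<Rightarrow> real) \<Rightarrow> ennreal" where
  "H1w_normsq a f = L2w_normsq a f + L2_normsq (wderiv f)"

definition H2w_space :: "(real \<Rightarrow> real) \<Rightarrow> (real \<Rightarrow> real) set" where
  "H2w_space a = {f \<in> H1w_space a. \<exists>g.
     has_weak_deriv 0 1 (wderiv f) g \<and> (\<lambda>x. a x * g x) \<in> L2w_space a}"

definition H2w_normsq :: "(real \<Rightarrow> real) \<Rightarrow> (real \<Rightarrow> real) \<Rightarrow> ennreal" where
  "H2w_normsq a f = H1w_normsq a f +
     (\<integral>\<^sup>+ x. ennreal (a x * (wderiv (wderiv f) x)\<^sup>2) \<partial>lebesgue_on {0<..<1})"

text \<open>
  \<open>L\<^sup>2(0,T;X)\<close> for a space \<open>X\<close> of functions on \<open>(0,1)\<close> with squared norm \<open>N\<close>. Its elements are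
  written as jointly measurable functions on \<open>QT T\<close>. For the separable spaces \<open>X\<close> used here, which
  embed continuously into \<open>L\<^sup>2(0,1)\<close>, this gives the strongly measurable functions into \<open>X\<close>.
\<close>

definition L2_time ::
  "real \<Rightarrow> (real \<Rightarrow> real) set \<Rightarrow> ((real \<Rightarrow> real) \<Rightarrow> ennreal) \<Rightarrow> (real \<times> real \<Rightarrow> real) set" where
  "L2_time T X N = {u \<in> borel_measurable (lebesgue_on (QT T)).
     (AE t in lebesgue_on {0<..<T}. (\<lambda>x. u (x, t)) \<in> X) \<and>
     (\<integral>\<^sup>+ t. N (\<lambda>x. u (x, t)) \<partial>lebesgue_on {0<..<T}) < \<infinity>}"

text \<open>
  \<open>v\<close> is the weak derivative of \<open>u\<close> in \<open>L\<^sup>2(0,T;X)\<close> with \<open>X = L2w_space a\<close>. The \<open>X\<close>-valued Bochner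
  integrals over \<open>t\<close> are, as functions of \<open>x\<close>, given almost everywhere by the integrals for fixed \<open>x\<close>.
\<close>

definition has_weak_dt ::
  "(real \<Rightarrow> real) \<Rightarrow> real \<Rightarrow> (real \<times> real \<Rightarrow> real) \<Rightarrow> (real \<times> real \<Rightarrow> real) \<Rightarrow> bool" where
  "has_weak_dt a T u v \<longleftrightarrow>
     u \<in> L2_time T (L2w_space a) (L2w_normsq a) \<and>
     v \<in> L2_time T (L2w_space a) (L2w_normsq a) \<and>
     (\<forall>\<phi>. test_function 0 T \<phi> \<longrightarrow>
        (AE x in lebesgue_on {0<..<1}.
           (LINT t|lebesgue_on {0<..<T}. u (x, t) * deriv \<phi> t) =
           - (LINT t|lebesgue_on {0<..<T}. v (x, t) * \<phi> t)))"

definition H1_time :: "(real \<Rightarrow> real) \<Rightarrow> real \<Rightarrow> (real \<times> real \<Rightarrow> real) set" where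
  "H1_time a T = {u. \<exists>v. has_weak_dt a T u v}"

definition has_weak_dx ::
  "real \<Rightarrow> (real \<times> real \<Rightarrow> real) \<Rightarrow> (real \<times> real \<Rightarrow> real) \<Rightarrow> bool" where
  "has_weak_dx T u v \<longleftrightarrow> v \<in> borel_measurable (lebesgue_on (QT T)) \<and>
     (AE t in lebesgue_on {0<..<T}. has_weak_deriv 0 1 (\<lambda>x. u (x, t)) (\<lambda>x. v (x, t)))"

text \<open>
  \<open>g = u(\<cdot>,t\<^sub>0)\<close>, the value at \<open>t\<^sub>0\<close> of the representative \<open>w\<close> of \<open>u\<close> that is continuous from
  \<open>[0,T]\<close> into \<open>L2w_space a\<close>; it exists for \<open>u\<close> in \<open>H1_time a T\<close>.
\<close>

definition has_time_trace ::
  "(real \<Rightarrow> real) \<Rightarrow> real \<Rightarrow> (real \<times> real \<Rightarrow> real) \<Rightarrow> real \<Rightarrow> (real \<Rightarrow> real) \<Rightarrow> bool" where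
  "has_time_trace a T u t\<^sub>0 g \<longleftrightarrow>
     (\<exists>w :: real \<Rightarrow> real \<Rightarrow> real.
        (\<forall>t\<in>{0..T}. w t \<in> L2w_space a) \<and>
        (\<forall>t\<in>{0..T}. ((\<lambda>\<tau>. L2w_normsq a (\<lambda>x. w \<tau> x - w t x)) \<longlongrightarrow> 0) (at t within {0..T})) \<and>
        (AE t in lebesgue_on {0<..<T}. AE x in lebesgue_on {0<..<1}. w t x = u (x, t)) \<and>
        (AE x in lebesgue_on {0<..<1}. g x = w t\<^sub>0 x))"

text \<open>\<open>u = 0\<close> on \<open>{0,1} \<times> (0,T)\<close>, through the continuous representative of \<open>u(\<cdot>,t)\<close>.\<close>

definition vanishes_on_lateral_boundary :: "real \<Rightarrow> (real \<times> real \<Rightarrow> real) \<Rightarrow> bool" where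
  "vanishes_on_lateral_boundary T u \<longleftrightarrow>
     (AE t in lebesgue_on {0<..<T}. \<exists>w. continuous_on {0..1} w \<and>
        (AE x in lebesgue_on {0<..<1}. w x = u (x, t)) \<and> w 0 = 0 \<and> w 1 = 0)"

definition Linf_QT :: "real \<Rightarrow> (real \<times> real \<Rightarrow> real) set" where
  "Linf_QT T = {b \<in> borel_measurable (lebesgue_on (QT T)).
     \<exists>M. AE z in lebesgue_on (QT T). \<bar>b z\<bar> \<le> M}"

definition carleman_phi :: "real \<Rightarrow> real \<Rightarrow> real" where
  "carleman_phi lam t = exp (lam * t)"

end

theory Submission
  imports Defs "HOL-Computational_Algebra.Polynomial"
begin

text \<open>
  For \<open>z = exp (s \<phi>) u\<close> and \<open>\<psi> = s \<lambda> \<phi>\<close> one expands the square of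
  \<open>z\<^sub>t + a z\<^sub>x\<^sub>x - \<psi> z = exp (s \<phi>) (u\<^sub>t + a u\<^sub>x\<^sub>x)\<close> in \<open>L\<^sup>2\<close> with weight \<open>1/a\<close>. Since \<open>\<integral> z z\<^sub>x\<^sub>x = - \<integral> z\<^sub>x\<^sup>2\<close>, the square of
  \<open>a z\<^sub>x\<^sub>x - \<psi> z\<close> produces all terms of the left-hand side with positive sign, and the two cross terms
  with \<open>z\<^sub>t\<close> are exact time derivatives, whose contributions at \<open>t = 0\<close> have a good sign. The drift is
  absorbed because \<open>b\<^sup>2 / a \<le> K\<^sup>2\<close>.

  The cross term \<open>2 \<integral> z\<^sub>t z\<^sub>x\<^sub>x\<close> is the only one that needs care, as \<open>z\<^sub>t\<close> has no derivative in \<open>x\<close>. Convexity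
  of the Dirichlet integral bounds the difference quotients \<open>2 \<integral> (z(t + h) - z(t)) z\<^sub>x\<^sub>x(t) / h\<close> from below
  by a telescoping quantity, and continuity of translations in \<open>L\<^sup>2\<close> gives the limit \<open>h \<rightarrow> 0\<close>. The same
  convexity, along times \<open>t\<^sub>n \<rightarrow> T\<close> at which \<open>(T - t\<^sub>n) \<integral> a z\<^sub>x\<^sub>x\<^sup>2\<close> is small, makes \<open>z\<^sub>x(t\<^sub>n)\<close> a Cauchy sequence, so
  that the trace at \<open>T\<close> is in \<open>H\<^sup>1\<^sub>0\<close>.
\<close>

section \<open>Smooth bump functions\<close>

text \<open>In the inner product with weight 1/a the operator a d^2/dx^2 is symmetric. The obstacle
  is the degeneracy: z_xx is controlled only with the factor sqrt(a), so z_x may be singular at 0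
  and 1. Hence \<open>primitive_on\<close> is used on [0,1] for z, but on (0,1), that is locally,
  for z_x. Only a lower bound of the pairing of z_t with z_xx is required; forward differences
  provide it with the right sign, and no chain rule for the Dirichlet integral is invoked.

  All data are replaced by Borel functions on the plane that vanish outside Q, and a by 1 outside
  (0,1), so that Fubini and translations apply to \<open>lborel\<close>. The time derivative is
  integrated once: z(t) is the final value minus the integral of z_t from t on.

  The gradient term arises twice, as 2 s \<lambda> \<phi> z_x^2, and one copy suffices for the drift
  once 2 K^2 \<le> s \<lambda>. This leads to \<lambda>_0 = 1, s_0 = max(1, 2 K^2) and C = 6; the
  factor s \<phi> in front of F^2 comes from 1 \<le> s \<phi>.\<close>

definition smooth :: "(real \<Rightarrow> real) \<Rightarrow> bool" where
  "smooth f \<longleftrightarrow> (\<forall>n x. (deriv ^^ n) f differentiable (at x))"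

text \<open>Coinduction replaces a formula for the n-th derivative: it is enough to place
  \<open>f\<close> in a class of differentiable functions that is closed under \<open>deriv\<close>.
  Several closure properties below supply such a class.\<close>

lemma smooth_coinduct:
  assumes "f \<in> S" and "\<And>g x. g \<in> S \<Longrightarrow> g differentiable (at x)" and "\<And>g. g \<in> S \<Longrightarrow> deriv g \<in> S"
  shows "smooth f"
proof -
  have "(deriv ^^ n) f \<in> S" for n by (induction n) (use assms in auto)
  then show ?thesis using assms(2) by (auto simp: smooth_def)
qed

lemma smooth_differentiable: "smooth f \<Longrightarrow> f differentiable (at x)"
  unfolding smooth_def by (metis funpow_0)

lemma smooth_deriv: "smooth f \<Longrightarrow> smooth (deriv f)"
  unfolding smooth_def by (metis comp_apply funpow_Suc_right)

lemma smooth_has_deriv: "smooth f \<Longrightarrow> (f has_real_derivative deriv f x) (at x)"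
  using DERIV_deriv_iff_real_differentiable smooth_differentiable by blast

lemma smooth_continuous: "smooth f \<Longrightarrow> continuous_on A f"
  by (meson DERIV_isCont continuous_at_imp_continuous_on smooth_has_deriv)

lemma smooth_of_deriv:
  assumes "\<And>x. (f has_real_derivative g x) (at x)" "smooth g"
  shows "smooth f"
proof -
  have [simp]: "deriv f = g" using assms(1) DERIV_imp_deriv by blast
  have "(deriv ^^ n) f differentiable (at x)" for n x
  proof (cases n)
    case 0 then show ?thesis using assms(1) real_differentiable_def by auto
  next
    case (Suc m)
    then show ?thesis using assms(2) by (simp add: funpow_Suc_right smooth_def del: funpow.simps)
  qed
  then show ?thesis by (simp add: smooth_def)
qed

text \<open>Products of two smooth functions are not closed under \<open>deriv\<close>, but their
  finite sums are, by the Leibniz rule; this is the class for coinduction on products.\<close>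

inductive_set smooth_prods :: "(real \<Rightarrow> real) set" where
  prod: "smooth f \<Longrightarrow> smooth g \<Longrightarrow> (\<lambda>x. f x * g x) \<in> smooth_prods"
| sum: "p \<in> smooth_prods \<Longrightarrow> q \<in> smooth_prods \<Longrightarrow> (\<lambda>x. p x + q x) \<in> smooth_prods"

lemma smooth_prods_deriv:
  assumes "p \<in> smooth_prods"
  shows "(\<forall>x. p differentiable (at x)) \<and> deriv p \<in> smooth_prods"
  using assms
proof induction
  case (prod f g)
  have d: "((\<lambda>x. f x * g x) has_real_derivative deriv f x * g x + f x * deriv g x) (at x)" for x
    using DERIV_mult[OF smooth_has_deriv[OF prod(1)] smooth_has_deriv[OF prod(2)], of x]
    by (simp add: algebra_simps)
  then have "deriv (\<lambda>x. f x * g x) = (\<lambda>x. deriv f x * g x + f x * deriv g x)"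
    using DERIV_imp_deriv by blast
  then show ?case
    using d prod smooth_deriv by (auto simp: real_differentiable_def intro!: smooth_prods.intros)
next
  case (sum p q)
  have d: "((\<lambda>x. p x + q x) has_real_derivative deriv p x + deriv q x) (at x)" for x
    using sum DERIV_deriv_iff_real_differentiable by (intro DERIV_add) auto
  then have "deriv (\<lambda>x. p x + q x) = (\<lambda>x. deriv p x + deriv q x)"
    using DERIV_imp_deriv by blast
  then show ?case
    using d sum by (auto simp: real_differentiable_def intro!: smooth_prods.intros)
qed

lemma smooth_const: "smooth (\<lambda>x. c)"
proof (rule smooth_coinduct[where S="range (\<lambda>c x. c)"])
  show "\<And>g. g \<in> range (\<lambda>c x. c) \<Longrightarrow> deriv g \<in> range (\<lambda>c x. c::real)" by force
qed auto

lemma smooth_mult: "smooth f \<Longrightarrow> smooth g \<Longrightarrow> smooth (\<lambda>x. f x * g x)"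
  using smooth_prods_deriv by (intro smooth_coinduct[where S=smooth_prods, OF smooth_prods.prod]) auto

lemma smooth_add:
  assumes "smooth f" "smooth g"
  shows "smooth (\<lambda>x. f x + g x)"
proof -
  have "(\<lambda>x. f x * 1 + g x * 1) \<in> smooth_prods"
    by (intro smooth_prods.intros assms smooth_const)
  then have "smooth (\<lambda>x. f x * 1 + g x * 1)"
    using smooth_prods_deriv by (intro smooth_coinduct[where S=smooth_prods]) auto
  then show ?thesis by simp
qed

text \<open>The factor \<open>c\<close> in the coinduction class collects the powers of
  \<open>m\<close> that the chain rule produces.\<close>

lemma smooth_affine:
  assumes "smooth f"
  shows "smooth (\<lambda>x. f (m * x + k))"
proof (rule smooth_coinduct[where S="{\<lambda>x. c * h (m * x + k) | c h. smooth h}"])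
  show "(\<lambda>x. f (m * x + k)) \<in> {\<lambda>x. c * h (m * x + k) | c h. smooth h}"
    using assms by (auto intro!: exI[of _ 1])
next
  fix g assume "g \<in> {\<lambda>x. c * h (m * x + k) | c h. smooth h}"
  then obtain c h where h: "smooth h" and g: "g = (\<lambda>x. c * h (m * x + k))" by auto
  have d: "(g has_real_derivative (c * m) * deriv h (m * x + k)) (at x)" for x
  proof -
    have "((\<lambda>x. m * x + k) has_real_derivative m) (at x)"
      by (auto intro!: derivative_eq_intros)
    from DERIV_chain2[OF smooth_has_deriv[OF h] this]
    show ?thesis unfolding g using DERIV_cmult by (fastforce simp: ac_simps)
  qed
  then show "g differentiable (at x)" for x using real_differentiable_def by blast
  have "deriv g = (\<lambda>x. (c * m) * deriv h (m * x + k))" using d DERIV_imp_deriv by blast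
  then show "deriv g \<in> {\<lambda>x. c * h (m * x + k) | c h. smooth h}"
    using smooth_deriv[OF h] by auto
qed

text \<open>These are the functions p(1/x) exp(-1/x), extended by 0. Every derivative of exp(-1/x)
  has this form, since with y = 1/x the derivative of p(y) exp(-y) in x is y^2 (p(y) - p'(y))
  exp(-y). The instance \<open>flat 1\<close> is the usual smooth function that vanishes to infinite
  order at 0.\<close>

definition flat :: "real poly \<Rightarrow> real \<Rightarrow> real" where
  "flat p x = (if x > 0 then poly p (1 / x) * exp (- (1 / x)) else 0)"

lemma poly_exp_tendsto_0: "((\<lambda>y. poly p y * exp (- y)) \<longlongrightarrow> (0::real)) at_top"
proof -
  have "((\<lambda>y. \<Sum>i\<le>degree p. coeff p i * (y ^ i / exp y)) \<longlongrightarrow> (\<Sum>i\<le>degree p. coeff p i * 0)) at_top"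
    by (intro tendsto_intros tendsto_power_div_exp_0)
  then show ?thesis
    by (simp add: poly_altdef sum_distrib_right exp_minus divide_inverse mult.assoc)
qed

lemma flat_has_deriv:
  "(flat p has_real_derivative flat ([:0, 0, 1:] * (p - pderiv p)) x) (at x)"
proof -
  consider "x > 0" | "x < 0" | "x = 0" by linarith
  then show ?thesis
  proof cases
    case 1
    have i: "((\<lambda>x. 1 / x) has_real_derivative - (1 / x\<^sup>2)) (at x)"
      using 1 by (auto intro!: derivative_eq_intros simp: power2_eq_square field_simps)
    have e: "((\<lambda>x. exp (- (1 / x))) has_real_derivative exp (- (1 / x)) * (1 / x\<^sup>2)) (at x)"
      using DERIV_chain2[OF DERIV_exp DERIV_minus[OF i]] by simp
    have "((\<lambda>x. poly p (1 / x) * exp (- (1 / x))) has_real_derivative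
        flat ([:0, 0, 1:] * (p - pderiv p)) x) (at x)"
      using DERIV_mult[OF DERIV_chain2[OF poly_DERIV i, of p] e] 1
      by (simp add: flat_def power2_eq_square algebra_simps)
    then show ?thesis
      by (rule has_field_derivative_transform_within_open[where S="{0<..}"]) (use 1 in \<open>auto simp: flat_def\<close>)
  next
    case 2
    have "((\<lambda>x. 0) has_real_derivative flat ([:0, 0, 1:] * (p - pderiv p)) x) (at x)"
      using 2 by (auto simp: flat_def)
    then show ?thesis
      by (rule has_field_derivative_transform_within_open[where S="{..<0}"]) (use 2 in \<open>auto simp: flat_def\<close>)
  next
    case 3
    have r: "((\<lambda>h. flat p h / h) \<longlongrightarrow> 0) (at_right 0)"
    proof -
      \<comment> \<open>The right difference quotient at 0 is y p(y) exp(-y) with y = 1/h;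
        \<open>pCons 0 p\<close> is the polynomial y p(y).\<close>
      have "((\<lambda>h. poly (pCons 0 p) (inverse h) * exp (- inverse h)) \<longlongrightarrow> (0::real)) (at_right 0)"
        using poly_exp_tendsto_0 filterlim_inverse_at_top_right by (rule filterlim_compose)
      then show ?thesis
        by (rule Lim_transform_eventually)
           (auto simp: eventually_at_filter flat_def field_simps)
    qed
    have l: "((\<lambda>h. flat p h / h) \<longlongrightarrow> 0) (at_left 0)"
      by (rule Lim_transform_eventually[OF tendsto_const])
         (auto simp: eventually_at_filter flat_def)
    show ?thesis
      using filterlim_split_at[OF l r] unfolding 3 DERIV_def by (simp add: flat_def)
  qed
qed

lemma smooth_flat: "smooth (flat p)"
proof (rule smooth_coinduct[where S="range flat"])
  fix g assume "g \<in> range flat"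
  then obtain p where g: "g = flat p" by auto
  show "g differentiable (at x)" for x
    using flat_has_deriv real_differentiable_def g by blast
  have "deriv g = flat ([:0, 0, 1:] * (p - pderiv p))"
    using flat_has_deriv DERIV_imp_deriv g by blast
  then show "deriv g \<in> range flat" by auto
qed auto

text \<open>The factor \<open>Suc n\<close> steepens both flanks: the functions stay between 0 and
  1, vanish outside (c,d) and converge pointwise to the indicator of (c,d).\<close>

definition bump :: "real \<Rightarrow> real \<Rightarrow> nat \<Rightarrow> real \<Rightarrow> real" where
  "bump c d n x = flat 1 (real (Suc n) * (x - c)) * flat 1 (real (Suc n) * (d - x))"

lemma smooth_bump: "smooth (bump c d n)"
proof -
  have "bump c d n = (\<lambda>x. flat 1 (real (Suc n) * x + (- real (Suc n) * c)) *
       flat 1 (- real (Suc n) * x + real (Suc n) * d))"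
    by (auto simp: bump_def fun_eq_iff algebra_simps)
  then show ?thesis
    using smooth_mult[OF smooth_affine[OF smooth_flat] smooth_affine[OF smooth_flat]] by metis
qed

lemma flat_1_bounds: "0 \<le> flat 1 x" "flat 1 x \<le> 1" "flat 1 x > 0 \<longleftrightarrow> x > 0"
  by (auto simp: flat_def)

lemma bump_nonneg: "0 \<le> bump c d n x"
  and bump_le_1: "bump c d n x \<le> 1"
  by (auto simp: bump_def flat_1_bounds intro!: mult_nonneg_nonneg mult_le_one)

lemma bump_eq_0: "x \<notin> {c<..<d} \<Longrightarrow> bump c d n x = 0"
  by (auto simp: bump_def flat_def zero_less_mult_iff)

lemma bump_pos: "x \<in> {c<..<d} \<Longrightarrow> bump c d n x > 0"
  by (auto simp: bump_def flat_1_bounds intro!: mult_pos_pos)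

lemma flat_1_scaled_tendsto: 
  assumes "x > 0"
  shows "(\<lambda>n. flat 1 (real (Suc n) * x)) \<longlonglongrightarrow> 1"
proof -
  have "(\<lambda>n. exp (- (inverse (real (Suc n)) * (1 / x)))) \<longlonglongrightarrow> exp (- (0 * (1 / x)))"
    by (intro tendsto_intros LIMSEQ_inverse_real_of_nat)
  moreover have "exp (- (inverse (real (Suc n)) * (1 / x))) = flat 1 (real (Suc n) * x)" for n
    using assms by (simp add: flat_def field_simps del: of_nat_Suc)
  ultimately show ?thesis by simp
qed

lemma bump_tendsto: "(\<lambda>n. bump c d n x) \<longlonglongrightarrow> indicator {c<..<d} x"
proof (cases "x \<in> {c<..<d}")
  case True
  then have "(\<lambda>n. flat 1 (real (Suc n) * (x - c)) * flat 1 (real (Suc n) * (d - x))) \<longlonglongrightarrow> 1 * 1"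
    by (intro tendsto_mult flat_1_scaled_tendsto) auto
  with True show ?thesis by (simp add: bump_def)
qed (simp add: bump_eq_0)

lemma test_function_smooth:
  "test_function l r \<phi> \<longleftrightarrow> smooth \<phi> \<and> (\<exists>c d. l < c \<and> d < r \<and> (\<forall>x. x \<notin> {c..d} \<longrightarrow> \<phi> x = 0))"
  by (simp add: test_function_def smooth_def)

section \<open>Primitives of locally integrable functions\<close>

lemma set_integrable_mult_continuous:
  fixes f h :: "real \<Rightarrow> real"
  assumes "set_integrable lborel {c..d} f" "continuous_on {c..d} h"
  shows "set_integrable lborel {c..d} (\<lambda>x. f x * h x)"
proof -
  have "compact (h ` {c..d})" using assms(2) compact_continuous_image by blast
  then obtain M where M: "\<And>x. x \<in> {c..d} \<Longrightarrow> \<bar>h x\<bar> \<le> M"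
    using compact_imp_bounded[of "h ` {c..d}"] unfolding bounded_iff by (metis imageI real_norm_def)
  have f: "integrable lborel (\<lambda>x. indicator {c..d} x * f x)"
    using assms(1) by (simp add: set_integrable_def)
  have h: "(\<lambda>x. indicator {c..d} x * h x) \<in> borel_measurable lborel"
    using borel_measurable_continuous_on_indicator[OF _ assms(2)] by simp
  have "(\<lambda>x. (indicator {c..d} x * f x) * (indicator {c..d} x * h x)) \<in> borel_measurable lborel"
    using f h by measurable
  moreover have "AE x in lborel. norm ((indicator {c..d} x * f x) * (indicator {c..d} x * h x))
      \<le> norm (M * (indicator {c..d} x * f x))"
  proof (rule AE_I2)
    fix x
    show "norm ((indicator {c..d} x * f x) * (indicator {c..d} x * h x))
      \<le> norm (M * (indicator {c..d} x * f x))"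
    proof (cases "x \<in> {c..d}")
      case True
      then have "\<bar>f x\<bar> * \<bar>h x\<bar> \<le> \<bar>f x\<bar> * \<bar>M\<bar>"
        using M[of x] by (intro mult_left_mono) auto
      with True show ?thesis by (simp add: abs_mult ac_simps)
    qed auto
  qed
  ultimately have "integrable lborel (\<lambda>x. (indicator {c..d} x * f x) * (indicator {c..d} x * h x))"
    by (intro Bochner_Integration.integrable_bound[OF integrable_mult_right[OF f, of M]])
  moreover have "(\<lambda>x. (indicator {c..d} x * f x) * (indicator {c..d} x * h x))
      = (\<lambda>x. indicator {c..d} x * (f x * h x))"
    by (auto simp: fun_eq_iff split: split_indicator)
  ultimately show ?thesis by (simp add: set_integrable_def)
qed

text \<open>Absolute continuity, stated by integrals over compact subintervals and not by pointwise
  derivatives. For open \<open>I\<close> nothing is asked of \<open>g\<close> up to the end points,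
  whereas \<open>I = {0..1}\<close> makes \<open>g\<close> integrable on all of [0,1]. The primitive
  is determined on an interval up to a constant.\<close>

definition primitive_on :: "real set \<Rightarrow> (real \<Rightarrow> real) \<Rightarrow> (real \<Rightarrow> real) \<Rightarrow> bool" where
  "primitive_on I g G \<longleftrightarrow> (\<forall>c\<in>I. \<forall>d\<in>I. c \<le> d \<longrightarrow>
     set_integrable lborel {c..d} g \<and> G d - G c = (LINT x:{c..d}|lborel. g x))"

lemma primitive_onD:
  assumes "primitive_on I g G" "c \<in> I" "d \<in> I" "c \<le> d"
  shows "set_integrable lborel {c..d} g" "(LINT x:{c..d}|lborel. g x) = G d - G c"
  using assms by (auto simp: primitive_on_def)

lemma primitive_on_subset: "primitive_on I g G \<Longrightarrow> J \<subseteq> I \<Longrightarrow> primitive_on J g G"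
  unfolding primitive_on_def by blast

lemma primitive_on_add_const: "primitive_on I g G \<Longrightarrow> primitive_on I g (\<lambda>x. G x + k)"
  by (simp add: primitive_on_def)

lemma primitive_on_cmult:
  assumes "primitive_on I g G" shows "primitive_on I (\<lambda>x. k * g x) (\<lambda>x. k * G x)"
  using assms by (auto simp: primitive_on_def right_diff_distrib[symmetric])

lemma primitive_on_diff:
  assumes "primitive_on I f F" "primitive_on I g G"
  shows "primitive_on I (\<lambda>x. f x - g x) (\<lambda>x. F x - G x)"
  unfolding primitive_on_def
proof (intro ballI impI)
  fix c d assume cd: "c \<in> I" "d \<in> I" "c \<le> d"
  note fg = primitive_onD[OF assms(1) cd] primitive_onD[OF assms(2) cd]
  show "set_integrable lborel {c..d} (\<lambda>x. f x - g x) \<and>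
        F d - G d - (F c - G c) = (LINT x:{c..d}|lborel. f x - g x)"
    unfolding set_integral_diff(2)[OF fg(1) fg(3)] fg(2) fg(4)
    by (intro conjI set_integral_diff(1)[OF fg(1) fg(3)]) simp
qed

lemma primitive_continuous:
  assumes "primitive_on {c..d} g G"
  shows "continuous_on {c..d} G"
proof (cases "c \<le> d")
  case True
  have i: "g integrable_on {c..d}"
    using primitive_onD(1)[OF assms _ _ True] True by (intro set_borel_integral_eq_integral(1)) auto
  have "G x = G c + integral {c..x} g" if "x \<in> {c..d}" for x
  proof -
    have "set_integrable lborel {c..x} g" "(LINT x:{c..x}|lborel. g x) = G x - G c"
      using primitive_onD[OF assms, of c x] that by auto
    then show ?thesis using set_borel_integral_eq_integral(2) by fastforce
  qed
  moreover have "continuous_on {c..d} (\<lambda>x. G c + integral {c..x} g)"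
    by (intro continuous_intros indefinite_integral_continuous_1[OF i])
  ultimately show ?thesis using continuous_on_cong by (metis (no_types, lifting))
qed auto

lemma primitive_exists:
  assumes "\<And>c d. l < c \<Longrightarrow> d < r \<Longrightarrow> set_integrable lborel {c..d} g" "l < r"
  shows "\<exists>G. primitive_on {l<..<r} g G"
proof -
  \<comment> \<open>An interior base point; \<open>LBINT\<close> is oriented, so one formula covers
    the points on both sides of it.\<close>
  define m where "m = (l + r) / 2"
  have m: "l < m" "m < r" using assms(2) by (auto simp: m_def)
  have "primitive_on {l<..<r} g (\<lambda>x. LBINT y=m..x. g y)"
    unfolding primitive_on_def
  proof (intro ballI impI conjI)
    fix c d assume cd: "c \<in> {l<..<r}" "d \<in> {l<..<r}" "c \<le> d"
    then show "set_integrable lborel {c..d} g" using assms by auto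
    have i: "set_integrable lborel {min m c..max m d} g" using assms m cd by auto
    have "set_integrable lborel (einterval (ereal (min m c)) (ereal (max m d))) g"
      by (rule set_integrable_subset[OF i]) (auto simp: einterval_def min_def max_def split: if_splits)
    moreover have "ereal (min m c) \<le> ereal (max m d)" using cd unfolding ereal_less_eq by linarith
    ultimately have "interval_lebesgue_integrable lborel (ereal (min m c)) (ereal (max m d)) g"
      unfolding interval_lebesgue_integrable_def by (simp only: if_True)
    moreover have "min (ereal m) (min (ereal c) (ereal d)) = ereal (min m c)"
      using cd by (simp add: min_absorb1 ereal_min[symmetric] del: ereal_min)
    moreover have "max (ereal m) (max (ereal c) (ereal d)) = ereal (max m d)"
      using cd by (simp add: max_absorb2 ereal_max[symmetric] del: ereal_max)
    ultimately have "(LBINT y=m..c. g y) + (LBINT y=c..d. g y) = (LBINT y=m..d. g y)"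
      by (intro interval_integral_sum) auto
    moreover have "(LBINT y=c..d. g y) = (LINT y:{c..d}|lborel. g y)"
      using cd by (intro interval_integral_Icc) auto
    ultimately show "(LBINT y=m..d. g y) - (LBINT y=m..c. g y) = (LINT y:{c..d}|lborel. g y)" by simp
  qed
  then show ?thesis by blast
qed

text \<open>Fubini on the triangle c \<le> x \<le> y \<le> d for f(x) g(y): integrating in x first
  leaves g(y) (F(y) - F(c)), integrating in y first leaves f(x) (G(d) - G(x)). Equality of the two
  integrals is the product rule.\<close>

lemma primitive_mult:
  assumes F: "primitive_on I f F" and G: "primitive_on I g G" and I: "is_interval I"
  shows "primitive_on I (\<lambda>x. f x * G x + F x * g x) (\<lambda>x. F x * G x)"
  unfolding primitive_on_def
proof (intro ballI impI)
  fix c d assume cd: "c \<in> I" "d \<in> I" "c \<le> d"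
  have sub: "{c..d} \<subseteq> I" using I cd by (meson atLeastAtMost_iff mem_is_interval_1_I subsetI)
  note cF = primitive_continuous[OF primitive_on_subset[OF F sub]]
  note cG = primitive_continuous[OF primitive_on_subset[OF G sub]]
  have fG: "set_integrable lborel {c..d} (\<lambda>x. f x * G x)"
    by (rule set_integrable_mult_continuous[OF primitive_onD(1)[OF F cd] cG])
  have Fg: "set_integrable lborel {c..d} (\<lambda>x. F x * g x)"
    using set_integrable_mult_continuous[OF primitive_onD(1)[OF G cd] cF] by (simp add: mult.commute)
  define fc where "fc x = indicator {c..d} x * f x" for x
  define gc where "gc x = indicator {c..d} x * g x" for x
  have fi[measurable]: "integrable lborel fc" and gi[measurable]: "integrable lborel gc"
    using primitive_onD(1)[OF F cd] primitive_onD(1)[OF G cd]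
    by (auto simp: set_integrable_def fc_def[abs_def] gc_def[abs_def])
  have p: "integrable (lborel \<Otimes>\<^sub>M lborel) (\<lambda>(x, y). fc x * gc y)"
  proof (rule lborel_pair.Fubini_integrable)
    show "(\<lambda>(x, y). fc x * gc y) \<in> borel_measurable (lborel \<Otimes>\<^sub>M lborel)" by measurable
    show "integrable lborel (\<lambda>x. \<integral> y. norm (case (x, y) of (x, y) \<Rightarrow> fc x * gc y) \<partial>lborel)"
      using fi by (simp add: abs_mult)
    show "AE x in lborel. integrable lborel (\<lambda>y. case (x, y) of (x, y) \<Rightarrow> fc x * gc y)"
      using gi by simp
  qed
  define K where "K x y = (if x \<le> y then fc x * gc y else 0)" for x y
  have Kint: "integrable (lborel \<Otimes>\<^sub>M lborel) (\<lambda>(x, y). K x y)"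
  proof (rule Bochner_Integration.integrable_bound[OF p])
    show "(\<lambda>(x, y). K x y) \<in> borel_measurable (lborel \<Otimes>\<^sub>M lborel)"
      unfolding K_def by measurable
  qed (auto simp: K_def)
  have 1: "(\<integral>x. K x y \<partial>lborel) = indicator {c..d} y * (g y * (F y - F c))" for y
  proof (cases "y \<in> {c..d}")
    case True
    have "(\<integral>x. K x y \<partial>lborel) = (\<integral>x. (indicator {c..y} x * f x) * g y \<partial>lborel)"
      using True by (intro Bochner_Integration.integral_cong)
        (auto simp: K_def fc_def gc_def split: split_indicator)
    also have "\<dots> = (LINT x:{c..y}|lborel. f x) * g y"
      by (simp add: set_lebesgue_integral_def)
    also have "(LINT x:{c..y}|lborel. f x) = F y - F c"
      using True cd sub by (intro primitive_onD(2)[OF F]) auto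
    finally show ?thesis using True by simp
  next
    case False
    then have "K x y = 0" for x by (auto simp: K_def gc_def)
    with False show ?thesis by simp
  qed
  have 2: "(\<integral>y. K x y \<partial>lborel) = indicator {c..d} x * (f x * (G d - G x))" for x
  proof (cases "x \<in> {c..d}")
    case True
    have "(\<integral>y. K x y \<partial>lborel) = (\<integral>y. f x * (indicator {x..d} y * g y) \<partial>lborel)"
      using True by (intro Bochner_Integration.integral_cong)
        (auto simp: K_def fc_def gc_def split: split_indicator)
    also have "\<dots> = f x * (LINT y:{x..d}|lborel. g y)"
      by (simp add: set_lebesgue_integral_def)
    also have "(LINT x:{x..d}|lborel. g x) = G d - G x"
      using True cd sub by (intro primitive_onD(2)[OF G]) auto
    finally show ?thesis using True by simp
  next
    case False
    then have "K x y = 0" for y by (auto simp: K_def fc_def)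
    with False show ?thesis by simp
  qed
  have "(\<integral>y. \<integral>x. K x y \<partial>lborel \<partial>lborel) = (\<integral>x. \<integral>y. K x y \<partial>lborel \<partial>lborel)"
    using lborel_pair.Fubini_integral[OF Kint] by simp
  then have eq: "(LINT y:{c..d}|lborel. g y * (F y - F c)) = (LINT x:{c..d}|lborel. f x * (G d - G x))"
    unfolding 1 2 set_lebesgue_integral_def by simp
  note f = primitive_onD[OF F cd] and g = primitive_onD[OF G cd]
  have l: "(LINT y:{c..d}|lborel. g y * (F y - F c)) = (LINT y:{c..d}|lborel. F y * g y) - F c * (G d - G c)"
    using Fg g by (simp add: right_diff_distrib mult.commute[of "g _"] set_integral_diff(2))
  have r: "(LINT x:{c..d}|lborel. f x * (G d - G x)) = G d * (F d - F c) - (LINT y:{c..d}|lborel. f y * G y)"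
    using fG f by (simp add: right_diff_distrib mult.commute[of _ "G d"] set_integral_diff(2))
  have "(LINT x:{c..d}|lborel. f x * G x + F x * g x) = F d * G d - F c * G c"
    using eq l r fG Fg by (simp add: set_integral_add(2) algebra_simps)
  then show "set_integrable lborel {c..d} (\<lambda>x. f x * G x + F x * g x) \<and>
      F d * G d - F c * G c = (LINT x:{c..d}|lborel. f x * G x + F x * g x)"
    using fG Fg by (simp add: set_integral_add(1))
qed

lemma primitive_on_deriv:
  assumes "\<And>x. (F has_real_derivative f x) (at x)" "continuous_on UNIV f"
  shows "primitive_on I f F"
  unfolding primitive_on_def
proof (intro ballI impI conjI)
  fix c d :: real assume cd: "c \<le> d"
  show i: "set_integrable lborel {c..d} f"
    using assms(2) continuous_on_subset by (intro borel_integrable_atLeastAtMost') blast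
  have "(f has_integral F d - F c) {c..d}"
    using assms(1) cd
    by (intro fundamental_theorem_of_calculus)
       (auto simp: has_real_derivative_iff_has_vector_derivative[symmetric] has_field_derivative_at_within)
  then show "F d - F c = (LINT x:{c..d}|lborel. f x)"
    unfolding set_borel_integral_eq_integral(2)[OF i] by (rule integral_unique[symmetric])
qed

section \<open>The du Bois-Reymond lemma\<close>

text \<open>Compact intervals generate the Borel sets, so induction over Borel sets carries the
  vanishing to all of them, and uniqueness of densities applies. The complement step needs the
  integral over the whole line, which is 0 by exhaustion with [-n,n].\<close>

lemma AE_0_if_interval_integrals_0:
  fixes w :: "real \<Rightarrow> real"
  assumes w: "integrable lborel w"
    and 0: "\<And>a b. a \<le> b \<Longrightarrow> (LINT x:{a..b}|lborel. w x) = 0"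
  shows "AE x in lborel. w x = 0"
proof -
  have si: "set_integrable lborel A w" if "A \<in> sets borel" for A
    using that w integrable_mult_indicator[of A lborel w] by (simp add: set_integrable_def)
  have tot: "(\<integral>x. w x \<partial>lborel) = 0"
  proof -
    have "(\<lambda>n. \<integral>x. indicator {- real n..real n} x * w x \<partial>lborel) \<longlonglongrightarrow> (\<integral>x. w x \<partial>lborel)"
    proof (rule integral_dominated_convergence[where w="\<lambda>x. norm (w x)"])
      show "AE x in lborel. (\<lambda>n. indicat_real {- real n..real n} x * w x) \<longlonglongrightarrow> w x"
      proof (rule AE_I2)
        fix x
        obtain N where N: "\<bar>x\<bar> \<le> real N" using real_arch_simple by blast
        have "\<forall>\<^sub>F n in sequentially. indicat_real {- real n..real n} x * w x = w x"
          by (rule eventually_sequentiallyI[of N]) (use N in \<open>auto split: split_indicator\<close>)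
        then show "(\<lambda>n. indicat_real {- real n..real n} x * w x) \<longlonglongrightarrow> w x"
          by (rule tendsto_eventually)
      qed
    qed (use w in \<open>auto split: split_indicator\<close>)
    moreover have "(\<integral>x. indicator {- real n..real n} x * w x \<partial>lborel) = 0" for n
      using 0[of "- real n" "real n"] by (simp add: set_lebesgue_integral_def)
    ultimately show ?thesis by (simp add: LIMSEQ_const_iff)
  qed
  have "(LINT x:A|lborel. w x) = 0" if "A \<in> sets borel" for A
    using that
  proof (induction rule: borel_set_induct)
    case (compl A)
    have "(\<integral>x. w x \<partial>lborel) = (\<integral>x. indicator A x * w x + indicator (- A) x * w x \<partial>lborel)"
      by (intro Bochner_Integration.integral_cong) (auto split: split_indicator)
    also have "\<dots> = (LINT x:A|lborel. w x) + (LINT x:-A|lborel. w x)"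
      using si[of A] si[of "- A"] compl(1)
      by (simp add: set_integrable_def set_lebesgue_integral_def)
    finally show ?case using compl tot by simp
  next
    case (union f)
    have "(LINT x:(\<Union>i. f i)|lborel. w x) = (\<Sum>i. (LINT x:(f i)|lborel. w x))"
      using union si by (intro lebesgue_integral_countable_add) (auto simp: disjoint_family_on_def)
    then show ?case using union by simp
  qed (use 0 in \<open>auto simp: set_lebesgue_integral_def\<close>)
  then show ?thesis
    using density_unique_real[OF w, of "\<lambda>x. 0"] by simp
qed

text \<open>Rational end points keep the number of conditions countable, on which
  \<open>du_bois_reymond\<close> relies. The primitive of \<open>w\<close> is continuous, so its
  constancy on the rationals extends to the whole interval.\<close>

lemma AE_0_if_rational_integrals_0:
  fixes w :: "real \<Rightarrow> real"
  assumes w: "\<And>c d. l < c \<Longrightarrow> d < r \<Longrightarrow> set_integrable lborel {c..d} w" and "l < r"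
    and 0: "\<And>c d. c \<in> \<rat> \<Longrightarrow> d \<in> \<rat> \<Longrightarrow> l < c \<Longrightarrow> c < d \<Longrightarrow> d < r \<Longrightarrow> (LINT x:{c..d}|lborel. w x) = 0"
  shows "AE x in lborel. l < x \<and> x < r \<longrightarrow> w x = 0"
proof -
  obtain W where W: "primitive_on {l<..<r} w W"
    using primitive_exists[OF w \<open>l < r\<close>] by blast
  have const: "W x = W y" if xy: "x \<in> {l<..<r} \<inter> \<rat>" "y \<in> {l<..<r} \<inter> \<rat>" for x y
  proof -
    have *: "W x = W y" if "x \<in> {l<..<r} \<inter> \<rat>" "y \<in> {l<..<r} \<inter> \<rat>" "x < y" for x y
      using 0[of x y] primitive_onD(2)[OF W, of x y] that by auto
    show ?thesis using *[of x y] *[of y x] xy by (cases x y rule: linorder_cases) auto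
  qed
  have const': "W x = W y" if xy: "x \<in> {l<..<r}" "y \<in> {l<..<r}" for x y
  proof -
    obtain q where q: "q \<in> {l<..<r} \<inter> \<rat>" using Rats_dense_in_real[OF \<open>l < r\<close>] by auto
    have "W z = W q" if z: "z \<in> {l<..<r}" for z
    proof -
      have c: "continuous (at z) W"
      proof -
        obtain c d where cd: "l < c" "c < z" "z < d" "d < r"
          using z dense by (metis greaterThanLessThan_iff)
        then have "continuous_on {c..d} W"
          by (intro primitive_continuous[where g=w] primitive_on_subset[OF W]) auto
        then show ?thesis using cd by (simp add: continuous_on_interior)
      qed
      have "\<exists>s. (\<forall>n. s n \<in> {l<..<r} \<inter> \<rat>) \<and> s \<longlonglongrightarrow> z"
      proof -
        have "\<exists>s. \<forall>n. s n \<in> \<rat> \<and> z < s n \<and> s n < min r (z + inverse (real (Suc n)))"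
          using z by (intro choice allI) (metis Rats_dense_in_real greaterThanLessThan_iff less_add_same_cancel1 min_less_iff_conj inverse_positive_iff_positive of_nat_0_less_iff zero_less_Suc)
        then obtain s where s: "\<And>n. s n \<in> \<rat> \<and> z < s n \<and> s n < min r (z + inverse (real (Suc n)))" by auto
        have "s \<longlonglongrightarrow> z"
        proof (rule tendsto_sandwich[of "\<lambda>n. z" _ _ "\<lambda>n. z + inverse (real (Suc n))"])
          show "(\<lambda>n. z + inverse (real (Suc n))) \<longlonglongrightarrow> z"
            using tendsto_add[OF tendsto_const LIMSEQ_inverse_real_of_nat, of z] by simp
        qed (use s in \<open>auto intro!: always_eventually less_imp_le simp del: of_nat_Suc\<close>)
        moreover have "s n \<in> {l<..<r} \<inter> \<rat>" for n using s[of n] z by auto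
        ultimately show ?thesis by blast
      qed
      then obtain s where s: "\<And>n. s n \<in> {l<..<r} \<inter> \<rat>" "s \<longlonglongrightarrow> z" by auto
      have "(\<lambda>n. W (s n)) \<longlonglongrightarrow> W z" using c s(2) by (rule isCont_tendsto_compose)
      moreover have "W (s n) = W q" for n using const s(1) q by blast
      ultimately show ?thesis by (simp add: LIMSEQ_const_iff)
    qed
    then show ?thesis using xy by metis
  qed
  have "AE x in lborel. indicator {c..d} x * w x = 0" if cd: "l < c" "d < r" for c d
  proof (rule AE_0_if_interval_integrals_0)
    show "integrable lborel (\<lambda>x. indicator {c..d} x * w x)"
      using w[OF cd] by (simp add: set_integrable_def)
    fix a b :: real
    have "(LINT x:{a..b}|lborel. indicator {c..d} x * w x) = (LINT x:{max a c..min b d}|lborel. w x)"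
      unfolding set_lebesgue_integral_def
      by (intro Bochner_Integration.integral_cong) (auto split: split_indicator)
    also have "\<dots> = 0"
    proof (cases "max a c \<le> min b d")
      case True
      then show ?thesis
        using primitive_onD(2)[OF W, of "max a c" "min b d"] const'[of "max a c" "min b d"] cd by auto
    qed (simp add: set_lebesgue_integral_def)
    finally show "(LINT x:{a..b}|lborel. indicator {c..d} x * w x) = 0" .
  qed
  then have "AE x in lborel. \<forall>n. indicator {l + inverse (real (Suc n))..r - inverse (real (Suc n))} x * w x = 0"
    by (subst AE_all_countable) (auto simp del: of_nat_Suc)
  then show ?thesis
  proof (rule AE_mp, intro AE_I2 impI)
    fix x assume 1: "\<forall>n. indicator {l + inverse (real (Suc n))..r - inverse (real (Suc n))} x * w x = 0"
      and x: "l < x \<and> x < r"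
    then obtain n where "inverse (real (Suc n)) < min (x - l) (r - x)"
      using reals_Archimedean[of "min (x - l) (r - x)"] by auto
    then have "x \<in> {l + inverse (real (Suc n))..r - inverse (real (Suc n))}" by auto
    then show "w x = 0" using 1[rule_format, of n] by (simp del: of_nat_Suc)
  qed
qed

lemma integrable_mult_supported:
  fixes w \<phi> :: "real \<Rightarrow> real"
  assumes "set_integrable lborel {c..d} w" "continuous_on UNIV \<phi>" "\<And>x. x \<notin> {c..d} \<Longrightarrow> \<phi> x = 0"
  shows "integrable lborel (\<lambda>x. w x * \<phi> x)"
    and "(\<integral>x. w x * \<phi> x \<partial>lborel) = (LINT x:{c..d}|lborel. w x * \<phi> x)"
proof -
  have eq: "(\<lambda>x. indicator {c..d} x *\<^sub>R (w x * \<phi> x)) = (\<lambda>x. w x * \<phi> x)"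
    using assms(3) by (auto simp: fun_eq_iff split: split_indicator)
  show "integrable lborel (\<lambda>x. w x * \<phi> x)"
    using set_integrable_mult_continuous[OF assms(1) continuous_on_subset[OF assms(2) subset_UNIV]]
    unfolding set_integrable_def eq .
  show "(\<integral>x. w x * \<phi> x \<partial>lborel) = (LINT x:{c..d}|lborel. w x * \<phi> x)"
    unfolding set_lebesgue_integral_def eq ..
qed

lemma bump_integral_tendsto:
  fixes w :: "real \<Rightarrow> real"
  assumes w: "set_integrable lborel {c..d} w"
  shows "(\<lambda>n. \<integral>x. w x * bump c d n x \<partial>lborel) \<longlonglongrightarrow> (LINT x:{c..d}|lborel. w x)"
proof -
  let ?w = "\<lambda>x. indicator {c..d} x * w x"
  have i: "integrable lborel ?w" using w by (simp add: set_integrable_def)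
  have eq: "w x * bump c d n x = ?w x * bump c d n x" for x n
    using bump_eq_0[of x c d n] by (auto split: split_indicator)
  have "(\<lambda>n. \<integral>x. ?w x * bump c d n x \<partial>lborel) \<longlonglongrightarrow> (\<integral>x. ?w x \<partial>lborel)"
  proof (rule integral_dominated_convergence[where w="\<lambda>x. norm (?w x)"])
    have b: "bump c d n \<in> borel_measurable borel" for n
      using smooth_continuous[OF smooth_bump] by (rule borel_measurable_continuous_onI)
    show "(\<lambda>x. ?w x * bump c d n x) \<in> borel_measurable lborel" for n
      using i b[of n] by measurable
    have "AE x in lborel. x \<noteq> c \<and> x \<noteq> d"
      using AE_lborel_singleton[of c] AE_lborel_singleton[of d] by eventually_elim auto
    then show "AE x in lborel. (\<lambda>n. ?w x * bump c d n x) \<longlonglongrightarrow> ?w x"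
    proof (rule AE_mp, intro AE_I2 impI)
      fix x assume "x \<noteq> c \<and> x \<noteq> d"
      then have e: "?w x * indicator {c<..<d} x = ?w x" by (auto split: split_indicator)
      show "(\<lambda>n. ?w x * bump c d n x) \<longlonglongrightarrow> ?w x"
        using tendsto_mult[OF tendsto_const bump_tendsto, of "?w x" c d x] unfolding e .
    qed
    show "AE x in lborel. norm (?w x * bump c d n x) \<le> norm (?w x)" for n
      using bump_nonneg bump_le_1 by (auto simp: abs_mult intro!: mult_left_le)
  qed (use i in auto)
  then show ?thesis unfolding eq set_lebesgue_integral_def by simp
qed

lemma bump_integral_pos:
  assumes "c < d"
  shows "(\<integral>x. bump c d n x \<partial>lborel) > 0"
proof -
  have "integrable lborel (\<lambda>x. 1 * bump c d n x)"
    by (rule integrable_mult_supported(1)[OF borel_integrable_atLeastAtMost'[OF continuous_on_const]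
      smooth_continuous[OF smooth_bump[of c d n]], of c d]) (auto intro: bump_eq_0)
  then have i: "integrable lborel (bump c d n)" by simp
  have "(\<integral>x. bump c d n x \<partial>lborel) \<noteq> 0"
  proof
    assume "(\<integral>x. bump c d n x \<partial>lborel) = 0"
    then have "AE x in lborel. bump c d n x = 0"
      using integral_nonneg_eq_0_iff_AE[OF i] bump_nonneg by auto
    then have "AE x in lborel. x \<notin> {c<..<d}"
    proof (rule AE_mp, intro AE_I2 impI notI)
      fix x assume "bump c d n x = 0" "x \<in> {c<..<d}"
      then show False using bump_pos[of x c d n] by simp
    qed
    then have "emeasure lborel {c<..<d} = 0"
      by (subst (asm) AE_iff_measurable[of "{c<..<d}"]) auto
    then show False using assms by simp
  qed
  moreover have "(\<integral>x. bump c d n x \<partial>lborel) \<ge> 0" using bump_nonneg by simp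
  ultimately show ?thesis by simp
qed

text \<open>Mean value 0 is exactly the condition under which the primitive that vanishes left of
  \<open>c\<close> also vanishes right of \<open>d\<close>.\<close>

lemma test_function_with_deriv:
  assumes s: "smooth \<psi>" and supp: "\<And>x. x \<notin> {c<..<d} \<Longrightarrow> \<psi> x = 0"
    and cd: "l < c" "c \<le> d" "d < r" and 0: "(\<integral>x. \<psi> x \<partial>lborel) = 0"
  shows "\<exists>\<phi>. test_function l r \<phi> \<and> deriv \<phi> = \<psi>"
proof -
  have "isCont \<psi> x" for x
    using smooth_has_deriv[OF s] DERIV_isCont by blast
  then obtain F where "\<And>x. (F has_vector_derivative \<psi> x) (at x)"
    using einterval_antiderivative[of "-\<infinity>" "\<infinity>" \<psi>] by auto
  then have F: "(F has_real_derivative \<psi> x) (at x)" for x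
    by (simp add: has_real_derivative_iff_has_vector_derivative)
  define \<phi> where "\<phi> = (\<lambda>x. F x - F c)"
  have d: "(\<phi> has_real_derivative \<psi> x) (at x)" for x
    unfolding \<phi>_def using DERIV_diff[OF F DERIV_const] by simp
  have P: "primitive_on UNIV \<psi> \<phi>"
    by (rule primitive_on_deriv[OF d smooth_continuous[OF s]])
  have z: "\<phi> x = 0" if "x \<notin> {c..d}" for x
  proof (cases "x < c")
    case True
    have "\<phi> c - \<phi> x = (LINT y:{x..c}|lborel. \<psi> y)"
      using primitive_onD(2)[OF P] True by simp
    also have "\<dots> = (\<integral>y. 0 \<partial>(lborel :: real measure))"
      unfolding set_lebesgue_integral_def
      using supp by (intro Bochner_Integration.integral_cong) (auto split: split_indicator)
    finally show ?thesis by (simp add: \<phi>_def)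
  next
    case False
    then have "x > d" using that by auto
    have "\<phi> x - \<phi> c = (LINT y:{c..x}|lborel. \<psi> y)"
      using primitive_onD(2)[OF P] False by simp
    also have "\<dots> = (\<integral>y. \<psi> y \<partial>lborel)"
      unfolding set_lebesgue_integral_def
      using supp \<open>x > d\<close> by (intro Bochner_Integration.integral_cong) (auto split: split_indicator)
    finally show ?thesis using 0 by (simp add: \<phi>_def)
  qed
  have "deriv \<phi> = \<psi>" using d DERIV_imp_deriv by blast
  moreover have "test_function l r \<phi>"
    unfolding test_function_smooth using smooth_of_deriv[OF d s] z cd by blast
  ultimately show ?thesis by blast
qed

lemma primitive_test_function:
  assumes G: "primitive_on {l<..<r} g G" and \<phi>: "test_function l r \<phi>"
  shows "integrable lborel (\<lambda>x. g x * \<phi> x)" "integrable lborel (\<lambda>x. G x * deriv \<phi> x)"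
    "(\<integral>x. G x * deriv \<phi> x \<partial>lborel) = - (\<integral>x. g x * \<phi> x \<partial>lborel)"
proof -
  obtain c d where s: "smooth \<phi>" and cd: "l < c" "d < r" and z: "\<And>x. x \<notin> {c..d} \<Longrightarrow> \<phi> x = 0"
    using \<phi> unfolding test_function_smooth by blast
  show "integrable lborel (\<lambda>x. g x * \<phi> x)" "integrable lborel (\<lambda>x. G x * deriv \<phi> x)"
    "(\<integral>x. G x * deriv \<phi> x \<partial>lborel) = - (\<integral>x. g x * \<phi> x \<partial>lborel)"
  proof (atomize(full), cases "c \<le> d")
    case False
    then have "\<phi> = (\<lambda>x. 0)" using z by fastforce
    then show "integrable lborel (\<lambda>x. g x * \<phi> x) \<and> integrable lborel (\<lambda>x. G x * deriv \<phi> x) \<and>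
      (\<integral>x. G x * deriv \<phi> x \<partial>lborel) = - (\<integral>x. g x * \<phi> x \<partial>lborel)" by simp
  next
    case True
    \<comment> \<open>The slightly larger interval [c',d'] has its end points outside the support,
      so the product rule leaves no boundary terms.\<close>
    obtain c' where c': "l < c'" "c' < c" using dense cd by blast
    obtain d' where d': "d < d'" "d' < r" using dense cd by blast
    have sub: "{c'..d'} \<subseteq> {l<..<r}" using c' d' by auto
    have z': "deriv \<phi> x = 0" if "x \<notin> {c'..d'}" for x
    proof (rule DERIV_imp_deriv)
      have "((\<lambda>x. 0) has_real_derivative 0) (at x)" by simp
      then show "(\<phi> has_real_derivative 0) (at x)"
        by (rule has_field_derivative_transform_within_open[where S="- {c..d}"])
           (use z that c' d' in auto)
    qed
    have z'': "\<phi> x = 0" if "x \<notin> {c'..d'}" for x using that z c' d' by auto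
    have G': "primitive_on {c'..d'} g G" by (rule primitive_on_subset[OF G sub])
    have P: "primitive_on {c'..d'} (deriv \<phi>) \<phi>"
      by (rule primitive_on_deriv[OF smooth_has_deriv[OF s] smooth_continuous[OF smooth_deriv[OF s]]])
    have le: "c' \<le> d'" using True c' d' by simp
    have gi: "set_integrable lborel {c'..d'} g" using primitive_onD(1)[OF G' _ _ le] le by simp
    have Gi: "set_integrable lborel {c'..d'} G"
      by (rule borel_integrable_atLeastAtMost'[OF primitive_continuous[OF G']])
    note 1 = integrable_mult_supported[OF gi smooth_continuous[OF s] z'']
    note 2 = integrable_mult_supported[OF Gi smooth_continuous[OF smooth_deriv[OF s]] z']
    have "(LINT x:{c'..d'}|lborel. g x * \<phi> x + G x * deriv \<phi> x) = G d' * \<phi> d' - G c' * \<phi> c'"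
      using le by (intro primitive_onD(2)[OF primitive_mult[OF G' P]]) (auto simp: is_interval_cc)
    also have "\<dots> = 0" using z[of d'] z[of c'] c' d' by simp
    finally have "(LINT x:{c'..d'}|lborel. g x * \<phi> x) + (LINT x:{c'..d'}|lborel. G x * deriv \<phi> x) = 0"
      using set_integral_add(2)[OF set_integrable_mult_continuous[OF gi smooth_continuous[OF s]]
         set_integrable_mult_continuous[OF Gi smooth_continuous[OF smooth_deriv[OF s]]]] by linarith
    then show "integrable lborel (\<lambda>x. g x * \<phi> x) \<and> integrable lborel (\<lambda>x. G x * deriv \<phi> x) \<and>
      (\<integral>x. G x * deriv \<phi> x \<partial>lborel) = - (\<integral>x. g x * \<phi> x \<partial>lborel)"
      using 1 2 by linarith
  qed
qed

lemma integrable_mult_bump: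
  assumes "\<And>c d. l < c \<Longrightarrow> d < r \<Longrightarrow> set_integrable lborel {c..d} w" "l < c" "d < r"
  shows "integrable lborel (\<lambda>x. w x * bump c d n x)"
  using assms by (intro integrable_mult_supported(1)[of c d] smooth_continuous[OF smooth_bump] bump_eq_0) auto

text \<open>The test functions form a countable family chosen before \<open>f\<close> and
  \<open>g\<close>. This matters for functions of (x,t): a weak identity in t that holds for almost
  every x, with a null set depending on the test function, then holds for almost every x against the
  whole family at once. The members are primitives of bumps with rational end points, corrected by a
  multiple of one fixed bump to have mean 0; testing with them shows that f - G is constant.\<close>

theorem du_bois_reymond:
  assumes lr: "l < r"
  obtains \<T> where "countable \<T>" "\<And>\<phi>. \<phi> \<in> \<T> \<Longrightarrow> test_function l r \<phi>"
    "\<And>f g. (\<And>c d. l < c \<Longrightarrow> d < r \<Longrightarrow> set_integrable lborel {c..d} f) \<Longrightarrow>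
      (\<And>c d. l < c \<Longrightarrow> d < r \<Longrightarrow> set_integrable lborel {c..d} g) \<Longrightarrow>
      (\<And>\<phi>. \<phi> \<in> \<T> \<Longrightarrow> (\<integral>x. f x * deriv \<phi> x \<partial>lborel) = - (\<integral>x. g x * \<phi> x \<partial>lborel)) \<Longrightarrow>
      \<exists>G. primitive_on {l<..<r} g G \<and> (AE x in lborel. l < x \<and> x < r \<longrightarrow> f x = G x)"
proof -
  obtain m2 where m2: "l < m2" "m2 < r" using dense[OF lr] by blast
  obtain m1 where m1: "l < m1" "m1 < m2" using dense[OF m2(1)] by blast
  define I0 where "I0 = (\<integral>x. bump m1 m2 0 x \<partial>lborel)"
  have I0: "I0 > 0" unfolding I0_def by (rule bump_integral_pos[OF m1(2)])
  \<comment> \<open>The ratio of the two masses; with it \<open>\<psi> c d n\<close> has integral 0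
    and therefore a compactly supported primitive.\<close>
  define \<kappa> where "\<kappa> c d n = (\<integral>x. bump c d n x \<partial>lborel) / I0" for c d n
  define \<psi> where "\<psi> c d n x = bump c d n x + (- \<kappa> c d n) * bump m1 m2 0 x" for c d n x
  have bi: "integrable lborel (bump c d n)" for c d n
    using integrable_mult_bump[of "c - 1" "d + 1" "\<lambda>x. 1" c d n] 
    by (simp add: borel_integrable_atLeastAtMost')
  have ex: "\<exists>\<phi>. test_function l r \<phi> \<and> deriv \<phi> = \<psi> c d n" if "l < c" "c < d" "d < r" for c d n
  proof (rule test_function_with_deriv[where c="min c m1" and d="max d m2"])
    show "smooth (\<psi> c d n)"
      unfolding \<psi>_def by (intro smooth_add smooth_mult smooth_const smooth_bump)
    show "\<psi> c d n x = 0" if "x \<notin> {min c m1<..<max d m2}" for x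
    proof -
      have "x \<notin> {c<..<d}" "x \<notin> {m1<..<m2}" using that by auto
      then show ?thesis by (simp add: \<psi>_def bump_eq_0)
    qed
    show "(\<integral>x. \<psi> c d n x \<partial>lborel) = 0"
      unfolding \<psi>_def using bi I0 by (simp add: \<kappa>_def I0_def)
  qed (use that m1 m2 in auto)
  define \<Phi> where "\<Phi> c d n = (SOME \<phi>. test_function l r \<phi> \<and> deriv \<phi> = \<psi> c d n)" for c d n
  have \<Phi>: "test_function l r (\<Phi> c d n)" "deriv (\<Phi> c d n) = \<psi> c d n" if "l < c" "c < d" "d < r" for c d n
    using someI_ex[OF ex[OF that]] unfolding \<Phi>_def by auto
  define \<T> where "\<T> = (\<lambda>(c, d, n). \<Phi> c d n) ` {(c, d, n). c \<in> \<rat> \<and> d \<in> \<rat> \<and> l < c \<and> c < d \<and> d < r}"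
  show thesis
  proof (rule that)
    have "{(c, d, n :: nat). c \<in> \<rat> \<and> d \<in> \<rat> \<and> l < c \<and> c < d \<and> d < r} \<subseteq> \<rat> \<times> \<rat> \<times> UNIV"
      by auto
    moreover have "countable (\<rat> \<times> \<rat> \<times> (UNIV :: nat set) :: (real \<times> real \<times> nat) set)"
      by (intro countable_SIGMA countable_rat) auto
    ultimately show "countable \<T>"
      unfolding \<T>_def by (intro countable_image) (rule countable_subset)
    show "test_function l r \<phi>" if "\<phi> \<in> \<T>" for \<phi>
    proof -
      obtain c d n where "\<phi> = \<Phi> c d n" "l < c" "c < d" "d < r" using \<open>\<phi> \<in> \<T>\<close> unfolding \<T>_def by (auto simp: image_iff)
      then show ?thesis using \<Phi>(1) by metis
    qed
    fix f g :: "real \<Rightarrow> real"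
    assume f: "\<And>c d. l < c \<Longrightarrow> d < r \<Longrightarrow> set_integrable lborel {c..d} f"
      and g: "\<And>c d. l < c \<Longrightarrow> d < r \<Longrightarrow> set_integrable lborel {c..d} g"
      and weak: "\<And>\<phi>. \<phi> \<in> \<T> \<Longrightarrow> (\<integral>x. f x * deriv \<phi> x \<partial>lborel) = - (\<integral>x. g x * \<phi> x \<partial>lborel)"
    obtain G where G: "primitive_on {l<..<r} g G" using primitive_exists[OF g lr] by blast
    define w where "w x = f x - G x" for x
    have Gi: "set_integrable lborel {c..d} G" if "l < c" "d < r" for c d
      using that by (intro borel_integrable_atLeastAtMost' primitive_continuous[where g=g] primitive_on_subset[OF G]) auto
    have w: "set_integrable lborel {c..d} w" if "l < c" "d < r" for c d
      unfolding w_def by (rule set_integral_diff(1)[OF f[OF that] Gi[OF that]])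
    \<comment> \<open>The value is forced: if f - G is constant, the constant is its mean against
      the reference bump.\<close>
    define k where "k = (\<integral>x. w x * bump m1 m2 0 x \<partial>lborel) / I0"
    have wk: "set_integrable lborel {c..d} (\<lambda>x. w x - k)" if "l < c" "d < r" for c d
      by (intro set_integral_diff(1) w that borel_integrable_atLeastAtMost' continuous_on_const)
    have "AE x in lborel. l < x \<and> x < r \<longrightarrow> w x - k = 0"
    proof (rule AE_0_if_rational_integrals_0[OF wk lr])
      fix c d :: real assume cd: "c \<in> \<rat>" "d \<in> \<rat>" "l < c" "c < d" "d < r"
      have "(\<integral>x. (w x - k) * bump c d n x \<partial>lborel) = 0" for n
      proof -
        note t = \<Phi>[OF cd(3-5), of n]
        have "\<Phi> c d n \<in> \<T>" unfolding \<T>_def using cd by (auto intro!: image_eqI[of _ _ "(c, d, n)"])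
        from weak[OF this] have W: "(\<integral>x. f x * \<psi> c d n x \<partial>lborel) = (\<integral>x. G x * \<psi> c d n x \<partial>lborel)"
          using primitive_test_function(3)[OF G t(1)] unfolding t(2) by simp
        have fi: "integrable lborel (\<lambda>x. f x * bump c d n x)" "integrable lborel (\<lambda>x. f x * bump m1 m2 0 x)"
          using integrable_mult_bump[of l r f] f cd m1 m2 by auto
        have Gi: "integrable lborel (\<lambda>x. G x * bump c d n x)" "integrable lborel (\<lambda>x. G x * bump m1 m2 0 x)"
          using integrable_mult_bump[of l r G] Gi cd m1 m2 by auto
        have f': "(\<integral>x. f x * \<psi> c d n x \<partial>lborel) =
            (\<integral>x. f x * bump c d n x \<partial>lborel) - \<kappa> c d n * (\<integral>x. f x * bump m1 m2 0 x \<partial>lborel)"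
        proof -
          have e: "f x * \<psi> c d n x = f x * bump c d n x - \<kappa> c d n * (f x * bump m1 m2 0 x)" for x
            by (simp add: \<psi>_def algebra_simps)
          show ?thesis unfolding e using fi by simp
        qed
        have G': "(\<integral>x. G x * \<psi> c d n x \<partial>lborel) =
            (\<integral>x. G x * bump c d n x \<partial>lborel) - \<kappa> c d n * (\<integral>x. G x * bump m1 m2 0 x \<partial>lborel)"
        proof -
          have e: "G x * \<psi> c d n x = G x * bump c d n x - \<kappa> c d n * (G x * bump m1 m2 0 x)" for x
            by (simp add: \<psi>_def algebra_simps)
          show ?thesis unfolding e using Gi by simp
        qed
        have w1: "(\<integral>x. w x * bump c d n x \<partial>lborel) = (\<integral>x. f x * bump c d n x \<partial>lborel) - (\<integral>x. G x * bump c d n x \<partial>lborel)"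
          unfolding w_def left_diff_distrib using fi Gi by simp
        have w2: "(\<integral>x. w x * bump m1 m2 0 x \<partial>lborel) = (\<integral>x. f x * bump m1 m2 0 x \<partial>lborel) - (\<integral>x. G x * bump m1 m2 0 x \<partial>lborel)"
          unfolding w_def left_diff_distrib using fi Gi by simp
        have wi: "integrable lborel (\<lambda>x. w x * bump c d n x)"
          using integrable_mult_bump[of l r w] w cd by auto
        have "(\<integral>x. (w x - k) * bump c d n x \<partial>lborel) = (\<integral>x. w x * bump c d n x \<partial>lborel) - k * (\<integral>x. bump c d n x \<partial>lborel)"
          unfolding left_diff_distrib using wi bi by simp
        also have "(\<integral>x. bump c d n x \<partial>lborel) = \<kappa> c d n * I0" using I0 by (simp add: \<kappa>_def)
        also have "k * (\<kappa> c d n * I0) = \<kappa> c d n * (\<integral>x. w x * bump m1 m2 0 x \<partial>lborel)"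
          using I0 by (simp add: k_def)
        finally show ?thesis using W f' G' w1 w2 by (simp add: algebra_simps)
      qed
      then show "(LINT x:{c..d}|lborel. w x - k) = 0"
        using bump_integral_tendsto[OF wk[OF cd(3,5)]] by (simp add: LIMSEQ_const_iff)
    qed
    then have "AE x in lborel. l < x \<and> x < r \<longrightarrow> f x = G x + k"
      by eventually_elim (auto simp: w_def)
    then show "\<exists>G. primitive_on {l<..<r} g G \<and> (AE x in lborel. l < x \<and> x < r \<longrightarrow> f x = G x)"
      using primitive_on_add_const[OF G] by blast
  qed
qed

section \<open>Translations in \<open>L\<^sup>2\<close>\<close>

lemma integrable_mult_L2:
  fixes f g :: "'a \<Rightarrow> real"
  assumes [measurable]: "f \<in> borel_measurable M" "g \<in> borel_measurable M"
    and i: "integrable M (\<lambda>x. (f x)\<^sup>2)" "integrable M (\<lambda>x. (g x)\<^sup>2)"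
  shows "integrable M (\<lambda>x. f x * g x)"
proof (rule Bochner_Integration.integrable_bound)
  show "integrable M (\<lambda>x. (f x)\<^sup>2 + (g x)\<^sup>2)" using i by simp
  show "AE x in M. norm (f x * g x) \<le> norm ((f x)\<^sup>2 + (g x)\<^sup>2)"
  proof (rule AE_I2)
    fix x
    have "2 * (\<bar>f x\<bar> * \<bar>g x\<bar>) \<le> (f x)\<^sup>2 + (g x)\<^sup>2"
      using sum_squares_bound[of "\<bar>f x\<bar>" "\<bar>g x\<bar>"] by simp
    moreover have "\<bar>f x\<bar> * \<bar>g x\<bar> \<ge> 0" by simp
    ultimately have "\<bar>f x\<bar> * \<bar>g x\<bar> \<le> (f x)\<^sup>2 + (g x)\<^sup>2" by linarith
    then show "norm (f x * g x) \<le> norm ((f x)\<^sup>2 + (g x)\<^sup>2)" by (simp add: abs_mult)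
  qed
qed measurable

lemma Cauchy_Schwarz_integral:
  fixes f g :: "'a \<Rightarrow> real"
  assumes [measurable]: "f \<in> borel_measurable M" "g \<in> borel_measurable M"
    and i: "integrable M (\<lambda>x. (f x)\<^sup>2)" "integrable M (\<lambda>x. (g x)\<^sup>2)"
  shows "(\<integral>x. \<bar>f x * g x\<bar> \<partial>M)\<^sup>2 \<le> (\<integral>x. (f x)\<^sup>2 \<partial>M) * (\<integral>x. (g x)\<^sup>2 \<partial>M)"
proof -
  have fg: "integrable M (\<lambda>x. \<bar>f x * g x\<bar>)" using integrable_mult_L2[OF assms] by simp
  have "(\<integral>\<^sup>+x. ennreal \<bar>f x\<bar> * ennreal \<bar>g x\<bar> \<partial>M)\<^sup>2
      \<le> (\<integral>\<^sup>+x. (ennreal \<bar>f x\<bar>)\<^sup>2 \<partial>M) * (\<integral>\<^sup>+x. (ennreal \<bar>g x\<bar>)\<^sup>2 \<partial>M)"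
    by (rule Cauchy_Schwarz_nn_integral) measurable
  also have "(\<integral>\<^sup>+x. ennreal \<bar>f x\<bar> * ennreal \<bar>g x\<bar> \<partial>M) = ennreal (\<integral>x. \<bar>f x * g x\<bar> \<partial>M)"
    using fg by (simp add: nn_integral_eq_integral ennreal_mult[symmetric] abs_mult)
  also have "(\<integral>\<^sup>+x. (ennreal \<bar>f x\<bar>)\<^sup>2 \<partial>M) = ennreal (\<integral>x. (f x)\<^sup>2 \<partial>M)"
    using i by (simp add: nn_integral_eq_integral ennreal_power)
  also have "(\<integral>\<^sup>+x. (ennreal \<bar>g x\<bar>)\<^sup>2 \<partial>M) = ennreal (\<integral>x. (g x)\<^sup>2 \<partial>M)"
    using i by (simp add: nn_integral_eq_integral ennreal_power)
  finally show ?thesis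
    by (simp add: ennreal_power ennreal_mult[symmetric])
qed

lemma abs_integral_mult_le_sqrt:
  fixes f g :: "'a \<Rightarrow> real"
  assumes "f \<in> borel_measurable M" "g \<in> borel_measurable M"
    and "integrable M (\<lambda>x. (f x)\<^sup>2)" "integrable M (\<lambda>x. (g x)\<^sup>2)"
  shows "\<bar>\<integral>x. f x * g x \<partial>M\<bar> \<le> sqrt (\<integral>x. (f x)\<^sup>2 \<partial>M) * sqrt (\<integral>x. (g x)\<^sup>2 \<partial>M)"
proof -
  have "\<bar>\<integral>x. f x * g x \<partial>M\<bar> \<le> (\<integral>x. \<bar>f x * g x\<bar> \<partial>M)"
    using integral_abs_bound by blast
  also have "\<dots> \<le> sqrt ((\<integral>x. (f x)\<^sup>2 \<partial>M) * (\<integral>x. (g x)\<^sup>2 \<partial>M))"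
    by (rule real_le_rsqrt[OF Cauchy_Schwarz_integral[OF assms]])
  finally show ?thesis by (simp add: real_sqrt_mult)
qed

lemma integrable_square_diff:
  fixes f g :: "'a \<Rightarrow> real"
  assumes "f \<in> borel_measurable M" "g \<in> borel_measurable M"
    and "integrable M (\<lambda>x. (f x)\<^sup>2)" "integrable M (\<lambda>x. (g x)\<^sup>2)"
  shows "integrable M (\<lambda>x. (f x - g x)\<^sup>2)"
proof -
  have "integrable M (\<lambda>x. (f x)\<^sup>2 + (g x)\<^sup>2 - 2 * (f x * g x))"
    using assms integrable_mult_L2[OF assms] by simp
  then show ?thesis by (simp add: power2_diff mult.assoc)
qed

lemma lborel_shift:
  fixes f :: "'a::euclidean_space \<Rightarrow> real"
  assumes [measurable]: "f \<in> borel_measurable borel"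
  shows "integrable lborel (\<lambda>x. f (x + t)) \<longleftrightarrow> integrable lborel f"
    and "(\<integral>x. f (x + t) \<partial>lborel) = (\<integral>x. f x \<partial>lborel)"
proof -
  have d: "distr lborel borel ((+) t) = lborel" by (rule lborel_distr_plus)
  have "integrable lborel f \<longleftrightarrow> integrable (distr lborel borel ((+) t)) f" by (simp only: d)
  also have "\<dots> \<longleftrightarrow> integrable lborel (\<lambda>x. f (t + x))"
    by (rule integrable_distr_eq) auto
  finally show "integrable lborel (\<lambda>x. f (x + t)) \<longleftrightarrow> integrable lborel f" by (simp add: add.commute)
  have "(\<integral>x. f x \<partial>lborel) = (\<integral>x. f x \<partial>distr lborel borel ((+) t))" by (simp only: d)
  also have "\<dots> = (\<integral>x. f (t + x) \<partial>lborel)"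
    by (rule integral_distr) auto
  finally show "(\<integral>x. f (x + t) \<partial>lborel) = (\<integral>x. f x \<partial>lborel)" by (simp add: add.commute)
qed

lemma sq_sum_le: "((a::real) + b)\<^sup>2 \<le> 2 * a\<^sup>2 + 2 * b\<^sup>2"
  using sum_squares_bound[of a b] by (simp add: power2_sum)

text \<open>Truncation in value and in space gives \<open>F n\<close>. Measurability provides
  continuous functions that converge to it almost everywhere, and cutting these off keeps them
  bounded with bounded support, so dominated convergence turns pointwise into L^2
  convergence.\<close>

lemma L2_continuous_approx:
  fixes f :: "'a::euclidean_space \<Rightarrow> real"
  assumes [measurable]: "f \<in> borel_measurable borel" and f: "integrable lborel (\<lambda>x. (f x)\<^sup>2)" and e: "e > 0"
  obtains k M R where "continuous_on UNIV k" "\<And>x. \<bar>k x\<bar> \<le> M" "\<And>x. norm x > R \<Longrightarrow> k x = 0"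
    "integrable lborel (\<lambda>x. (f x - k x)\<^sup>2)" "(\<integral>x. (f x - k x)\<^sup>2 \<partial>lborel) < e"
proof -
  define F where "F n x = (if \<bar>f x\<bar> \<le> real n \<and> norm x \<le> real n then f x else 0)" for n x
  have [measurable]: "F n \<in> borel_measurable borel" for n unfolding F_def by measurable
  have "(\<lambda>n. \<integral>x. (f x - F n x)\<^sup>2 \<partial>lborel) \<longlonglongrightarrow> (\<integral>x. 0 \<partial>(lborel :: 'a measure))"
  proof (rule integral_dominated_convergence[where w="\<lambda>x. (f x)\<^sup>2"])
    show "AE x in lborel. (\<lambda>n. (f x - F n x)\<^sup>2) \<longlonglongrightarrow> 0"
    proof (rule AE_I2)
      fix x
      obtain N where N: "max \<bar>f x\<bar> (norm x) \<le> real N" using real_arch_simple by blast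
      have "\<forall>\<^sub>F n in sequentially. (f x - F n x)\<^sup>2 = 0"
        by (rule eventually_sequentiallyI[of N]) (use N in \<open>auto simp: F_def\<close>)
      then show "(\<lambda>n. (f x - F n x)\<^sup>2) \<longlonglongrightarrow> 0" by (rule tendsto_eventually)
    qed
  qed (use f in \<open>auto simp: F_def\<close>)
  then have "\<forall>\<^sub>F n in sequentially. (\<integral>x. (f x - F n x)\<^sup>2 \<partial>lborel) < e / 4"
    using e by (intro order_tendstoD(2)[where y=0]) auto
  \<comment> \<open>Two errors below e/4 will enter, each doubled by \<open>sq_sum_le\<close>, so
    the total stays below \<open>e\<close>.\<close>
  then obtain n where n: "(\<integral>x. (f x - F n x)\<^sup>2 \<partial>lborel) < e / 4"
    by (auto simp: eventually_sequentially)
  have Fi: "integrable lborel (\<lambda>x. (f x - F n x)\<^sup>2)"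
    by (rule Bochner_Integration.integrable_bound[OF f]) (auto simp: F_def)
  have "F n \<in> borel_measurable (lebesgue_on UNIV)"
    unfolding lebesgue_on_UNIV_eq by (rule measurable_completion) simp
  then have "F n measurable_on UNIV" by (subst measurable_on_iff_borel_measurable) auto
  then obtain N g where N: "negligible N" and g: "\<And>m. continuous_on UNIV (g m)"
    "\<And>x. x \<notin> N \<Longrightarrow> (\<lambda>m. g m x) \<longlonglongrightarrow> F n x"
    unfolding measurable_on_def by auto
  \<comment> \<open>The first factor is 1 on the ball of radius n and 0 beyond radius n + 1; the
    second truncates to [-n,n]. Neither of the two operations changes \<open>F n\<close>, so
    \<open>k m\<close> still converges to \<open>F n\<close>.\<close>
  define k where "k m x = max 0 (min 1 (real n + 1 - norm x)) * max (- real n) (min (real n) (g m x))" for m x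
  have kc: "continuous_on UNIV (k m)" for m
    unfolding k_def by (intro continuous_intros g)
  have [measurable]: "k m \<in> borel_measurable borel" for m
    using kc borel_measurable_continuous_onI by blast
  have kb: "\<bar>k m x\<bar> \<le> real n" for m x
  proof -
    have "\<bar>max 0 (min 1 (real n + 1 - norm x))\<bar> * \<bar>max (- real n) (min (real n) (g m x))\<bar> \<le> 1 * real n"
      by (intro mult_mono) auto
    then show ?thesis by (simp add: k_def abs_mult)
  qed
  have k0: "k m x = 0" if "norm x > real n + 1" for m x using that by (simp add: k_def)
  have "emeasure lborel (cball 0 (real n + 1) :: 'a set) < \<infinity>"
    using emeasure_bounded_finite[OF bounded_cball] by auto
  then have di: "integrable lborel (\<lambda>x. (2 * real n)\<^sup>2 * indicator (cball 0 (real n + 1) :: 'a set) x)"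
    by (intro integrable_mult_right) (simp add: integrable_indicator_iff)
  have dom: "(F n x - k m x)\<^sup>2 \<le> (2 * real n)\<^sup>2 * indicator (cball 0 (real n + 1) :: 'a set) x" for m x
  proof (cases "norm x > real n + 1")
    case True
    then show ?thesis by (simp add: k0 F_def)
  next
    case False
    have "\<bar>F n x - k m x\<bar> \<le> 2 * real n"
      using kb[of m x] by (auto simp: F_def abs_le_iff split: if_splits)
    then have "(F n x - k m x)\<^sup>2 \<le> (2 * real n)\<^sup>2" by (metis abs_ge_zero power2_abs power_mono)
    then show ?thesis using False by simp
  qed
  have "(\<lambda>m. \<integral>x. (F n x - k m x)\<^sup>2 \<partial>lborel) \<longlonglongrightarrow> (\<integral>x. 0 \<partial>(lborel :: 'a measure))"
  proof (rule integral_dominated_convergence[OF _ _ di])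
    have "AE x in lebesgue. x \<notin> N"
      using N by (simp add: AE_not_in negligible_iff_null_sets)
    then have "AE x in lborel. x \<notin> N" by (rule AE_completion_iff[THEN iffD1])
    then show "AE x in lborel. (\<lambda>m. (F n x - k m x)\<^sup>2) \<longlonglongrightarrow> 0"
    proof (rule AE_mp, intro AE_I2 impI)
      fix x assume "x \<notin> N"
      have "max 0 (min 1 (real n + 1 - norm x)) * max (- real n) (min (real n) (F n x)) = F n x"
        by (auto simp: F_def)
      then have "(\<lambda>m. k m x) \<longlonglongrightarrow> F n x"
        unfolding k_def
        using tendsto_mult[OF tendsto_const tendsto_max[OF tendsto_const tendsto_min[OF tendsto_const g(2)[OF \<open>x \<notin> N\<close>]]],
            of "max 0 (min 1 (real n + 1 - norm x))" "- real n" "real n"] by simp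
      then have "(\<lambda>m. (F n x - k m x)\<^sup>2) \<longlonglongrightarrow> (F n x - F n x)\<^sup>2" by (intro tendsto_intros)
      then show "(\<lambda>m. (F n x - k m x)\<^sup>2) \<longlonglongrightarrow> 0" by simp
    qed
  qed (use dom in auto)
  then have "\<forall>\<^sub>F m in sequentially. (\<integral>x. (F n x - k m x)\<^sup>2 \<partial>lborel) < e / 4"
    using e by (intro order_tendstoD(2)[where y=0]) auto
  then obtain m where m: "(\<integral>x. (F n x - k m x)\<^sup>2 \<partial>lborel) < e / 4"
    by (auto simp: eventually_sequentially)
  have ki: "integrable lborel (\<lambda>x. (F n x - k m x)\<^sup>2)"
    by (rule Bochner_Integration.integrable_bound[OF di]) (use dom in auto)
  have le: "(f x - k m x)\<^sup>2 \<le> 2 * (f x - F n x)\<^sup>2 + 2 * (F n x - k m x)\<^sup>2" for x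
    using sq_sum_le[of "f x - F n x" "F n x - k m x"] by simp
  have bi: "integrable lborel (\<lambda>x. 2 * (f x - F n x)\<^sup>2 + 2 * (F n x - k m x)\<^sup>2)"
    using Fi ki by simp
  have i: "integrable lborel (\<lambda>x. (f x - k m x)\<^sup>2)"
    by (rule Bochner_Integration.integrable_bound[OF bi]) (use le in auto)
  have "(\<integral>x. (f x - k m x)\<^sup>2 \<partial>lborel) \<le> (\<integral>x. 2 * (f x - F n x)\<^sup>2 + 2 * (F n x - k m x)\<^sup>2 \<partial>lborel)"
    by (rule integral_mono[OF i bi le])
  also have "\<dots> < e" using Fi ki n m by simp
  finally show thesis using that[OF kc kb k0 i] by blast
qed

text \<open>Continuity is stated for the correlation rather than for the norm of v(x + t) - v(x). It
  is then enough to approximate the single factor \<open>f\<close> by a compactly supported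
  continuous \<open>k\<close>: the norms of the translates of \<open>v\<close> do not depend on t,
  and in the remaining integral the translation is moved from \<open>v\<close> onto
  \<open>k\<close>.\<close>

lemma L2_translation_continuous:
  fixes f v :: "'a::euclidean_space \<Rightarrow> real"
  assumes [measurable]: "f \<in> borel_measurable borel" "v \<in> borel_measurable borel"
    and f: "integrable lborel (\<lambda>x. (f x)\<^sup>2)" and v: "integrable lborel (\<lambda>x. (v x)\<^sup>2)"
  shows "((\<lambda>t. \<integral>x. f x * v (x + t) \<partial>lborel) \<longlongrightarrow> (\<integral>x. f x * v x \<partial>lborel)) (at 0)"
  unfolding tendsto_at_iff_sequentially
proof (intro allI impI)
  fix X :: "nat \<Rightarrow> 'a" assume X: "X \<longlonglongrightarrow> 0"
  define A where "A = (\<integral>x. (v x)\<^sup>2 \<partial>lborel)"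
  have A: "A \<ge> 0" unfolding A_def by simp
  have vt: "integrable lborel (\<lambda>x. (v (x + t))\<^sup>2)" "(\<integral>x. (v (x + t))\<^sup>2 \<partial>lborel) = A" for t
    using lborel_shift[of "\<lambda>x. (v x)\<^sup>2" t] v by (simp_all add: A_def)
  have "(\<lambda>n. \<integral>x. f x * v (x + X n) \<partial>lborel) \<longlonglongrightarrow> (\<integral>x. f x * v x \<partial>lborel)"
  proof (rule LIMSEQ_I)
    fix r :: real assume r: "r > 0"
    \<comment> \<open>This makes the Cauchy-Schwarz bound sqrt(e) sqrt(A) at most r/4; the summand 1
      covers the case A = 0.\<close>
    define e where "e = (r / 4 / (sqrt A + 1))\<^sup>2"
    have sA: "sqrt A + 1 > 0" using A by (simp add: add_nonneg_pos)
    have e: "e > 0" using r sA by (simp add: e_def)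
    obtain k M R where kc: "continuous_on UNIV k" and kb: "\<And>x. \<bar>k x\<bar> \<le> M" and k0: "\<And>x. norm x > R \<Longrightarrow> k x = 0"
      and ki: "integrable lborel (\<lambda>x. (f x - k x)\<^sup>2)" and ke: "(\<integral>x. (f x - k x)\<^sup>2 \<partial>lborel) < e"
      using L2_continuous_approx[OF _ f e] by auto
    have [measurable]: "k \<in> borel_measurable borel"
      using kc borel_measurable_continuous_onI by blast
    have k2: "integrable lborel (\<lambda>x. (k x)\<^sup>2)"
    proof -
      have "integrable lborel (\<lambda>x. (f x - (f x - k x))\<^sup>2)"
        by (rule integrable_square_diff) (use f ki in auto)
      then show ?thesis by simp
    qed
    have fk: "\<bar>\<integral>x. (f x - k x) * v (x + t) \<partial>lborel\<bar> \<le> r / 4" for t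
    proof -
      have "\<bar>\<integral>x. (f x - k x) * v (x + t) \<partial>lborel\<bar> \<le> sqrt (\<integral>x. (f x - k x)\<^sup>2 \<partial>lborel) * sqrt (\<integral>x. (v (x + t))\<^sup>2 \<partial>lborel)"
        by (rule abs_integral_mult_le_sqrt) (use ki vt in auto)
      also have "\<dots> \<le> sqrt e * sqrt A"
        unfolding vt using ke A by (intro mult_right_mono) auto
      also have "\<dots> = r / 4 * (sqrt A / (sqrt A + 1))"
        using r sA by (simp add: e_def)
      also have "\<dots> \<le> r / 4 * 1"
        using r sA A by (intro mult_left_mono) auto
      finally show ?thesis by simp
    qed
    have split: "(\<integral>x. f x * v (x + t) \<partial>lborel) = (\<integral>x. (f x - k x) * v (x + t) \<partial>lborel) + (\<integral>x. k x * v (x + t) \<partial>lborel)" for t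
    proof -
      have "integrable lborel (\<lambda>x. (f x - k x) * v (x + t))" "integrable lborel (\<lambda>x. k x * v (x + t))"
        by (rule integrable_mult_L2; use ki k2 vt in auto)+
      then show ?thesis by (subst Bochner_Integration.integral_add[symmetric]) (auto simp: algebra_simps)
    qed
    have kt: "(\<integral>x. k x * v (x + t) \<partial>lborel) = (\<integral>x. k (x - t) * v x \<partial>lborel)" for t
      using lborel_shift(2)[of "\<lambda>x. k (x - t) * v x" t] by simp
    have "(\<lambda>n. \<integral>x. k (x - X n) * v x \<partial>lborel) \<longlonglongrightarrow> (\<integral>x. k (x - 0) * v x \<partial>lborel)"
    proof -
      obtain B where B: "\<And>n. norm (X n) \<le> B"
        using X convergent_imp_Bseq[of X] by (auto simp: Bseq_def convergent_def)
      \<comment> \<open>\<open>B\<close> bounds the translations, so the ball of radius R + B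
        contains the supports of all translates of \<open>k\<close>.\<close>
      let ?w = "\<lambda>x. M * (indicator (cball 0 (R + B)) x * \<bar>v x\<bar>)"
      show ?thesis
      proof (rule integral_dominated_convergence[where w="?w"])
        have "emeasure lborel (cball 0 (R + B) :: 'a set) < \<infinity>"
          using emeasure_bounded_finite[OF bounded_cball] by auto
        then have "integrable lborel (\<lambda>x. (indicator (cball 0 (R + B) :: 'a set) x)\<^sup>2 :: real)"
          by (simp add: integrable_indicator_iff power2_eq_square flip: indicator_inter_arith)
        then show "integrable lborel ?w"
          using v by (intro integrable_mult_right integrable_mult_L2) (auto intro!: borel_measurable_indicator)
        show "AE x in lborel. (\<lambda>n. k (x - X n) * v x) \<longlonglongrightarrow> k (x - 0) * v x"
        proof (rule AE_I2)
          fix x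
          have "isCont k (x - 0)" using kc by (simp add: continuous_on_eq_continuous_at)
          then show "(\<lambda>n. k (x - X n) * v x) \<longlonglongrightarrow> k (x - 0) * v x"
            using X by (intro tendsto_intros isCont_tendsto_compose[of _ k])
        qed
        show "AE x in lborel. norm (k (x - X n) * v x) \<le> ?w x" for n
        proof (rule AE_I2)
          fix x
          show "norm (k (x - X n) * v x) \<le> ?w x"
          proof (cases "norm x \<le> R + B")
            case True
            then show ?thesis using mult_right_mono[OF kb, of "\<bar>v x\<bar>"] by (simp add: abs_mult)
          next
            case False
            then have "norm (x - X n) > R"
              using B[of n] norm_triangle_ineq2[of x "X n"] by linarith
            then show ?thesis using k0 kb[of 0] by simp
          qed
        qed
      qed auto
    qed
    then have "(\<lambda>n. \<integral>x. k x * v (x + X n) \<partial>lborel) \<longlonglongrightarrow> (\<integral>x. k x * v x \<partial>lborel)"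
      by (simp add: kt)
    then have "\<exists>N. \<forall>n\<ge>N. norm ((\<integral>x. k x * v (x + X n) \<partial>lborel) - (\<integral>x. k x * v x \<partial>lborel)) < r / 2"
      by (rule LIMSEQ_D) (use r in simp)
    then obtain N where N: "\<And>n. n \<ge> N \<Longrightarrow> \<bar>(\<integral>x. k x * v (x + X n) \<partial>lborel) - (\<integral>x. k x * v x \<partial>lborel)\<bar> < r / 2"
      by auto
    have "norm ((\<integral>x. f x * v (x + X n) \<partial>lborel) - (\<integral>x. f x * v x \<partial>lborel)) < r" if "n \<ge> N" for n
    proof -
      have abs: "\<bar>(p + q) - (p' + q')\<bar> < r" if "\<bar>p\<bar> \<le> r / 4" "\<bar>p'\<bar> \<le> r / 4" "\<bar>q - q'\<bar> < r / 2"
        for p q p' q' :: real using that r by linarith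
      show ?thesis
        unfolding real_norm_def split[of "X n"] split[of 0, unfolded add_0_right]
        using abs[OF fk[of "X n"] fk[of 0, unfolded add_0_right] N[OF that]] .
    qed
    then show "\<exists>N. \<forall>n\<ge>N. norm ((\<integral>x. f x * v (x + X n) \<partial>lborel) - (\<integral>x. f x * v x \<partial>lborel)) < r" by blast
  qed
  then show "((\<lambda>t. \<integral>x. f x * v (x + t) \<partial>lborel) \<circ> X) \<longlonglongrightarrow> (\<integral>x. f x * v x \<partial>lborel)"
    by (simp add: comp_def)
qed

section \<open>Integration by parts in the degenerate weighted spaces\<close>

text \<open>If every point with \<open>P\<close> exceeded the average, then \<open>f\<close> minus
  its average would have integral 0 over (u,v) and be positive almost everywhere there. With the
  function 0 in place of \<open>f\<close> the lemma just extracts a point with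
  \<open>P\<close>.\<close>

lemma exists_le_average:
  fixes f :: "real \<Rightarrow> real"
  assumes uv: "u < v" and f: "set_integrable lborel {u<..<v} f"
    and P: "AE x in lborel. u < x \<and> x < v \<longrightarrow> P x"
  obtains d where "u < d" "d < v" "P d" "(v - u) * f d \<le> (LINT x:{u<..<v}|lborel. f x)"
proof (rule ccontr)
  assume *: "\<not> thesis"
  define m where "m = (LINT x:{u<..<v}|lborel. f x) / (v - u)"
  have gt: "AE x in lborel. u < x \<and> x < v \<longrightarrow> m < f x"
    using P
  proof (rule AE_mp, intro AE_I2 impI)
    fix x assume "u < x \<and> x < v \<longrightarrow> P x" "u < x \<and> x < v"
    then have "\<not> (v - u) * f x \<le> (LINT x:{u<..<v}|lborel. f x)" using * that by blast
    then show "m < f x" using uv by (simp add: m_def field_simps)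
  qed
  let ?h = "\<lambda>x. indicator {u<..<v} x * f x - m * indicator {u<..<v} x"
  have h: "integrable lborel ?h"
    using f by (intro Bochner_Integration.integrable_diff integrable_mult_right)
      (simp_all add: set_integrable_def integrable_indicator_iff emeasure_lborel_Ioo[OF less_imp_le[OF uv]])
  have "(\<integral>x. ?h x \<partial>lborel) = 0"
    using f uv by (subst Bochner_Integration.integral_diff)
      (auto simp: set_integrable_def set_lebesgue_integral_def integrable_indicator_iff emeasure_lborel_Ioo[OF less_imp_le[OF uv]] m_def)
  moreover have "AE x in lborel. 0 \<le> ?h x"
    using gt by eventually_elim (auto split: split_indicator)
  ultimately have "AE x in lborel. ?h x = 0"
    using integral_nonneg_eq_0_iff_AE[OF h] by simp
  then have "AE x in lborel. x \<notin> {u<..<v}"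
    using gt by eventually_elim (auto split: split_indicator)
  then have "emeasure lborel {u<..<v} = 0"
    by (subst (asm) AE_iff_measurable[of "{u<..<v}"]) auto
  then show False using uv by simp
qed

lemma square_integral_interval_le:
  fixes f :: "real \<Rightarrow> real"
  assumes [measurable]: "f \<in> borel_measurable borel" and f: "integrable lborel (\<lambda>x. (f x)\<^sup>2)"
    and le: "c \<le> d" and A: "A \<in> sets borel" "A \<subseteq> {c..d}"
  shows "(\<integral>x. indicator A x * f x \<partial>lborel)\<^sup>2 \<le> (d - c) * (\<integral>x. indicator A x * (f x)\<^sup>2 \<partial>lborel)"
    and "integrable lborel (\<lambda>x. indicator A x * f x)"
proof -
  note A(1)[measurable]
  have [measurable]: "(\<lambda>x. indicator A x * f x) \<in> borel_measurable borel" by measurable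
  have i: "integrable lborel (\<lambda>x. (indicator {c..d} x :: real)\<^sup>2)"
    by (simp add: power2_eq_square integrable_indicator_iff emeasure_lborel_Icc_eq flip: indicator_inter_arith)
  have e: "(indicator A x * f x)\<^sup>2 = indicator A x * (f x)\<^sup>2" for x
    by (auto split: split_indicator)
  have g: "integrable lborel (\<lambda>x. (indicator A x * f x)\<^sup>2)"
    unfolding e using integrable_mult_indicator[of A lborel, OF _ f] by simp
  have e1: "indicator {c..d} x * (indicator A x * f x) = indicator A x * f x" for x
    using A by (auto split: split_indicator)
  have im: "(indicator {c..d} :: real \<Rightarrow> real) \<in> borel_measurable lborel" by simp
  show "integrable lborel (\<lambda>x. indicator A x * f x)"
    using integrable_mult_L2[OF im _ i g] unfolding e1 by simp
  have "\<bar>\<integral>x. indicator A x * f x \<partial>lborel\<bar> \<le> (\<integral>x. \<bar>indicator A x * f x\<bar> \<partial>lborel)"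
    by (rule integral_abs_bound)
  then have "(\<integral>x. indicator A x * f x \<partial>lborel)\<^sup>2 \<le> (\<integral>x. \<bar>indicator A x * f x\<bar> \<partial>lborel)\<^sup>2"
    by (metis abs_ge_zero power2_abs power_mono)
  also have "\<dots> \<le> (\<integral>x. (indicator {c..d} x :: real)\<^sup>2 \<partial>lborel) * (\<integral>x. (indicator A x * f x)\<^sup>2 \<partial>lborel)"
    using Cauchy_Schwarz_integral[OF im _ i g] unfolding e1 by simp
  also have "(\<integral>x. (indicator {c..d} x :: real)\<^sup>2 \<partial>lborel) = d - c"
    using le by (simp add: power2_eq_square flip: indicator_inter_arith)
  finally show "(\<integral>x. indicator A x * f x \<partial>lborel)\<^sup>2 \<le> (d - c) * (\<integral>x. indicator A x * (f x)\<^sup>2 \<partial>lborel)"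
    unfolding e .
qed

text \<open>\<open>H10_pair p q\<close>: \<open>p\<close> is in \<open>H\<^sup>1\<^sub>0(0,1)\<close> with derivative \<open>q\<close>; \<open>weak_deriv_pair q r\<close>: \<open>q\<close> is locally
  absolutely continuous in \<open>(0,1)\<close> with derivative \<open>r\<close>. All functions are extended by \<open>0\<close>.\<close>

definition H10_pair :: "(real \<Rightarrow> real) \<Rightarrow> (real \<Rightarrow> real) \<Rightarrow> bool" where
  "H10_pair p q \<longleftrightarrow> p \<in> borel_measurable borel \<and> q \<in> borel_measurable borel \<and>
     (\<forall>x. x \<notin> {0<..<1} \<longrightarrow> p x = 0 \<and> q x = 0) \<and> integrable lborel (\<lambda>x. (q x)\<^sup>2) \<and>
     (\<exists>P. primitive_on {0..1} q P \<and> P 0 = 0 \<and> P 1 = 0 \<and> (AE x in lborel. 0 < x \<and> x < 1 \<longrightarrow> p x = P x))"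

definition weak_deriv_pair :: "(real \<Rightarrow> real) \<Rightarrow> (real \<Rightarrow> real) \<Rightarrow> bool" where
  "weak_deriv_pair q r \<longleftrightarrow> r \<in> borel_measurable borel \<and> (\<forall>x. x \<notin> {0<..<1} \<longrightarrow> r x = 0) \<and>
     (\<exists>Q. primitive_on {0<..<1} r Q \<and> (AE x in lborel. 0 < x \<and> x < 1 \<longrightarrow> q x = Q x))"

lemma tendsto_0_if_square_le:
  fixes f :: "nat \<Rightarrow> real"
  assumes "\<And>n. (f n)\<^sup>2 \<le> g n" and g: "g \<longlonglongrightarrow> 0"
  shows "f \<longlonglongrightarrow> 0"
proof (rule tendsto_rabs_zero_cancel, rule tendsto_sandwich[OF _ _ tendsto_const])
  show "(\<lambda>n. sqrt (g n)) \<longlonglongrightarrow> 0" using tendsto_real_sqrt[OF g] by simp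
  show "\<forall>\<^sub>F n in sequentially. \<bar>f n\<bar> \<le> sqrt (g n)"
    using assms(1) by (intro always_eventually allI real_le_rsqrt) simp
qed simp

lemma shrinking_integral_tendsto_0:
  fixes f :: "real \<Rightarrow> real"
  assumes f: "integrable lborel f" and A: "\<And>n. A n \<in> sets borel"
    and *: "\<And>x. eventually (\<lambda>n. x \<notin> A n) sequentially"
  shows "(\<lambda>n. \<integral>x. indicator (A n) x * f x \<partial>lborel) \<longlonglongrightarrow> 0"
proof -
  have [measurable]: "A n \<in> sets borel" for n by (rule A)
  have "(\<lambda>n. \<integral>x. indicator (A n) x * f x \<partial>lborel) \<longlonglongrightarrow> (\<integral>x. 0 \<partial>(lborel :: real measure))"
  proof (rule integral_dominated_convergence[where w="\<lambda>x. norm (f x)"])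
    show "AE x in lborel. (\<lambda>n. indicator (A n) x * f x) \<longlonglongrightarrow> 0"
    proof (rule AE_I2)
      fix x
      have "\<forall>\<^sub>F n in sequentially. indicator (A n) x * f x = 0"
        using *[of x] by eventually_elim simp
      then show "(\<lambda>n. indicator (A n) x * f x) \<longlonglongrightarrow> 0" by (rule tendsto_eventually)
    qed
    show "(\<lambda>x. indicator (A n) x * f x) \<in> borel_measurable lborel" for n
      using f by measurable
  qed (use f in \<open>auto split: split_indicator\<close>)
  then show ?thesis by simp
qed

text \<open>The boundary terms vanish along suitable sequences: near an end point \<open>e\<close> the factor from
  \<open>H\<^sup>1\<^sub>0\<close> is \<open>O(\<bar>x - e\<bar>\<^bsup>1/2\<^esup>)\<close>, while \<open>\<bar>x - e\<bar> (q x)\<^sup>2\<close> has lower limit \<open>0\<close> for integrable \<open>q\<^sup>2\<close>.\<close>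

lemma H10_integration_by_parts:
  assumes p: "H10_pair p p'" and q: "q \<in> borel_measurable borel" "integrable lborel (\<lambda>x. (q x)\<^sup>2)"
      "\<And>x. x \<notin> {0<..<1} \<Longrightarrow> q x = 0"
    and r: "weak_deriv_pair q r" and rp: "integrable lborel (\<lambda>x. r x * p x)"
  shows "(\<integral>x. r x * p x \<partial>lborel) = - (\<integral>x. q x * p' x \<partial>lborel)"
proof -
  have [measurable]: "p \<in> borel_measurable borel" "p' \<in> borel_measurable borel" "q \<in> borel_measurable borel"
    "r \<in> borel_measurable borel"
    using p q r by (auto simp: H10_pair_def weak_deriv_pair_def)
  have p'2: "integrable lborel (\<lambda>x. (p' x)\<^sup>2)" and z: "\<And>x. x \<notin> {0<..<1} \<Longrightarrow> p x = 0 \<and> p' x = 0"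
    using p by (auto simp: H10_pair_def)
  obtain P where P: "primitive_on {0..1} p' P" "P 0 = 0" "P 1 = 0" "AE x in lborel. 0 < x \<and> x < 1 \<longrightarrow> p x = P x"
    using p by (auto simp: H10_pair_def)
  obtain Q where Q: "primitive_on {0<..<1} r Q" "AE x in lborel. 0 < x \<and> x < 1 \<longrightarrow> q x = Q x"
    using r by (auto simp: weak_deriv_pair_def)
  define E where "E = (\<integral>x. (p' x)\<^sup>2 \<partial>lborel)"
  define h where "h x = r x * p x + q x * p' x" for x
  have qp: "integrable lborel (\<lambda>x. q x * p' x)" by (rule integrable_mult_L2) (use q p'2 in auto)
  have hi: "integrable lborel h" unfolding h_def using rp qp by simp
  have E0: "E \<ge> 0" by (simp add: E_def)
  \<comment> \<open>Cauchy-Schwarz makes \<open>P\<close> Hoelder continuous with exponent 1/2; this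
    is its decay at the two end points.\<close>
  have inc: "(P d - P c)\<^sup>2 \<le> (d - c) * E" if "0 \<le> c" "c \<le> d" "d \<le> 1" for c d
  proof -
    have "P d - P c = (\<integral>x. indicator {c..d} x * p' x \<partial>lborel)"
      using primitive_onD(2)[OF P(1), of c d] that by (simp add: set_lebesgue_integral_def)
    then have "(P d - P c)\<^sup>2 \<le> (d - c) * (\<integral>x. indicator {c..d} x * (p' x)\<^sup>2 \<partial>lborel)"
      using square_integral_interval_le(1)[OF _ p'2, of c d "{c..d}"] that by simp
    also have "\<dots> \<le> (d - c) * E"
    proof (rule mult_left_mono)
      show "(\<integral>x. indicator {c..d} x * (p' x)\<^sup>2 \<partial>lborel) \<le> E"
        unfolding E_def
        using p'2 integrable_mult_indicator[of "{c..d}" lborel, OF _ p'2]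
        by (intro integral_mono) (auto split: split_indicator)
    qed (use that in simp)
    finally show ?thesis .
  qed
  define \<epsilon> where "\<epsilon> A = (\<integral>x. indicator A x * (q x)\<^sup>2 \<partial>lborel)" for A
  \<comment> \<open>A point at which Q^2 is at most the mean of q^2 over (u,v). The integral of q^2
    on the right tends to 0 as the interval shrinks to an end point.\<close>
  have sel: "\<exists>d. u < d \<and> d < v \<and> (v - u) * (Q d)\<^sup>2 \<le> \<epsilon> {u<..<v}" if uv: "0 \<le> u" "u < v" "v \<le> 1" for u v
  proof -
    have "set_integrable lborel {u<..<v} (\<lambda>x. (q x)\<^sup>2)"
      using integrable_mult_indicator[of "{u<..<v}" lborel, OF _ q(2)] by (simp add: set_integrable_def)
    moreover have "AE x in lborel. u < x \<and> x < v \<longrightarrow> q x = Q x"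
      using Q(2) uv by (auto elim!: eventually_mono)
    ultimately obtain d where "u < d" "d < v" "q d = Q d" "(v - u) * (q d)\<^sup>2 \<le> (LINT x:{u<..<v}|lborel. (q x)\<^sup>2)"
      using exists_le_average[OF uv(2), of "\<lambda>x. (q x)\<^sup>2" "\<lambda>x. q x = Q x"] by blast
    then show ?thesis by (auto simp: \<epsilon>_def set_lebesgue_integral_def)
  qed
  \<comment> \<open>The double \<open>Suc\<close> gives \<open>\<delta> n \<le> 1 / 2\<close>, so
    that \<open>c n < \<delta> n \<le> 1 - \<delta> n < d n\<close>.\<close>
  define \<delta> where "\<delta> n = inverse (real (Suc (Suc n)))" for n
  have \<delta>: "0 < \<delta> n" "\<delta> n \<le> 1 / 2" for n by (auto simp: \<delta>_def field_simps)
  have \<delta>0: "\<delta> \<longlonglongrightarrow> 0" unfolding \<delta>_def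
    using LIMSEQ_inverse_real_of_nat by (rule LIMSEQ_Suc)
  have "\<forall>n. \<exists>d. 1 - \<delta> n < d \<and> d < 1 \<and> \<delta> n * (Q d)\<^sup>2 \<le> \<epsilon> {1 - \<delta> n<..<1}"
    using sel[of "1 - \<delta> n" 1 for n] \<delta> by (intro allI) (smt (verit) field_sum_of_halves)
  then obtain d where d: "\<And>n. 1 - \<delta> n < d n" "\<And>n. d n < 1" "\<And>n. \<delta> n * (Q (d n))\<^sup>2 \<le> \<epsilon> {1 - \<delta> n<..<1}"
    by metis
  have "\<forall>n. \<exists>c. 0 < c \<and> c < \<delta> n \<and> \<delta> n * (Q c)\<^sup>2 \<le> \<epsilon> {0<..<\<delta> n}"
    using sel[of 0 "\<delta> n" for n] \<delta> by (intro allI) (smt (verit) field_sum_of_halves)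
  then obtain c where c: "\<And>n. 0 < c n" "\<And>n. c n < \<delta> n" "\<And>n. \<delta> n * (Q (c n))\<^sup>2 \<le> \<epsilon> {0<..<\<delta> n}"
    by metis
  have cd: "c n \<le> d n" for n using c(2)[of n] d(1)[of n] \<delta>[of n] by linarith
  have ev: "\<forall>\<^sub>F n in sequentially. \<delta> n < e" if "e > 0" for e
    using order_tendstoD(2)[OF \<delta>0 that] .
  have \<epsilon>d: "(\<lambda>n. \<epsilon> {1 - \<delta> n<..<1}) \<longlonglongrightarrow> 0"
    unfolding \<epsilon>_def
  proof (rule shrinking_integral_tendsto_0[OF q(2)])
    show "\<forall>\<^sub>F n in sequentially. x \<notin> {1 - \<delta> n<..<1}" for x
    proof (cases "x < 1")
      case True
      with ev[of "1 - x"] show ?thesis by (auto elim!: eventually_mono)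
    qed auto
  qed auto
  have \<epsilon>c: "(\<lambda>n. \<epsilon> {0<..<\<delta> n}) \<longlonglongrightarrow> 0"
    unfolding \<epsilon>_def
  proof (rule shrinking_integral_tendsto_0[OF q(2)])
    show "\<forall>\<^sub>F n in sequentially. x \<notin> {0<..<\<delta> n}" for x
    proof (cases "x > 0")
      case True
      with ev[of x] show ?thesis by (auto elim!: eventually_mono)
    qed auto
  qed auto
  \<comment> \<open>The length \<open>\<delta> n\<close> cancels: P^2 contributes a factor \<delta>
    and Q^2 a factor \<epsilon> / \<delta>.\<close>
  have bd: "(\<lambda>n. Q (d n) * P (d n)) \<longlonglongrightarrow> 0"
  proof -
    have "(Q (d n) * P (d n))\<^sup>2 \<le> \<epsilon> {1 - \<delta> n<..<1} * E" for n
    proof -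
      have "(P (d n))\<^sup>2 \<le> (1 - d n) * E" using inc[of "d n" 1] P(3) d(1,2)[of n] \<delta>[of n] by auto
      also have "\<dots> \<le> \<delta> n * E" using d(1)[of n] E0 by (intro mult_right_mono) auto
      finally have "(Q (d n))\<^sup>2 * (P (d n))\<^sup>2 \<le> (Q (d n))\<^sup>2 * (\<delta> n * E)" by (rule mult_left_mono) simp
      also have "\<dots> = (\<delta> n * (Q (d n))\<^sup>2) * E" by simp
      also have "\<dots> \<le> \<epsilon> {1 - \<delta> n<..<1} * E" using d(3) E0 by (rule mult_right_mono)
      finally show ?thesis by (simp add: power_mult_distrib)
    qed
    then show ?thesis by (rule tendsto_0_if_square_le[OF _ tendsto_mult_left_zero[OF \<epsilon>d]])
  qed
  have bc: "(\<lambda>n. Q (c n) * P (c n)) \<longlonglongrightarrow> 0"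
  proof -
    have "(Q (c n) * P (c n))\<^sup>2 \<le> \<epsilon> {0<..<\<delta> n} * E" for n
    proof -
      have "(P (c n))\<^sup>2 \<le> c n * E" using inc[of 0 "c n"] P(2) c(1,2)[of n] \<delta>[of n] by auto
      also have "\<dots> \<le> \<delta> n * E" using c(2)[of n] E0 by (intro mult_right_mono) auto
      finally have "(Q (c n))\<^sup>2 * (P (c n))\<^sup>2 \<le> (Q (c n))\<^sup>2 * (\<delta> n * E)" by (rule mult_left_mono) simp
      also have "\<dots> = (\<delta> n * (Q (c n))\<^sup>2) * E" by simp
      also have "\<dots> \<le> \<epsilon> {0<..<\<delta> n} * E" using c(3) E0 by (rule mult_right_mono)
      finally show ?thesis by (simp add: power_mult_distrib)
    qed
    then show ?thesis by (rule tendsto_0_if_square_le[OF _ tendsto_mult_left_zero[OF \<epsilon>c]])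
  qed
  have hn: "(\<integral>x. indicator {c n..d n} x * h x \<partial>lborel) = Q (d n) * P (d n) - Q (c n) * P (c n)" for n
  proof -
    have P': "primitive_on {0<..<1} p' P" by (rule primitive_on_subset[OF P(1)]) auto
    have "Q (d n) * P (d n) - Q (c n) * P (c n) = (LINT x:{c n..d n}|lborel. r x * P x + Q x * p' x)"
      using c(1)[of n] d(2)[of n] cd[of n]
      by (intro primitive_onD(2)[OF primitive_mult[OF Q(1) P'], symmetric]) (auto simp: is_interval_oo)
    also have "\<dots> = (\<integral>x. indicator {c n..d n} x * h x \<partial>lborel)"
      unfolding set_lebesgue_integral_def real_scaleR_def
    proof (rule integral_cong_AE)
      show "AE x in lborel. indicator {c n..d n} x * (r x * P x + Q x * p' x) = indicator {c n..d n} x * h x"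
        using P(4) Q(2) by eventually_elim
          (use c(1)[of n] d(2)[of n] in \<open>auto simp: h_def split: split_indicator\<close>)
      show "(\<lambda>x. indicator {c n..d n} x * (r x * P x + Q x * p' x)) \<in> borel_measurable lborel"
        using primitive_onD(1)[OF primitive_mult[OF Q(1) P'], of "c n" "d n"] c(1)[of n] d(2)[of n] cd[of n]
        by (auto simp: set_integrable_def is_interval_oo)
      show "(\<lambda>x. indicator {c n..d n} x * h x) \<in> borel_measurable lborel"
        unfolding h_def by measurable
    qed
    finally show ?thesis by simp
  qed
  \<comment> \<open>Since \<open>h\<close> vanishes outside (0,1), its total integral differs from
    the one over [c n, d n] by an integral over sets that every point eventually leaves.\<close>
  have "(\<lambda>n. \<integral>x. indicator (- {c n..d n} \<inter> {0<..<1}) x * h x \<partial>lborel) \<longlonglongrightarrow> 0"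
  proof (rule shrinking_integral_tendsto_0[OF hi])
    show "\<forall>\<^sub>F n in sequentially. x \<notin> - {c n..d n} \<inter> {0<..<1}" for x
    proof (cases "x \<in> {0<..<1}")
      case True
      then have "\<forall>\<^sub>F n in sequentially. \<delta> n < min x (1 - x)" by (intro ev) auto
      then show ?thesis
      proof (rule eventually_mono)
        fix n assume "\<delta> n < min x (1 - x)"
        then show "x \<notin> - {c n..d n} \<inter> {0<..<1}" using c(2)[of n] d(1)[of n] by auto
      qed
    qed auto
  qed auto
  moreover have "(\<integral>x. indicator (- {c n..d n} \<inter> {0<..<1}) x * h x \<partial>lborel)
      = (\<integral>x. h x \<partial>lborel) - (Q (d n) * P (d n) - Q (c n) * P (c n))" for n
  proof -
    have "(\<integral>x. h x \<partial>lborel) - (\<integral>x. indicator {c n..d n} x * h x \<partial>lborel)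
        = (\<integral>x. h x - indicator {c n..d n} x * h x \<partial>lborel)"
      using hi integrable_mult_indicator[of "{c n..d n}" lborel, OF _ hi]
      by (intro Bochner_Integration.integral_diff[symmetric]) auto
    also have "\<dots> = (\<integral>x. indicator (- {c n..d n} \<inter> {0<..<1}) x * h x \<partial>lborel)"
    proof (intro Bochner_Integration.integral_cong refl)
      fix x
      show "h x - indicator {c n..d n} x * h x = indicator (- {c n..d n} \<inter> {0<..<1}) x * h x"
        using z[of x] q(3)[of x] by (cases "x \<in> {0<..<1}") (auto simp: h_def split: split_indicator)
    qed
    finally show ?thesis unfolding hn by simp
  qed
  ultimately have "(\<lambda>n. (\<integral>x. h x \<partial>lborel) - (Q (d n) * P (d n) - Q (c n) * P (c n))) \<longlonglongrightarrow> 0" by simp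
  moreover have "(\<lambda>n. (\<integral>x. h x \<partial>lborel) - (Q (d n) * P (d n) - Q (c n) * P (c n))) \<longlonglongrightarrow> (\<integral>x. h x \<partial>lborel) - (0 - 0)"
    by (intro tendsto_intros bd bc)
  ultimately have "(\<integral>x. h x \<partial>lborel) = 0" using LIMSEQ_unique by fastforce
  then show ?thesis unfolding h_def using rp qp by simp
qed

section \<open>Evolution in the weighted space\<close>

lemma Fubini_plane_snd:
  fixes f :: "real \<times> real \<Rightarrow> real"
  assumes f: "integrable lborel f"
  shows "AE t in lborel. integrable lborel (\<lambda>x. f (x, t))"
    and "integrable lborel (\<lambda>t. \<integral>x. f (x, t) \<partial>lborel)"
    and "(\<integral>t. \<integral>x. f (x, t) \<partial>lborel \<partial>lborel) = (\<integral>z. f z \<partial>lborel)"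
proof -
  have *: "integrable (lborel \<Otimes>\<^sub>M lborel) (\<lambda>(x, t). f (x, t))" using f by (simp add: lborel_prod)
  show "AE t in lborel. integrable lborel (\<lambda>x. f (x, t))" by (rule lborel_pair.AE_integrable_snd[OF *])
  show "integrable lborel (\<lambda>t. \<integral>x. f (x, t) \<partial>lborel)" by (rule lborel_pair.integrable_snd[OF *])
  show "(\<integral>t. \<integral>x. f (x, t) \<partial>lborel \<partial>lborel) = (\<integral>z. f z \<partial>lborel)"
    using lborel_pair.integral_snd[OF *] by (simp add: lborel_prod)
qed

lemma Fubini_plane_fst:
  fixes f :: "real \<times> real \<Rightarrow> real"
  assumes f: "integrable lborel f"
  shows "AE x in lborel. integrable lborel (\<lambda>t. f (x, t))"
    and "integrable lborel (\<lambda>x. \<integral>t. f (x, t) \<partial>lborel)"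
    and "(\<integral>x. \<integral>t. f (x, t) \<partial>lborel \<partial>lborel) = (\<integral>z. f z \<partial>lborel)"
proof -
  have *: "integrable (lborel \<Otimes>\<^sub>M lborel) f" using f by (simp add: lborel_prod)
  show "AE x in lborel. integrable lborel (\<lambda>t. f (x, t))" by (rule lborel_pair.AE_integrable_fst'[OF *])
  show "integrable lborel (\<lambda>x. \<integral>t. f (x, t) \<partial>lborel)" by (rule lborel_pair.integrable_fst'[OF *])
  show "(\<integral>x. \<integral>t. f (x, t) \<partial>lborel \<partial>lborel) = (\<integral>z. f z \<partial>lborel)"
    using lborel_pair.integral_fst'[OF *] by (simp add: lborel_prod)
qed

text \<open>Exchanging the order of the two quantifiers needs a measurable set, and the exceptions
  to \<open>P\<close> need not form one; the exchange is made for a measurable null set that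
  contains them.\<close>

lemma AE_plane:
  fixes P :: "real \<times> real \<Rightarrow> bool"
  assumes "AE z in lborel. P z"
  shows "AE x in lborel. AE t in lborel. P (x, t)" and "AE t in lborel. AE x in lborel. P (x, t)"
proof -
  have P: "AE z in lborel \<Otimes>\<^sub>M lborel. P z" unfolding lborel_prod by (rule assms)
  show "AE x in lborel. AE t in lborel. P (x, t)" by (rule lborel_pair.AE_pair[OF P])
  obtain N where N: "N \<in> null_sets (lborel \<Otimes>\<^sub>M lborel :: (real \<times> real) measure)" "{z. \<not> P z} \<subseteq> N"
    using P by (auto simp: eventually_ae_filter space_pair_measure)
  then have [measurable]: "N \<in> sets (lborel \<Otimes>\<^sub>M lborel)" by auto
  have "AE z in lborel \<Otimes>\<^sub>M lborel. z \<notin> N" using N(1) by (rule AE_not_in)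
  then have "AE x in lborel. AE t in lborel. (x, t) \<notin> N" by (rule lborel_pair.AE_pair)
  moreover have "space (lborel \<Otimes>\<^sub>M lborel) - N \<in> sets (lborel \<Otimes>\<^sub>M lborel)"
    using N(1) by (intro sets.compl_sets null_setsD2)
  then have "{z \<in> space (lborel \<Otimes>\<^sub>M lborel). (fst z, snd z) \<notin> N} \<in> sets (lborel \<Otimes>\<^sub>M lborel)"
    unfolding prod.collapse set_diff_eq .
  ultimately have "AE t in lborel. AE x in lborel. (x, t) \<notin> N"
    using lborel_pair.AE_commute[of "\<lambda>x t. (x, t) \<notin> N"] by blast
  then show "AE t in lborel. AE x in lborel. P (x, t)"
  proof eventually_elim
    case (elim t)
    then show ?case by eventually_elim (use N(2) in auto)
  qed
qed

lemma Pair_measurable_fst: "f \<in> borel_measurable borel \<Longrightarrow> (\<lambda>x. f (x, t)) \<in> borel_measurable borel"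
  for f :: "real \<times> real \<Rightarrow> real"
  by (rule measurable_compose[of "\<lambda>x. (x, t)" borel borel]) (simp_all add: borel_prod[symmetric])

lemma Pair_measurable_snd: "f \<in> borel_measurable borel \<Longrightarrow> (\<lambda>t. f (x, t)) \<in> borel_measurable borel"
  for f :: "real \<times> real \<Rightarrow> real"
  by (rule measurable_compose[of "\<lambda>t. (x, t)" borel borel]) (simp_all add: borel_prod[symmetric])

lemma snd_measurable: "f \<in> borel_measurable borel \<Longrightarrow> (\<lambda>z :: real \<times> real. f (snd z)) \<in> borel_measurable borel"
  for f :: "real \<Rightarrow> real"
  by (rule measurable_compose[of snd borel borel]) (simp_all add: borel_measurable_continuous_onI continuous_on_snd)

lemma fst_measurable: "f \<in> borel_measurable borel \<Longrightarrow> (\<lambda>z :: real \<times> real. f (fst z)) \<in> borel_measurable borel"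
  for f :: "real \<Rightarrow> real"
  by (rule measurable_compose[of fst borel borel]) (simp_all add: borel_measurable_continuous_onI continuous_on_fst)

lemma tail_integral_measurable:
  fixes V :: "real \<times> real \<Rightarrow> real"
  assumes "V \<in> borel_measurable borel"
  shows "(\<lambda>z. \<integral>\<tau>. indicator {snd z..} \<tau> * V (fst z, \<tau>) \<partial>lborel) \<in> borel_measurable borel"
proof -
  have V_meas': "V \<in> borel_measurable (lborel \<Otimes>\<^sub>M lborel)" using assms by (simp add: lborel_prod)
  let ?M = "(lborel \<Otimes>\<^sub>M lborel) \<Otimes>\<^sub>M lborel :: ((real \<times> real) \<times> real) measure"
  have S: "{z \<in> space ?M. snd (fst z) \<le> snd z} \<in> sets ?M"
    by (rule borel_measurable_le) measurable
  have "(\<lambda>w. (fst (fst w), snd w)) \<in> measurable ?M (lborel \<Otimes>\<^sub>M lborel)" by measurable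
  then have "(\<lambda>w. V (fst (fst w), snd w)) \<in> borel_measurable ?M"
    using V_meas' by (rule measurable_compose)
  then have "(\<lambda>w. if snd (fst w) \<le> snd w then V (fst (fst w), snd w) else 0) \<in> borel_measurable ?M"
    by (rule measurable_If[OF _ borel_measurable_const S])
  then have "(\<lambda>z. \<integral>\<tau>. (if snd z \<le> \<tau> then V (fst z, \<tau>) else 0) \<partial>lborel) \<in> borel_measurable (lborel \<Otimes>\<^sub>M lborel)"
    by (intro lborel.borel_measurable_lebesgue_integral) (simp only: case_prod_beta')
  then have "(\<lambda>z. \<integral>\<tau>. (if snd z \<le> \<tau> then V (fst z, \<tau>) else 0) \<partial>lborel) \<in> borel_measurable (borel \<Otimes>\<^sub>M borel)"
    by (simp add: lborel_prod borel_prod)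
  moreover have "(\<integral>\<tau>. (if snd z \<le> \<tau> then V (fst z, \<tau>) else 0) \<partial>lborel)
     = (\<integral>\<tau>. indicator {snd z..} \<tau> * V (fst z, \<tau>) \<partial>lborel)" for z :: "real \<times> real"
    by (intro Bochner_Integration.integral_cong) (auto split: split_indicator)
  ultimately have "(\<lambda>z. \<integral>\<tau>. indicator {snd z..} \<tau> * V (fst z, \<tau>) \<partial>lborel) \<in> borel_measurable (borel \<Otimes>\<^sub>M borel)"
    by (simp only:)
  then show ?thesis by (simp add: borel_prod)
qed

text \<open>For fixed x the weight is a positive constant and drops out, and on the bounded interval
  [0,T] square integrability implies integrability.\<close>

lemma weighted_slice_integrable:
  fixes f :: "real \<times> real \<Rightarrow> real" and a :: "real \<Rightarrow> real"
  assumes T: "0 < T" and a: "\<And>x. 0 < a x" and m: "f \<in> borel_measurable borel"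
    and i: "integrable lborel (\<lambda>z. (f z)\<^sup>2 / a (fst z))" and z: "\<And>x t. \<not> (0 < t \<and> t < T) \<Longrightarrow> f (x, t) = 0"
  shows "AE x in lborel. integrable lborel (\<lambda>t. (f (x, t))\<^sup>2) \<and> integrable lborel (\<lambda>t. f (x, t))"
  using Fubini_plane_fst(1)[OF i]
proof eventually_elim
  case (elim x)
  have [measurable]: "(\<lambda>t. f (x, t)) \<in> borel_measurable borel" by (rule Pair_measurable_snd[OF m])
  have "integrable lborel (\<lambda>t. a x * ((f (x, t))\<^sup>2 / a x))" using elim by (intro integrable_mult_right) simp
  then have 1: "integrable lborel (\<lambda>t. (f (x, t))\<^sup>2)" using a[of x] by simp
  have "integrable lborel (\<lambda>t. indicator {0..T} t * f (x, t))"
    by (rule square_integral_interval_le(2)[OF _ 1, of 0 T]) (use T in auto)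
  moreover have "indicator {0..T} t * f (x, t) = f (x, t)" for t
    using z[of t x] by (auto split: split_indicator)
  ultimately show ?case using 1 by simp
qed

lemma tail_integral_diff:
  fixes f :: "real \<Rightarrow> real"
  assumes f: "integrable lborel f" and le: "s \<le> t"
  shows "(c - (\<integral>\<tau>. indicator {t..} \<tau> * f \<tau> \<partial>lborel)) - (c - (\<integral>\<tau>. indicator {s..} \<tau> * f \<tau> \<partial>lborel))
    = (\<integral>\<tau>. indicator {s..<t} \<tau> * f \<tau> \<partial>lborel)"
proof -
  have i: "integrable lborel (\<lambda>\<tau>. indicator {u..} \<tau> * f \<tau>)" for u
    using f integrable_mult_indicator[of "{u..}" lborel f] by simp
  have "(\<integral>\<tau>. indicator {s..} \<tau> * f \<tau> \<partial>lborel) - (\<integral>\<tau>. indicator {t..} \<tau> * f \<tau> \<partial>lborel)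
      = (\<integral>\<tau>. indicator {s..} \<tau> * f \<tau> - indicator {t..} \<tau> * f \<tau> \<partial>lborel)"
    by (rule Bochner_Integration.integral_diff[OF i i, symmetric])
  also have "\<dots> = (\<integral>\<tau>. indicator {s..<t} \<tau> * f \<tau> \<partial>lborel)"
    using le by (intro Bochner_Integration.integral_cong) (auto split: split_indicator)
  finally show ?thesis by simp
qed

lemma primitive_tail_integral:
  fixes f :: "real \<Rightarrow> real"
  assumes f: "integrable lborel f"
  shows "primitive_on UNIV f (\<lambda>t. c - (\<integral>\<tau>. indicator {t..} \<tau> * f \<tau> \<partial>lborel))"
  unfolding primitive_on_def
proof (intro ballI impI conjI)
  fix s t :: real assume st: "s \<le> t"
  show "set_integrable lborel {s..t} f"
    using integrable_mult_indicator[of "{s..t}" lborel, OF _ f] by (simp add: set_integrable_def)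
  have "(\<integral>\<tau>. indicator {s..<t} \<tau> * f \<tau> \<partial>lborel) = (\<integral>\<tau>. indicator {s..t} \<tau> * f \<tau> \<partial>lborel)"
  proof (rule integral_cong_AE)
    show "AE \<tau> in lborel. indicator {s..<t} \<tau> * f \<tau> = indicator {s..t} \<tau> * f \<tau>"
      using AE_lborel_singleton[of t] by eventually_elim (auto split: split_indicator)
  qed (use f in measurable)
  then show "(c - (\<integral>\<tau>. indicator {t..} \<tau> * f \<tau> \<partial>lborel)) - (c - (\<integral>\<tau>. indicator {s..} \<tau> * f \<tau> \<partial>lborel))
      = (LINT \<tau>:{s..t}|lborel. f \<tau>)"
    unfolding tail_integral_diff[OF f st] set_lebesgue_integral_def by simp
qed

text \<open>\<open>X\<close>, \<open>Y\<close> and \<open>V\<close> play the roles of Z_x, Z_xx and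
  Z_t, and \<open>g\<close> that of the value at time T. The assumption \<open>time\<close> is the
  integrated form of Z_t = V. Membership of \<open>g\<close> in H^1_0 is not assumed but derived in
  \<open>final_trace_H10\<close>. The locale serves twice: for the solution and for its product with
  the Carleman weight.\<close>

locale evolution_setting =
  fixes a :: "real \<Rightarrow> real" and T :: real and Z X Y V :: "real \<times> real \<Rightarrow> real" and g :: "real \<Rightarrow> real"
  assumes T: "0 < T"
    and a_meas[measurable]: "a \<in> borel_measurable borel" and a_pos: "\<And>x. 0 < a x"
    and Z_meas[measurable]: "Z \<in> borel_measurable borel" and X_meas[measurable]: "X \<in> borel_measurable borel"
    and Y_meas[measurable]: "Y \<in> borel_measurable borel" and V_meas[measurable]: "V \<in> borel_measurable borel"
    and g_meas[measurable]: "g \<in> borel_measurable borel"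
    and supp: "\<And>x t. \<not> (0 < x \<and> x < 1 \<and> 0 < t \<and> t < T) \<Longrightarrow> Z (x, t) = 0 \<and> X (x, t) = 0 \<and> Y (x, t) = 0 \<and> V (x, t) = 0"
    and g_supp: "\<And>x. \<not> (0 < x \<and> x < 1) \<Longrightarrow> g x = 0"
    and Z_int: "integrable lborel (\<lambda>z. (Z z)\<^sup>2 / a (fst z))"
    and X_int: "integrable lborel (\<lambda>z. (X z)\<^sup>2)"
    and Y_int: "integrable lborel (\<lambda>z. a (fst z) * (Y z)\<^sup>2)"
    and V_int: "integrable lborel (\<lambda>z. (V z)\<^sup>2 / a (fst z))"
    and space: "AE t in lborel. 0 < t \<and> t < T \<longrightarrow>
      H10_pair (\<lambda>x. Z (x, t)) (\<lambda>x. X (x, t)) \<and> weak_deriv_pair (\<lambda>x. X (x, t)) (\<lambda>x. Y (x, t))"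
    and time: "AE z in lborel. fst z \<in> {0<..<1} \<and> snd z \<in> {0<..<T} \<longrightarrow>
      Z z = g (fst z) - (\<integral>\<tau>. indicator {snd z..} \<tau> * V (fst z, \<tau>) \<partial>lborel)"
begin

text \<open>The representative of \<open>Z\<close> that is defined for every t and, for almost every
  x, absolutely continuous in t. It equals \<open>g\<close> for all t \<ge> T because
  \<open>V\<close> vanishes from T on.\<close>

definition Zc :: "real \<Rightarrow> real \<Rightarrow> real" where
  "Zc t x = g x - (\<integral>\<tau>. indicator {t..} \<tau> * V (x, \<tau>) \<partial>lborel)"

definition e :: "real \<Rightarrow> real" where "e t = (\<integral>x. (X (x, t))\<^sup>2 \<partial>lborel)"
definition N :: "real \<Rightarrow> real" where "N t = (\<integral>x. a x * (Y (x, t))\<^sup>2 \<partial>lborel)"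
definition v :: "real \<Rightarrow> real" where "v t = (\<integral>x. (V (x, t))\<^sup>2 / a x \<partial>lborel)"

text \<open>Times at which the slice of \<open>Z\<close> may be replaced by \<open>Zc t\<close> and
  integration by parts against \<open>Y\<close> is available. Almost every time in (0,T) is good,
  and the energy arguments compare good times with each other.\<close>

definition good :: "real \<Rightarrow> bool" where
  "good t \<longleftrightarrow> 0 < t \<and> t < T \<and> H10_pair (Zc t) (\<lambda>x. X (x, t)) \<and>
     weak_deriv_pair (\<lambda>x. X (x, t)) (\<lambda>x. Y (x, t)) \<and>
     integrable lborel (\<lambda>x. a x * (Y (x, t))\<^sup>2) \<and> integrable lborel (\<lambda>x. (Zc t x)\<^sup>2 / a x)"

section \<open>Continuity in time with values in the weighted space\<close>

lemma Zc_plane_meas: "(\<lambda>z. Zc (snd z) (fst z)) \<in> borel_measurable borel"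
  unfolding Zc_def by (intro borel_measurable_diff tail_integral_measurable[OF V_meas] fst_measurable[OF g_meas])

lemma Zc_meas[measurable]: "Zc t \<in> borel_measurable borel"
  using Pair_measurable_fst[OF Zc_plane_meas, of t] by simp

lemma V_slice:
  "AE x in lborel. integrable lborel (\<lambda>t. (V (x, t))\<^sup>2) \<and> integrable lborel (\<lambda>t. V (x, t))"
  by (rule weighted_slice_integrable[OF T a_pos V_meas V_int]) (use supp in auto)

lemma Zc_at_T: "T \<le> t \<Longrightarrow> Zc t x = g x"
proof -
  assume "T \<le> t"
  then have "indicator {t..} \<tau> * V (x, \<tau>) = 0" for \<tau> using supp[of x \<tau>] by (auto split: split_indicator)
  then have "(\<integral>\<tau>. indicator {t..} \<tau> * V (x, \<tau>) \<partial>lborel) = (\<integral>\<tau>. 0 \<partial>(lborel :: real measure))"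
    by (intro Bochner_Integration.integral_cong refl)
  then show ?thesis by (simp add: Zc_def)
qed

lemma Zc_diff:
  assumes "integrable lborel (\<lambda>\<tau>. V (x, \<tau>))" "s \<le> t"
  shows "Zc t x - Zc s x = (\<integral>\<tau>. indicator {s..<t} \<tau> * V (x, \<tau>) \<partial>lborel)"
  unfolding Zc_def by (rule tail_integral_diff[OF assms])

lemma Zc_increment:
  assumes "s \<le> t"
  shows "AE x in lborel. (Zc t x - Zc s x)\<^sup>2 \<le> (t - s) * (\<integral>\<tau>. indicator {s..<t} \<tau> * (V (x, \<tau>))\<^sup>2 \<partial>lborel)"
  using V_slice
proof eventually_elim
  case (elim x)
  have [measurable]: "(\<lambda>t. V (x, t)) \<in> borel_measurable borel" by (rule Pair_measurable_snd[OF V_meas])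
  have d: "Zc t x - Zc s x = (\<integral>\<tau>. indicator {s..<t} \<tau> * V (x, \<tau>) \<partial>lborel)"
    by (rule Zc_diff) (use elim assms in auto)
  show ?case unfolding d
    using square_integral_interval_le(1)[of "\<lambda>t. V (x, t)" s t "{s..<t}"] elim assms by (auto simp: subset_iff)
qed

lemma v_integrable: "integrable lborel v" and v_nonneg: "v t \<ge> 0"
  unfolding v_def using Fubini_plane_snd(2)[OF V_int] a_pos by (auto simp: less_imp_le)

lemma N_integrable: "integrable lborel N" and N_nonneg: "N t \<ge> 0"
  unfolding N_def using Fubini_plane_snd(2)[OF Y_int] a_pos by (auto simp: less_imp_le)

lemma e_integrable: "integrable lborel e" and e_nonneg: "e t \<ge> 0"
  unfolding e_def using Fubini_plane_snd(2)[OF X_int] by auto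

text \<open>Cauchy-Schwarz in time for fixed x, then Fubini. Thus \<open>Zc\<close> is Hoelder
  continuous of exponent 1/2 with values in weighted L^2. The integral of \<open>v\<close> is kept
  local to [s,t) because its increments have to telescope later on.\<close>

lemma Zc_increment_integral:
  assumes "s \<le> t"
  shows "integrable lborel (\<lambda>x. (Zc t x - Zc s x)\<^sup>2 / a x)"
    and "(\<integral>x. (Zc t x - Zc s x)\<^sup>2 / a x \<partial>lborel) \<le> (t - s) * (\<integral>\<tau>. indicator {s..<t} \<tau> * v \<tau> \<partial>lborel)"
proof -
  let ?h = "\<lambda>z. indicator {s..<t} (snd z) * ((V z)\<^sup>2 / a (fst z))"
  have [measurable]: "V \<in> borel_measurable (borel \<Otimes>\<^sub>M borel)" using V_meas by (simp add: borel_prod)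
  have "?h \<in> borel_measurable (borel \<Otimes>\<^sub>M borel)" by measurable
  then have hm: "?h \<in> borel_measurable lborel" by (simp add: borel_prod)
  have h: "integrable lborel ?h"
    by (rule Bochner_Integration.integrable_bound[OF V_int hm])
       (auto split: split_indicator)
  define B where "B x = (t - s) * (\<integral>\<tau>. ?h (x, \<tau>) \<partial>lborel)" for x
  have Bi: "integrable lborel B" unfolding B_def by (intro integrable_mult_right Fubini_plane_fst(2)[OF h])
  have le: "AE x in lborel. (Zc t x - Zc s x)\<^sup>2 / a x \<le> B x"
    using Zc_increment[OF assms]
  proof eventually_elim
    case (elim x)
    have "(Zc t x - Zc s x)\<^sup>2 / a x \<le> ((t - s) * (\<integral>\<tau>. indicator {s..<t} \<tau> * (V (x, \<tau>))\<^sup>2 \<partial>lborel)) / a x"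
      using elim a_pos[of x] by (intro divide_right_mono) auto
    also have "\<dots> = B x" unfolding B_def by simp
    finally show ?case .
  qed
  show i: "integrable lborel (\<lambda>x. (Zc t x - Zc s x)\<^sup>2 / a x)"
  proof (rule Bochner_Integration.integrable_bound[OF Bi])
    show "AE x in lborel. norm ((Zc t x - Zc s x)\<^sup>2 / a x) \<le> norm (B x)"
      using le by eventually_elim (use a_pos in \<open>auto simp: less_imp_le abs_of_nonneg\<close>)
  qed measurable
  have "(\<integral>x. (Zc t x - Zc s x)\<^sup>2 / a x \<partial>lborel) \<le> (\<integral>x. B x \<partial>lborel)"
    by (rule integral_mono_AE[OF i Bi le])
  also have "\<dots> = (t - s) * (\<integral>z. ?h z \<partial>lborel)"
    unfolding B_def integral_mult_right_zero Fubini_plane_fst(3)[OF h] ..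
  also have "(\<integral>z. ?h z \<partial>lborel) = (\<integral>\<tau>. indicator {s..<t} \<tau> * v \<tau> \<partial>lborel)"
    unfolding Fubini_plane_snd(3)[OF h, symmetric] v_def fst_conv snd_conv integral_mult_right_zero ..
  finally show "(\<integral>x. (Zc t x - Zc s x)\<^sup>2 / a x \<partial>lborel) \<le> (t - s) * (\<integral>\<tau>. indicator {s..<t} \<tau> * v \<tau> \<partial>lborel)" .
qed

lemma Zc_supp: "\<not> (0 < x \<and> x < 1) \<Longrightarrow> Zc t x = 0"
  using supp g_supp by (auto simp: Zc_def)

lemma H10_pair_cong_AE:
  assumes "H10_pair p q" "p' \<in> borel_measurable borel" "\<And>x. \<not> (0 < x \<and> x < 1) \<Longrightarrow> p' x = 0"
    "AE x in lborel. 0 < x \<and> x < 1 \<longrightarrow> p' x = p x"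
  shows "H10_pair p' q"
proof -
  obtain P where P: "primitive_on {0..1} q P" "P 0 = 0" "P 1 = 0" "AE x in lborel. 0 < x \<and> x < 1 \<longrightarrow> p x = P x"
    using assms(1) by (auto simp: H10_pair_def)
  have "AE x in lborel. 0 < x \<and> x < 1 \<longrightarrow> p' x = P x"
    using P(4) assms(4) by eventually_elim auto
  then show ?thesis using assms P(1-3) unfolding H10_pair_def by auto
qed

lemma AE_good: "AE t in lborel. 0 < t \<and> t < T \<longrightarrow> good t"
  using space AE_plane(2)[OF time] Fubini_plane_snd(1)[OF Z_int] Fubini_plane_snd(1)[OF Y_int]
proof eventually_elim
  case (elim t)
  show ?case
  proof (intro impI)
    assume t: "0 < t \<and> t < T"
    have ZZ: "AE x in lborel. 0 < x \<and> x < 1 \<longrightarrow> Zc t x = Z (x, t)"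
      using elim(2) by eventually_elim (use t in \<open>auto simp: Zc_def\<close>)
    have H: "H10_pair (Zc t) (\<lambda>x. X (x, t))"
      by (rule H10_pair_cong_AE[OF _ Zc_meas Zc_supp ZZ]) (use elim(1) t in auto)
    have "integrable lborel (\<lambda>x. (Zc t x)\<^sup>2 / a x)"
    proof (rule integrable_cong_AE_imp)
      show "integrable lborel (\<lambda>x. (Z (x, t))\<^sup>2 / a x)" using elim(3) by simp
      show "AE x in lborel. (Z (x, t))\<^sup>2 / a x = (Zc t x)\<^sup>2 / a x"
        using ZZ by eventually_elim (use Zc_supp supp in \<open>metis\<close>)
    qed measurable
    then show "good t" unfolding good_def using elim(1,4) t H by simp
  qed
qed

lemma g_int: "integrable lborel (\<lambda>x. (g x)\<^sup>2 / a x)"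
proof -
  \<comment> \<open>Averaging the function 0 serves to produce one good time; from there
    \<open>g\<close> is reached by an increment of finite weighted norm.\<close>
  obtain t where t: "0 < t" "t < T" "good t"
    by (rule exists_le_average[OF T _ AE_good, of "\<lambda>x. 0"]) (auto simp: set_integrable_def)
  have gT: "Zc T x = g x" for x by (rule Zc_at_T) simp
  show ?thesis
  proof (rule Bochner_Integration.integrable_bound)
    show "integrable lborel (\<lambda>x. 2 * ((Zc t x)\<^sup>2 / a x) + 2 * ((Zc T x - Zc t x)\<^sup>2 / a x))"
      using t Zc_increment_integral(1)[of t T]
      by (intro Bochner_Integration.integrable_add integrable_mult_right) (auto simp: good_def)
    show "AE x in lborel. norm ((g x)\<^sup>2 / a x) \<le> norm (2 * ((Zc t x)\<^sup>2 / a x) + 2 * ((Zc T x - Zc t x)\<^sup>2 / a x))"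
    proof (rule AE_I2)
      fix x
      have "(g x)\<^sup>2 / a x \<le> (2 * (Zc t x)\<^sup>2 + 2 * (Zc T x - Zc t x)\<^sup>2) / a x"
        using sq_sum_le[of "Zc t x" "Zc T x - Zc t x"] a_pos[of x] by (intro divide_right_mono) (auto simp: gT)
      also have "\<dots> = 2 * ((Zc t x)\<^sup>2 / a x) + 2 * ((Zc T x - Zc t x)\<^sup>2 / a x)"
        by (simp add: add_divide_distrib)
      finally show "norm ((g x)\<^sup>2 / a x) \<le> norm (2 * ((Zc t x)\<^sup>2 / a x) + 2 * ((Zc T x - Zc t x)\<^sup>2 / a x))"
        using a_pos[of x] by simp
    qed
  qed measurable
qed

text \<open>The splitting r p = (sqrt(a) r) (p / sqrt(a)) puts both factors into L^2. The parameter
  \<kappa> of Young's inequality stays free, because \<open>final_trace_H10\<close> takes it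
  comparable to the distance from the final time.\<close>

lemma sqrt_weighted_integrable:
  assumes [measurable]: "p \<in> borel_measurable borel" "r \<in> borel_measurable borel"
    and p: "integrable lborel (\<lambda>x. (p x)\<^sup>2 / a x)" and r: "integrable lborel (\<lambda>x. a x * (r x)\<^sup>2)"
  shows "integrable lborel (\<lambda>x. r x * p x)"
    and "\<kappa> > 0 \<Longrightarrow> 2 * (\<integral>x. r x * p x \<partial>lborel) \<le> \<kappa> * (\<integral>x. a x * (r x)\<^sup>2 \<partial>lborel) + (\<integral>x. (p x)\<^sup>2 / a x \<partial>lborel) / \<kappa>"
proof -
  have e: "(sqrt (a x) * r x) * (p x / sqrt (a x)) = r x * p x"
    "(sqrt (a x) * r x)\<^sup>2 = a x * (r x)\<^sup>2" "(p x / sqrt (a x))\<^sup>2 = (p x)\<^sup>2 / a x" for x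
    using a_pos[of x] by (auto simp: power_mult_distrib power_divide)
  have "integrable lborel (\<lambda>x. (sqrt (a x) * r x) * (p x / sqrt (a x)))"
    by (rule integrable_mult_L2) (use p r in \<open>simp_all add: e del: times_divide_eq_right times_divide_eq_left\<close>)
  then show i: "integrable lborel (\<lambda>x. r x * p x)" unfolding e .
  show "2 * (\<integral>x. r x * p x \<partial>lborel) \<le> \<kappa> * (\<integral>x. a x * (r x)\<^sup>2 \<partial>lborel) + (\<integral>x. (p x)\<^sup>2 / a x \<partial>lborel) / \<kappa>"
    if \<kappa>: "\<kappa> > 0"
  proof -
    have le: "2 * (r x * p x) \<le> \<kappa> * (a x * (r x)\<^sup>2) + (p x)\<^sup>2 / a x / \<kappa>" for x
    proof -
      have "2 * (sqrt \<kappa> * (sqrt (a x) * r x)) * (p x / sqrt (a x) / sqrt \<kappa>)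
          \<le> (sqrt \<kappa> * (sqrt (a x) * r x))\<^sup>2 + (p x / sqrt (a x) / sqrt \<kappa>)\<^sup>2"
        by (rule sum_squares_bound)
      then show ?thesis using \<kappa> a_pos[of x] by (simp add: power_mult_distrib power_divide)
    qed
    have "(\<integral>x. 2 * (r x * p x) \<partial>lborel) \<le> (\<integral>x. \<kappa> * (a x * (r x)\<^sup>2) + (p x)\<^sup>2 / a x / \<kappa> \<partial>lborel)"
      by (intro integral_mono Bochner_Integration.integrable_add integrable_mult_right integrable_divide i p r le)
    also have "\<dots> = (\<integral>x. \<kappa> * (a x * (r x)\<^sup>2) \<partial>lborel) + (\<integral>x. (p x)\<^sup>2 / a x / \<kappa> \<partial>lborel)"
      by (intro Bochner_Integration.integral_add integrable_mult_right integrable_divide p r)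
    finally show ?thesis by (simp only: integral_mult_right_zero integral_divide_zero)
  qed
qed

text \<open>The convexity of the Dirichlet integral with its exact remainder: expand the square and
  turn both pairings with \<open>X\<close> into pairings with \<open>Y\<close> by parts. Dropping
  the left-hand side gives the convexity inequality; keeping it controls the difference of two
  derivatives.\<close>

lemma energy_identity:
  assumes t: "good t" and w: "H10_pair w w'" and wi: "integrable lborel (\<lambda>x. (w x)\<^sup>2 / a x)"
  shows "(\<integral>x. (w' x - X (x, t))\<^sup>2 \<partial>lborel)
    = (\<integral>x. (w' x)\<^sup>2 \<partial>lborel) - e t + 2 * (\<integral>x. Y (x, t) * (w x - Zc t x) \<partial>lborel)"
proof -
  have [measurable]: "(\<lambda>x. X (x, t)) \<in> borel_measurable borel" "(\<lambda>x. Y (x, t)) \<in> borel_measurable borel"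
    by (rule Pair_measurable_fst[OF X_meas] Pair_measurable_fst[OF Y_meas])+
  have [measurable]: "w \<in> borel_measurable borel" "w' \<in> borel_measurable borel" using w by (auto simp: H10_pair_def)
  have Zt: "H10_pair (Zc t) (\<lambda>x. X (x, t))" and XY: "weak_deriv_pair (\<lambda>x. X (x, t)) (\<lambda>x. Y (x, t))"
    and Yi: "integrable lborel (\<lambda>x. a x * (Y (x, t))\<^sup>2)" and Zi: "integrable lborel (\<lambda>x. (Zc t x)\<^sup>2 / a x)"
    using t by (auto simp: good_def)
  have X2: "integrable lborel (\<lambda>x. (X (x, t))\<^sup>2)" using Zt by (auto simp: H10_pair_def)
  have w2: "integrable lborel (\<lambda>x. (w' x)\<^sup>2)" using w by (auto simp: H10_pair_def)
  have s: "\<And>x. x \<notin> {0<..<1} \<Longrightarrow> X (x, t) = 0" using supp by auto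
  have Yw: "integrable lborel (\<lambda>x. Y (x, t) * w x)" and YZ: "integrable lborel (\<lambda>x. Y (x, t) * Zc t x)"
    using sqrt_weighted_integrable(1)[OF _ _ wi Yi] sqrt_weighted_integrable(1)[OF _ _ Zi Yi] by auto
  have 1: "(\<integral>x. Y (x, t) * w x \<partial>lborel) = - (\<integral>x. X (x, t) * w' x \<partial>lborel)"
    by (rule H10_integration_by_parts[OF w _ X2 s XY Yw]) auto
  have 2: "(\<integral>x. Y (x, t) * Zc t x \<partial>lborel) = - (\<integral>x. X (x, t) * X (x, t) \<partial>lborel)"
    by (rule H10_integration_by_parts[OF Zt _ X2 s XY YZ]) auto
  have Xw: "integrable lborel (\<lambda>x. X (x, t) * w' x)" by (rule integrable_mult_L2) (use X2 w2 in auto)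
  have "(\<integral>x. (w' x - X (x, t))\<^sup>2 \<partial>lborel) = (\<integral>x. (w' x)\<^sup>2 + (X (x, t))\<^sup>2 - 2 * (X (x, t) * w' x) \<partial>lborel)"
    by (intro Bochner_Integration.integral_cong) (auto simp: power2_diff)
  also have "\<dots> = (\<integral>x. (w' x)\<^sup>2 \<partial>lborel) + e t - 2 * (\<integral>x. X (x, t) * w' x \<partial>lborel)"
    using X2 w2 Xw by (simp add: e_def)
  finally show ?thesis
    using 1 2 Yw YZ by (simp add: right_diff_distrib e_def power2_eq_square)
qed

end

section \<open>The trace at the final time lies in \<open>H\<^sup>1\<^sub>0\<close>\<close>

text \<open>Completeness of L^2 in the form needed here: the integrals over Borel sets converge, and
  primitives of the \<open>X n\<close> are such integrals. A rapidly converging subsequence has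
  summable increments; their sum gives an almost everywhere limit together with an integrable
  majorant, and Fatou's lemma gives square integrability.\<close>

lemma L2_Cauchy_limit:
  fixes X :: "nat \<Rightarrow> real \<Rightarrow> real"
  assumes meas[measurable]: "\<And>n. X n \<in> borel_measurable borel"
    and supp: "\<And>n x. x \<notin> {0<..<1} \<Longrightarrow> X n x = 0"
    and int: "\<And>n. integrable lborel (\<lambda>x. (X n x)\<^sup>2)"
    and Cauchy: "\<And>r. r > 0 \<Longrightarrow> \<exists>K. \<forall>n\<ge>K. \<forall>m>n. (\<integral>x. (X m x - X n x)\<^sup>2 \<partial>lborel) < r"
  obtains q \<rho> where "strict_mono \<rho>" "q \<in> borel_measurable borel" "\<And>x. x \<notin> {0<..<1} \<Longrightarrow> q x = 0"
    "integrable lborel (\<lambda>x. (q x)\<^sup>2)" "integrable lborel q"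
    "\<And>A. A \<in> sets borel \<Longrightarrow> (\<lambda>k. \<integral>x. indicator A x * X (\<rho> k) x \<partial>lborel) \<longlonglongrightarrow> (\<integral>x. indicator A x * q x \<partial>lborel)"
proof -
  \<comment> \<open>With squared norms at most 4^-k, the L^1 norms on the unit interval are at most
    2^-k and hence summable.\<close>
  have "\<forall>k. \<exists>K. \<forall>n\<ge>K. \<forall>m>n. (\<integral>x. (X m x - X n x)\<^sup>2 \<partial>lborel) < (1 / 4) ^ k"
    using Cauchy by simp
  then obtain K where K: "\<And>k n m. n \<ge> K k \<Longrightarrow> m > n \<Longrightarrow> (\<integral>x. (X m x - X n x)\<^sup>2 \<partial>lborel) < (1 / 4) ^ k"
    by metis
  define \<rho> where "\<rho> = rec_nat (K 0) (\<lambda>k r. max (Suc r) (K (Suc k)))"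
  have \<rho>0: "\<rho> 0 = K 0" and \<rho>S: "\<rho> (Suc k) = max (Suc (\<rho> k)) (K (Suc k))" for k by (simp_all add: \<rho>_def)
  have \<rho>K: "\<rho> k \<ge> K k" for k by (cases k) (simp_all add: \<rho>0 \<rho>S)
  have sm: "strict_mono \<rho>" by (rule strict_monoI_Suc) (simp add: \<rho>S less_max_iff_disj)
  define D where "D k x = X (\<rho> (Suc k)) x - X (\<rho> k) x" for k x
  have Dm[measurable]: "D k \<in> borel_measurable borel" for k unfolding D_def by measurable
  have D2: "integrable lborel (\<lambda>x. (D k x)\<^sup>2)" for k
    unfolding D_def by (rule integrable_square_diff) (use int in auto)
  have D4: "(\<integral>x. (D k x)\<^sup>2 \<partial>lborel) \<le> (1 / 4) ^ k" for k
    unfolding D_def using K[OF \<rho>K[of k], of "\<rho> (Suc k)"] strict_monoD[OF sm, of k "Suc k"] by simp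
  have Ds: "indicator {0..1} x * D k x = D k x" for k x
    using supp by (auto simp: D_def split: split_indicator)
  have Ds2: "indicator {0..1} x * (D k x)\<^sup>2 = (D k x)\<^sup>2" for k x
    using supp by (auto simp: D_def split: split_indicator)
  have Xs: "indicator {0..1} x * X k x = X k x" for k x
    using supp by (auto split: split_indicator)
  have Xi: "integrable lborel (X k)" for k
    using square_integral_interval_le(2)[of "X k" 0 1 "{0..1}"] int unfolding Xs by simp
  have Di: "integrable lborel (D k)" for k unfolding D_def using Xi by simp
  have D1: "(\<integral>x. \<bar>D k x\<bar> \<partial>lborel) \<le> (1 / 2) ^ k" for k
  proof -
    have "(\<integral>x. indicator {0..1} x * \<bar>D k x\<bar> \<partial>lborel)\<^sup>2 \<le> (1 - 0) * (\<integral>x. indicator {0..1} x * (\<bar>D k x\<bar>)\<^sup>2 \<partial>lborel)"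
      by (rule square_integral_interval_le(1)) (use D2 in auto)
    also have "\<dots> \<le> ((1 / 2) ^ k)\<^sup>2" 
      using D4[of k] unfolding power2_abs Ds2 power2_eq_square[of "(1 / 2) ^ k"] power_mult_distrib[symmetric] by simp
    finally have "(\<integral>x. indicator {0..1} x * \<bar>D k x\<bar> \<partial>lborel) \<le> (1 / 2) ^ k"
      by (rule power2_le_imp_le) simp
    moreover have "indicator {0..1} x * \<bar>D k x\<bar> = \<bar>D k x\<bar>" for x
      using supp by (auto simp: D_def split: split_indicator)
    ultimately show ?thesis by simp
  qed
  have sumD: "summable (\<lambda>k. \<integral>x. norm (D k x) \<partial>lborel)"
    by (rule summable_comparison_test[of _ "\<lambda>k. (1 / 2) ^ k"]) (use D1 in auto)
  have AEs: "AE x in lborel. summable (\<lambda>k. norm (D k x))"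
  proof -
    have "(\<integral>\<^sup>+x. (\<Sum>k. ennreal (norm (D k x))) \<partial>lborel) = (\<Sum>k. \<integral>\<^sup>+x. ennreal (norm (D k x)) \<partial>lborel)"
      by (rule nn_integral_suminf) measurable
    also have "\<dots> = (\<Sum>k. ennreal (\<integral>x. norm (D k x) \<partial>lborel))"
      using Di by (simp add: nn_integral_eq_integral)
    also have "\<dots> \<noteq> top" by (rule ennreal_suminf_neq_top[OF sumD]) simp
    finally have "AE x in lborel. (\<Sum>k. ennreal (norm (D k x))) \<noteq> \<infinity>"
      by (intro nn_integral_PInf_AE) auto
    then show ?thesis by eventually_elim (auto intro!: summable_suminf_not_top)
  qed
  define q where "q x = X (\<rho> 0) x + (\<Sum>k. D k x)" for x
  have qm[measurable]: "q \<in> borel_measurable borel" unfolding q_def by measurable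
  define w where "w x = \<bar>X (\<rho> 0) x\<bar> + (\<Sum>k. norm (D k x))" for x
  have wi: "integrable lborel w"
    unfolding w_def using Xi Di AEs sumD
    by (intro Bochner_Integration.integrable_add integrable_suminf) auto
  have tele: "X (\<rho> k) x = X (\<rho> 0) x + (\<Sum>j<k. D j x)" for k x
    unfolding D_def by (subst sum_lessThan_telescope) simp
  have lim: "AE x in lborel. (\<lambda>k. X (\<rho> k) x) \<longlonglongrightarrow> q x"
    using AEs
  proof eventually_elim
    case (elim x)
    have "(\<lambda>k. X (\<rho> 0) x + (\<Sum>j<k. D j x)) \<longlonglongrightarrow> q x"
      unfolding q_def by (rule tendsto_add[OF tendsto_const summable_LIMSEQ[OF summable_norm_cancel[OF elim]]])
    then show ?case by (simp only: tele[symmetric])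
  qed
  have bnd: "AE x in lborel. norm (X (\<rho> k) x) \<le> w x" for k
    using AEs
  proof eventually_elim
    case (elim x)
    have "\<bar>\<Sum>j<k. D j x\<bar> \<le> (\<Sum>j<k. norm (D j x))" using sum_abs[of "\<lambda>j. D j x" "{..<k}"] by simp
    also have "\<dots> \<le> (\<Sum>k. norm (D k x))" by (rule sum_le_suminf[OF elim]) auto
    finally have "\<bar>X (\<rho> 0) x + (\<Sum>j<k. D j x)\<bar> \<le> \<bar>X (\<rho> 0) x\<bar> + (\<Sum>k. norm (D k x))" by linarith
    then show ?case unfolding w_def tele[of k, symmetric] real_norm_def .
  qed
  have qi: "integrable lborel q"
    by (rule integrable_dominated_convergence[OF _ _ wi lim bnd]) auto
  \<comment> \<open>The threshold \<open>K 0\<close> belongs to the bound (1/4)^0 = 1, which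
    \<open>sq_sum_le\<close> doubles to the summand 2.\<close>
  define B where "B = 2 * (\<integral>x. (X (\<rho> 0) x)\<^sup>2 \<partial>lborel) + 2"
  have XB: "(\<integral>x. (X (\<rho> k) x)\<^sup>2 \<partial>lborel) \<le> B" for k
  proof (cases k)
    case 0
    then show ?thesis by (simp add: B_def)
  next
    case (Suc j)
    have i: "integrable lborel (\<lambda>x. (X (\<rho> k) x - X (\<rho> 0) x)\<^sup>2)"
      by (rule integrable_square_diff) (use int in auto)
    have "(\<integral>x. (X (\<rho> k) x)\<^sup>2 \<partial>lborel) \<le> (\<integral>x. 2 * (X (\<rho> 0) x)\<^sup>2 + 2 * (X (\<rho> k) x - X (\<rho> 0) x)\<^sup>2 \<partial>lborel)"
      using int i sq_sum_le[of "X (\<rho> 0) x" "X (\<rho> k) x - X (\<rho> 0) x" for x] by (intro integral_mono) auto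
    also have "\<dots> = 2 * (\<integral>x. (X (\<rho> 0) x)\<^sup>2 \<partial>lborel) + 2 * (\<integral>x. (X (\<rho> k) x - X (\<rho> 0) x)\<^sup>2 \<partial>lborel)"
      using int i by simp
    also have "\<dots> \<le> B"
      using K[OF \<rho>K[of 0], of "\<rho> k"] strict_monoD[OF sm, of 0 k] Suc by (simp add: B_def)
    finally show ?thesis .
  qed
  have q2: "integrable lborel (\<lambda>x. (q x)\<^sup>2)"
  proof (rule integrableI_bounded)
    have "(\<integral>\<^sup>+x. ennreal (norm ((q x)\<^sup>2)) \<partial>lborel) = (\<integral>\<^sup>+x. liminf (\<lambda>k. ennreal ((X (\<rho> k) x)\<^sup>2)) \<partial>lborel)"
    proof (rule nn_integral_cong_AE)
      show "AE x in lborel. ennreal (norm ((q x)\<^sup>2)) = liminf (\<lambda>k. ennreal ((X (\<rho> k) x)\<^sup>2))"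
        using lim
      proof eventually_elim
        case (elim x)
        have "(\<lambda>k. ennreal ((X (\<rho> k) x)\<^sup>2)) \<longlonglongrightarrow> ennreal ((q x)\<^sup>2)"
          using elim by (intro tendsto_intros) auto
        from lim_imp_Liminf[OF sequentially_bot this] show ?case by simp
      qed
    qed
    also have "\<dots> \<le> liminf (\<lambda>k. \<integral>\<^sup>+x. ennreal ((X (\<rho> k) x)\<^sup>2) \<partial>lborel)"
      by (rule nn_integral_liminf) measurable
    also have "\<dots> \<le> ennreal B"
    proof (rule Liminf_le[OF sequentially_bot always_eventually], rule allI)
      fix k
      have "(\<integral>\<^sup>+x. ennreal ((X (\<rho> k) x)\<^sup>2) \<partial>lborel) = ennreal (\<integral>x. (X (\<rho> k) x)\<^sup>2 \<partial>lborel)"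
        by (rule nn_integral_eq_integral[OF int]) simp
      then show "(\<integral>\<^sup>+x. ennreal ((X (\<rho> k) x)\<^sup>2) \<partial>lborel) \<le> ennreal B"
        using XB[of k] by (simp only: ennreal_leI)
    qed
    finally show "(\<integral>\<^sup>+x. ennreal (norm ((q x)\<^sup>2)) \<partial>lborel) < \<infinity>"
      by (simp add: order.strict_trans1)
  qed measurable
  show thesis
  proof (rule that[OF sm qm _ q2 qi])
    show "q x = 0" if "x \<notin> {0<..<1}" for x
      using supp[OF that] by (simp add: q_def D_def)
    fix A :: "real set" assume A[measurable]: "A \<in> sets borel"
    show "(\<lambda>k. \<integral>x. indicator A x * X (\<rho> k) x \<partial>lborel) \<longlonglongrightarrow> (\<integral>x. indicator A x * q x \<partial>lborel)"
    proof (rule integral_dominated_convergence[OF _ _ wi])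
      show "AE x in lborel. (\<lambda>k. indicator A x * X (\<rho> k) x) \<longlonglongrightarrow> indicator A x * q x"
        using lim by eventually_elim (intro tendsto_intros)
      show "AE x in lborel. norm (indicator A x * X (\<rho> k) x) \<le> w x" for k
        using bnd[of k] by eventually_elim (auto split: split_indicator)
    qed measurable
  qed
qed

text \<open>\<open>p\<close> and \<open>s\<close> converge by monotonicity, and e - p - s is
  decreasing and bounded below by -P - S. So \<open>e\<close> converges although it need not be
  monotone.\<close>

lemma Cauchy_of_almost_decreasing:
  fixes e p s :: "nat \<Rightarrow> real"
  assumes "incseq p" "incseq s" "\<And>n. p n \<le> P" "\<And>n. s n \<le> S" "\<And>n. 0 \<le> e n"
    and dec: "\<And>n. e (Suc n) \<le> e n + (p (Suc n) - p n) + (s (Suc n) - s n)"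
  shows "convergent e" "convergent p" "convergent s"
proof -
  show p: "convergent p" using incseq_convergent[OF assms(1), of P] assms(3) unfolding convergent_def by blast
  show s: "convergent s" using incseq_convergent[OF assms(2), of S] assms(4) unfolding convergent_def by blast
  have "decseq (\<lambda>n. e n - p n - s n)" by (rule decseq_SucI) (use dec in \<open>simp add: algebra_simps\<close>)
  moreover have "- P - S \<le> e n - p n - s n" for n using assms(3,4,5)[of n] by linarith
  ultimately have "convergent (\<lambda>n. e n - p n - s n)"
    using decseq_convergent[of "\<lambda>n. e n - p n - s n" "- P - S"] unfolding convergent_def by blast
  then have "convergent (\<lambda>n. (e n - p n - s n) + p n + s n)"
    using p s by (intro convergent_add)
  then show "convergent e" by simp
qed

context evolution_setting
begin

text \<open>\<open>energy_identity\<close> with the slice at time \<open>s\<close> as competitor,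
  then Young's inequality and the Hoelder bound for the increment. Both orders of the two times are
  used: \<open>t\<close> after \<open>s\<close> bounds the energy at \<open>t\<close> by the earlier
  one, \<open>t\<close> before \<open>s\<close> bounds the distance of the derivatives.\<close>

lemma energy_le:
  assumes t: "good t" and s: "good s" and \<kappa>: "\<kappa> > 0"
  shows "(\<integral>x. (X (x, s) - X (x, t))\<^sup>2 \<partial>lborel)
    \<le> e s - e t + \<kappa> * N t + \<bar>s - t\<bar> * (\<integral>\<tau>. indicator {min s t..<max s t} \<tau> * v \<tau> \<partial>lborel) / \<kappa>"
proof -
  have [measurable]: "(\<lambda>x. Y (x, t)) \<in> borel_measurable borel" by (rule Pair_measurable_fst[OF Y_meas])
  have Yi: "integrable lborel (\<lambda>x. a x * (Y (x, t))\<^sup>2)" using t by (simp add: good_def)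
  let ?st = "\<integral>x. (Zc s x - Zc t x)\<^sup>2 / a x \<partial>lborel"
  have st: "integrable lborel (\<lambda>x. (Zc s x - Zc t x)\<^sup>2 / a x)"
    "?st \<le> \<bar>s - t\<bar> * (\<integral>\<tau>. indicator {min s t..<max s t} \<tau> * v \<tau> \<partial>lborel)"
    using Zc_increment_integral[of s t] Zc_increment_integral[of t s]
    by (cases "s \<le> t"; simp add: power2_commute[of "Zc s _"] min_def max_def)+
  have "2 * (\<integral>x. Y (x, t) * (Zc s x - Zc t x) \<partial>lborel) \<le> \<kappa> * N t + ?st / \<kappa>"
    unfolding N_def by (rule sqrt_weighted_integrable(2)[OF _ _ st(1) Yi \<kappa>]) auto
  moreover have "?st / \<kappa> \<le> \<bar>s - t\<bar> * (\<integral>\<tau>. indicator {min s t..<max s t} \<tau> * v \<tau> \<partial>lborel) / \<kappa>"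
    using st(2) \<kappa> by (intro divide_right_mono) auto
  moreover have "(\<integral>x. (X (x, s) - X (x, t))\<^sup>2 \<partial>lborel) = e s - e t + 2 * (\<integral>x. Y (x, t) * (Zc s x - Zc t x) \<partial>lborel)"
    unfolding e_def[of s] using s by (intro energy_identity[OF t]) (auto simp: good_def)
  ultimately show ?thesis by linarith
qed

text \<open>The n-th dyadic interval has length \<open>l n\<close>, which is also its distance to T,
  and contributes one time \<open>t n\<close> at which \<open>N\<close> is at most its average. The
  choice \<kappa> = l n in \<open>energy_le\<close> balances the two errors: one is at most an
  increment of the integral of \<open>N\<close>, the other at most four times an increment of the
  integral of \<open>v\<close>. Both integrals are finite, so the energies converge and the
  derivatives form a Cauchy sequence; its limit is the derivative of \<open>g\<close>.\<close>

lemma final_trace_H10: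
  obtains q where "H10_pair g q"
proof -
  define l where "l n = T / 2 ^ Suc n" for n
  \<comment> \<open>That is, \<tau> n = T - T / 2^n; in particular \<tau> 0 = 0.\<close>
  define \<tau> where "\<tau> n = T - 2 * l n" for n
  have l: "l n > 0" for n using T by (simp add: l_def)
  have lS: "l n = 2 * l (Suc n)" for n by (simp add: l_def)
  have \<tau>S: "\<tau> (Suc n) = \<tau> n + l n" for n using lS[of n] by (simp add: \<tau>_def)
  have \<tau>T: "\<tau> n < T" for n using l[of n] by (simp add: \<tau>_def)
  have "2 * l n \<le> T" for n using T by (simp add: l_def field_simps)
  then have \<tau>0: "0 \<le> \<tau> n" for n by (simp add: \<tau>_def)
  have l0: "l \<longlonglongrightarrow> 0"
  proof -
    have "(\<lambda>n. T * (1 / 2) ^ Suc n) \<longlonglongrightarrow> T * 0"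
      by (intro tendsto_intros LIMSEQ_Suc LIMSEQ_realpow_zero) auto
    then show ?thesis by (simp add: l_def[abs_def] power_divide)
  qed
  \<comment> \<open>The cumulative integral of \<open>N\<close> up to the n-th node; its increments
    bound \<open>l n * N (t n)\<close>.\<close>
  define p where "p n = (\<integral>s. indicator {..\<tau> n} s * N s \<partial>lborel)" for n
  have Ni: "integrable lborel (\<lambda>s. indicator A s * N s)" if "A \<in> sets borel" for A
    using integrable_mult_indicator[of A lborel, OF _ N_integrable] that by simp
  have vi: "integrable lborel (\<lambda>s. indicator A s * v s)" if "A \<in> sets borel" for A
    using integrable_mult_indicator[of A lborel, OF _ v_integrable] that by simp
  have pS: "(\<integral>s. indicator {\<tau> n<..<\<tau> (Suc n)} s * N s \<partial>lborel) \<le> p (Suc n) - p n" for n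
  proof -
    have "(\<integral>s. indicator {\<tau> n<..<\<tau> (Suc n)} s * N s \<partial>lborel) + p n
        = (\<integral>s. indicator {\<tau> n<..<\<tau> (Suc n)} s * N s + indicator {..\<tau> n} s * N s \<partial>lborel)"
      unfolding p_def by (rule Bochner_Integration.integral_add[symmetric]) (auto intro: Ni)
    also have "\<dots> \<le> p (Suc n)"
      unfolding p_def using N_nonneg l[of n]
      by (intro integral_mono Bochner_Integration.integrable_add Ni) (auto simp: \<tau>S split: split_indicator)
    finally show ?thesis by simp
  qed
  have "\<forall>n. \<exists>t. \<tau> n < t \<and> t < \<tau> (Suc n) \<and> good t \<and> l n * N t \<le> p (Suc n) - p n"
  proof
    fix n
    have h3: "AE t in lborel. \<tau> n < t \<and> t < \<tau> (Suc n) \<longrightarrow> good t"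
      using AE_good by eventually_elim (use \<tau>0[of n] \<tau>T[of "Suc n"] in auto)
    have h2: "set_integrable lborel {\<tau> n<..<\<tau> (Suc n)} N" using Ni by (simp add: set_integrable_def)
    have h1: "\<tau> n < \<tau> (Suc n)" using l[of n] by (simp add: \<tau>S)
    obtain t where "\<tau> n < t" "t < \<tau> (Suc n)" "good t"
      "(\<tau> (Suc n) - \<tau> n) * N t \<le> (LINT x:{\<tau> n<..<\<tau> (Suc n)}|lborel. N x)"
      by (rule exists_le_average[OF h1 h2 h3])
    then show "\<exists>t. \<tau> n < t \<and> t < \<tau> (Suc n) \<and> good t \<and> l n * N t \<le> p (Suc n) - p n"
      using pS[of n] by (auto simp: \<tau>S set_lebesgue_integral_def intro!: exI[of _ t])
  qed
  then obtain t where t: "\<And>n. \<tau> n < t n" "\<And>n. t n < \<tau> (Suc n)" "\<And>n. good (t n)" "\<And>n. l n * N (t n) \<le> p (Suc n) - p n"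
    by metis
  have tmono: "t m < t n" if "m < n" for m n
  proof (rule lift_Suc_mono_less[OF _ that])
    show "t k < t (Suc k)" for k using t(2)[of k] t(1)[of "Suc k"] by linarith
  qed
  \<comment> \<open>Unlike \<open>p\<close>, this integral runs up to the selected times, since
    \<open>energy_le\<close> compares exactly these.\<close>
  define s where "s n = (\<integral>\<sigma>. indicator {..<t n} \<sigma> * v \<sigma> \<partial>lborel)" for n
  have sdiff: "(\<integral>\<sigma>. indicator {t m..<t n} \<sigma> * v \<sigma> \<partial>lborel) = s n - s m" if "m < n" for m n
  proof -
    have "s n - s m = (\<integral>\<sigma>. indicator {..<t n} \<sigma> * v \<sigma> - indicator {..<t m} \<sigma> * v \<sigma> \<partial>lborel)"
      unfolding s_def by (rule Bochner_Integration.integral_diff[symmetric]) (auto intro: vi)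
    also have "\<dots> = (\<integral>\<sigma>. indicator {t m..<t n} \<sigma> * v \<sigma> \<partial>lborel)"
      using tmono[OF that] by (intro Bochner_Integration.integral_cong) (auto split: split_indicator)
    finally show ?thesis ..
  qed
  have Tt: "T - t n \<le> 2 * l n" for n using t(1)[of n] by (simp add: \<tau>_def)
  have tT: "t n < T" for n using t(2)[of n] \<tau>T[of "Suc n"] by linarith
  have incp: "incseq p"
    by (rule incseq_SucI) (use pS N_nonneg in \<open>smt (verit) Bochner_Integration.integral_nonneg indicator_pos_le mult_nonneg_nonneg\<close>)
  have incs: "incseq s"
    by (rule incseq_SucI) (use sdiff v_nonneg in \<open>smt (verit) Bochner_Integration.integral_nonneg indicator_pos_le lessI mult_nonneg_nonneg\<close>)
  have pb: "p n \<le> (\<integral>s. N s \<partial>lborel)" for n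
    unfolding p_def using N_nonneg N_integrable by (intro integral_mono Ni) (auto split: split_indicator)
  have sb: "s n \<le> (\<integral>s. v s \<partial>lborel)" for n
    unfolding s_def using v_nonneg v_integrable by (intro integral_mono vi) (auto split: split_indicator)
  \<comment> \<open>The base point of the convexity inequality is the later time. The earlier one is
    at distance at most 2 l n = 4 l (Suc n), whence the factor 4.\<close>
  have dec: "e (t (Suc n)) \<le> e (t n) + (p (Suc (Suc n)) - p (Suc n)) + (4 * s (Suc n) - 4 * s n)" for n
  proof -
    have "0 \<le> (\<integral>x. (X (x, t n) - X (x, t (Suc n)))\<^sup>2 \<partial>lborel)" by simp
    also have "\<dots> \<le> e (t n) - e (t (Suc n)) + l (Suc n) * N (t (Suc n)) + (t (Suc n) - t n) * (s (Suc n) - s n) / l (Suc n)"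
      using energy_le[OF t(3)[of "Suc n"] t(3)[of n] l[of "Suc n"]] sdiff[of n "Suc n"] tmono[of n "Suc n"]
      by simp
    also have "(t (Suc n) - t n) * (s (Suc n) - s n) / l (Suc n) \<le> 4 * (s (Suc n) - s n)"
    proof -
      have "t (Suc n) - t n \<le> 4 * l (Suc n)" using t(1)[of n] tT[of "Suc n"] lS[of n] by (simp add: \<tau>_def)
      moreover have "0 \<le> s (Suc n) - s n" using incs by (simp add: incseq_SucD)
      ultimately have "(t (Suc n) - t n) * (s (Suc n) - s n) \<le> 4 * l (Suc n) * (s (Suc n) - s n)"
        by (rule mult_right_mono)
      then show ?thesis using l[of "Suc n"] by (simp add: divide_le_eq ac_simps)
    qed
    finally show ?thesis using t(4)[of "Suc n"] by simp
  qed
  have incp': "incseq (\<lambda>n. p (Suc n))" using incp by (simp add: incseq_def)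
  have incs': "incseq (\<lambda>n. 4 * s n)" using incs by (simp add: incseq_def)
  have conv: "convergent (\<lambda>n. e (t n))" "convergent (\<lambda>n. p (Suc n))" "convergent (\<lambda>n. 4 * s n)"
    using Cauchy_of_almost_decreasing[OF incp' incs' pb _ _ dec, of "4 * (\<integral>s. v s \<partial>lborel)"] sb e_nonneg by auto
  have Xm[measurable]: "(\<lambda>x. X (x, t n)) \<in> borel_measurable borel" for n by (rule Pair_measurable_fst[OF X_meas])
  have X2: "integrable lborel (\<lambda>x. (X (x, t n))\<^sup>2)" for n using t(3) by (auto simp: good_def H10_pair_def)
  \<comment> \<open>Now the earlier time is the base point and the square on the left is kept; it is
    bounded by differences of three convergent sequences.\<close>
  have close: "(\<integral>x. (X (x, t m) - X (x, t n))\<^sup>2 \<partial>lborel)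
      \<le> (e (t m) - e (t n)) + (p (Suc n) - p n) + (4 * s m - 4 * s n)" if "n < m" for m n
  proof -
    have "(\<integral>x. (X (x, t m) - X (x, t n))\<^sup>2 \<partial>lborel)
        \<le> e (t m) - e (t n) + l n * N (t n) + (t m - t n) * (s m - s n) / l n"
      using energy_le[OF t(3)[of n] t(3)[of m] l[of n]] sdiff[OF that] tmono[OF that] by simp
    also have "(t m - t n) * (s m - s n) / l n \<le> 4 * (s m - s n)"
    proof -
      have "t m - t n \<le> 4 * l n" using Tt[of n] tT[of m] l[of n] by simp
      moreover have "0 \<le> s m - s n" using incs that by (simp add: incseqD)
      ultimately have "(t m - t n) * (s m - s n) \<le> 4 * l n * (s m - s n)"
        by (rule mult_right_mono)
      then show ?thesis using l[of n] by (simp add: divide_le_eq ac_simps)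
    qed
    finally show ?thesis using t(4)[of n] by simp
  qed
  have Cau: "\<exists>K. \<forall>n\<ge>K. \<forall>m>n. (\<integral>x. (X (x, t m) - X (x, t n))\<^sup>2 \<partial>lborel) < r" if r: "r > 0" for r
  proof -
    have C: "Cauchy f" if "convergent f" for f :: "nat \<Rightarrow> real" using that by (simp add: Cauchy_convergent_iff)
    obtain K1 where K1: "\<And>m n. m \<ge> K1 \<Longrightarrow> n \<ge> K1 \<Longrightarrow> \<bar>e (t m) - e (t n)\<bar> < r / 3"
      using CauchyD[OF C[OF conv(1)], of "r / 3"] r by auto
    obtain K2 where K2: "\<And>m n. m \<ge> K2 \<Longrightarrow> n \<ge> K2 \<Longrightarrow> \<bar>p (Suc m) - p (Suc n)\<bar> < r / 3"
      using CauchyD[OF C[OF conv(2)], of "r / 3"] r by auto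
    obtain K3 where K3: "\<And>m n. m \<ge> K3 \<Longrightarrow> n \<ge> K3 \<Longrightarrow> \<bar>4 * s m - 4 * s n\<bar> < r / 3"
      using CauchyD[OF C[OF conv(3)], of "r / 3"] r by auto
    show ?thesis
    proof (intro exI[of _ "max K1 (max (Suc K2) K3)"] allI impI)
      fix n m assume n: "max K1 (max (Suc K2) K3) \<le> n" and m: "n < m"
      \<comment> \<open>Convergence is known for \<open>p (Suc n)\<close>, so the increment
        \<open>p (Suc n) - p n\<close> is read at the preceding index.\<close>
      then obtain n' where n': "n = Suc n'" "K2 \<le> n'" by (cases n) auto
      show "(\<integral>x. (X (x, t m) - X (x, t n))\<^sup>2 \<partial>lborel) < r"
      proof -
        have abs: "x + y + z < r" if "\<bar>x\<bar> < r / 3" "\<bar>y\<bar> < r / 3" "\<bar>z\<bar> < r / 3" for x y z :: real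
          using that by linarith
        have "\<bar>e (t m) - e (t n)\<bar> < r / 3" "\<bar>4 * s m - 4 * s n\<bar> < r / 3"
          using K1[of m n] K3[of m n] n m by auto
        moreover have "\<bar>p (Suc n) - p n\<bar> < r / 3" using K2[of n n'] n' by simp
        ultimately show ?thesis using close[OF m] abs order.strict_trans1 by blast
      qed
    qed
  qed
  obtain q \<rho> where \<rho>: "strict_mono \<rho>" and qm: "q \<in> borel_measurable borel"
    and q0: "\<And>x. x \<notin> {0<..<1} \<Longrightarrow> q x = 0" and q2: "integrable lborel (\<lambda>x. (q x)\<^sup>2)" and qi: "integrable lborel q"
    and lim: "\<And>A. A \<in> sets borel \<Longrightarrow> (\<lambda>k. \<integral>x. indicator A x * X (x, t (\<rho> k)) \<partial>lborel) \<longlonglongrightarrow> (\<integral>x. indicator A x * q x \<partial>lborel)"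
    by (rule L2_Cauchy_limit[of "\<lambda>n x. X (x, t n)", OF Xm _ X2 Cau]) (use supp in auto)
  \<comment> \<open>The primitive of the limit \<open>q\<close> that starts at 0. The primitives of
    the slices are integrals over [0,x] too and converge to it pointwise, so both boundary values
    pass to the limit.\<close>
  define Q where "Q x = (\<integral>y. indicator {0..x} y * q y \<partial>lborel)" for x
  have qA: "integrable lborel (\<lambda>y. indicator A y * q y)" if "A \<in> sets borel" for A
    using integrable_mult_indicator[of A lborel, OF _ qi] that by simp
  have QP: "primitive_on {0..1} q Q"
    unfolding primitive_on_def
  proof (intro ballI impI conjI)
    fix c d :: real assume cd: "c \<in> {0..1}" "d \<in> {0..1}" "c \<le> d"
    show "set_integrable lborel {c..d} q" using qA by (simp add: set_integrable_def)
    have "Q c + (LINT x:{c..d}|lborel. q x) = (\<integral>y. indicator {0..c} y * q y + indicator {c..d} y * q y \<partial>lborel)"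
      unfolding Q_def set_lebesgue_integral_def using qA by simp
    also have "\<dots> = Q d"
      unfolding Q_def
    proof (rule integral_cong_AE)
      show "AE y in lborel. indicator {0..c} y * q y + indicator {c..d} y * q y = indicator {0..d} y * q y"
        using AE_lborel_singleton[of c] by eventually_elim (use cd in \<open>auto split: split_indicator\<close>)
    qed (use qm in auto)
    finally show "Q d - Q c = (LINT x:{c..d}|lborel. q x)" by simp
  qed
  have "\<forall>n. \<exists>P. primitive_on {0..1} (\<lambda>x. X (x, t n)) P \<and> P 0 = 0 \<and> P 1 = 0 \<and> (AE x in lborel. 0 < x \<and> x < 1 \<longrightarrow> Zc (t n) x = P x)"
    using t(3) by (auto simp: good_def H10_pair_def)
  from choice[OF this] obtain P where P': "\<forall>n. primitive_on {0..1} (\<lambda>x. X (x, t n)) (P n) \<and> P n 0 = 0 \<and> P n 1 = 0 \<and>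
      (AE x in lborel. 0 < x \<and> x < 1 \<longrightarrow> Zc (t n) x = P n x)" ..
  then have P: "\<And>n. primitive_on {0..1} (\<lambda>x. X (x, t n)) (P n)" "\<And>n. P n 0 = 0" "\<And>n. P n 1 = 0"
    "\<And>n. AE x in lborel. 0 < x \<and> x < 1 \<longrightarrow> Zc (t n) x = P n x"
    by simp_all
  have PI: "P n x = (\<integral>y. indicator {0..x} y * X (y, t n) \<partial>lborel)" if "0 \<le> x" "x \<le> 1" for n x
    using primitive_onD(2)[OF P(1), of 0 x n] that P(2) by (simp add: set_lebesgue_integral_def)
  have PQ: "(\<lambda>k. P (\<rho> k) x) \<longlonglongrightarrow> Q x" if "0 \<le> x" "x \<le> 1" for x
    unfolding PI[OF that] Q_def by (rule lim) simp
  have Q1: "Q 1 = 0" using PQ[of 1] P(3) by (simp add: LIMSEQ_const_iff)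
  have Q0: "Q 0 = 0" using PQ[of 0] P(2) by (simp add: LIMSEQ_const_iff)
  have gQ: "AE x in lborel. 0 < x \<and> x < 1 \<longrightarrow> g x = Q x"
  proof -
    have "AE x in lborel. \<forall>n. 0 < x \<and> x < 1 \<longrightarrow> Zc (t n) x = P n x"
      unfolding AE_all_countable using P(4) by blast
    then show ?thesis using V_slice
    proof eventually_elim
      case (elim x)
      show ?case
      proof
        assume x: "0 < x \<and> x < 1"
        \<comment> \<open>At such an x the integral of \<open>V\<close> over [t n, T) tends to 0, so
          \<open>Zc (t n) x\<close> tends to \<open>g x\<close>, while the primitives tend to
          \<open>Q x\<close>; this identifies \<open>g\<close> with \<open>Q\<close>.\<close>
        have "(\<lambda>n. \<integral>\<sigma>. indicator {t n..} \<sigma> * V (x, \<sigma>) \<partial>lborel) \<longlonglongrightarrow> 0"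
        proof -
          have "(\<lambda>n. \<integral>\<sigma>. indicator {t n..<T} \<sigma> * V (x, \<sigma>) \<partial>lborel) \<longlonglongrightarrow> 0"
          proof (rule shrinking_integral_tendsto_0)
            show "\<forall>\<^sub>F n in sequentially. y \<notin> {t n..<T}" for y
            proof (cases "y < T")
              case True
              then have "\<forall>\<^sub>F n in sequentially. l n < (T - y) / 2" by (intro order_tendstoD(2)[OF l0]) simp
              then show ?thesis
              proof (rule eventually_mono)
                fix n assume "l n < (T - y) / 2"
                then show "y \<notin> {t n..<T}" using Tt[of n] by simp
              qed
            qed simp
          qed (use elim in auto)
          moreover have "indicator {t n..<T} \<sigma> * V (x, \<sigma>) = indicator {t n..} \<sigma> * V (x, \<sigma>)" for n \<sigma>
            using supp[of x \<sigma>] by (auto split: split_indicator)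
          ultimately show ?thesis by simp
        qed
        then have "(\<lambda>n. Zc (t n) x) \<longlonglongrightarrow> g x - 0"
          unfolding Zc_def by (intro tendsto_intros)
        then have "(\<lambda>k. Zc (t (\<rho> k)) x) \<longlonglongrightarrow> g x"
          using LIMSEQ_subseq_LIMSEQ[OF _ \<rho>, of "\<lambda>n. Zc (t n) x"] by (simp add: comp_def)
        moreover have "(\<lambda>k. Zc (t (\<rho> k)) x) \<longlonglongrightarrow> Q x" using PQ[of x] elim x by simp
        ultimately show "g x = Q x" by (rule LIMSEQ_unique)
      qed
    qed
  qed
  have "H10_pair g q"
    unfolding H10_pair_def using qm q0 q2 g_supp QP Q0 Q1 gQ by auto
  then show thesis by (rule that)
qed

end

section \<open>The energy inequality\<close>

lemma AE_shift:
  fixes P :: "real \<Rightarrow> bool"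
  assumes "AE x in lborel. P x"
  shows "AE x in lborel. P (x + h)"
proof -
  obtain N where N: "N \<in> null_sets lborel" "{x. \<not> P x} \<subseteq> N"
    using assms by (auto simp: eventually_ae_filter)
  then have [measurable]: "N \<in> sets borel" by auto
  have "AE x in lborel. x \<notin> N" using N(1) by (rule AE_not_in)
  then have "AE x in lborel. h + 1 * x \<notin> N" by (intro AE_borel_affine) auto
  then show ?thesis by eventually_elim (use N(2) in \<open>auto simp: add.commute\<close>)
qed

context evolution_setting
begin

text \<open>The correlation of \<open>Y\<close> with the time translates of \<open>V\<close>. Its
  value at 0 is the pairing to be estimated; its average over [0,h) is the pairing of
  \<open>Y\<close> with a difference quotient of \<open>Zc\<close>.\<close>

definition corr :: "real \<Rightarrow> real" where
  "corr \<sigma> = (\<integral>z. Y z * V (z + (0, \<sigma>)) \<partial>lborel)"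

lemma corr_eq:
  fixes z :: "real \<times> real"
  shows "(sqrt (a (fst z)) * Y z) * (V (z + (0, \<sigma>)) / sqrt (a (fst (z + (0, \<sigma>))))) = Y z * V (z + (0, \<sigma>))"
  using a_pos[of "fst z"] by (simp add: less_imp_neq[symmetric])

lemma sqrt_a_meas: "(\<lambda>z :: real \<times> real. sqrt (a (fst z))) \<in> borel_measurable borel"
proof -
  have "(\<lambda>z. sqrt (a (fst z))) \<in> borel_measurable (borel \<Otimes>\<^sub>M (borel :: real measure))" by measurable
  then show ?thesis by (simp add: borel_prod)
qed

lemma L2_factors:
  "(\<lambda>z. sqrt (a (fst z)) * Y z) \<in> borel_measurable borel" "(\<lambda>z. V z / sqrt (a (fst z))) \<in> borel_measurable borel"
  "integrable lborel (\<lambda>z. (sqrt (a (fst z)) * Y z)\<^sup>2)" "integrable lborel (\<lambda>z. (V z / sqrt (a (fst z)))\<^sup>2)"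
proof -
  note sqrt_a_meas[measurable]
  show "(\<lambda>z. sqrt (a (fst z)) * Y z) \<in> borel_measurable borel" "(\<lambda>z. V z / sqrt (a (fst z))) \<in> borel_measurable borel"
    by measurable
  have "(sqrt (a (fst z)) * Y z)\<^sup>2 = a (fst z) * (Y z)\<^sup>2" "(V z / sqrt (a (fst z)))\<^sup>2 = (V z)\<^sup>2 / a (fst z)" for z
    using a_pos[of "fst z"] by (auto simp: power_mult_distrib power_divide)
  then show "integrable lborel (\<lambda>z. (sqrt (a (fst z)) * Y z)\<^sup>2)" "integrable lborel (\<lambda>z. (V z / sqrt (a (fst z)))\<^sup>2)"
    using Y_int V_int by simp_all
qed

text \<open>Square integrable on the plane are sqrt(a) Y and V / sqrt(a). As \<open>a\<close>
  depends on x alone, the two weights still cancel after a translation in time, so continuity of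
  translations applies to these factors.\<close>

lemma corr_continuous: "((\<lambda>\<sigma>. corr \<sigma>) \<longlongrightarrow> corr 0) (at 0)"
proof -
  have "((\<lambda>t. \<integral>z. (sqrt (a (fst z)) * Y z) * (V (z + t) / sqrt (a (fst (z + t)))) \<partial>lborel)
      \<longlongrightarrow> (\<integral>z. (sqrt (a (fst z)) * Y z) * (V z / sqrt (a (fst z))) \<partial>lborel)) (at (0 :: real \<times> real))"
    by (rule L2_translation_continuous[OF L2_factors])
  moreover have "filterlim (\<lambda>\<sigma>::real. (0 :: real, \<sigma>)) (at (0 :: real \<times> real)) (at 0)"
    by (auto simp: filterlim_at zero_prod_def eventually_at_filter intro!: tendsto_Pair)
  ultimately have "((\<lambda>\<sigma>. \<integral>z. (sqrt (a (fst z)) * Y z) * (V (z + (0, \<sigma>)) / sqrt (a (fst (z + (0, \<sigma>))))) \<partial>lborel)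
      \<longlongrightarrow> (\<integral>z. (sqrt (a (fst z)) * Y z) * (V z / sqrt (a (fst z))) \<partial>lborel)) (at 0)"
    by (rule filterlim_compose)
  moreover have "(sqrt (a (fst z)) * Y z) * (V z / sqrt (a (fst z))) = Y z * V (z + (0, 0))" for z
    using corr_eq[of z 0] by (simp flip: zero_prod_def)
  ultimately show ?thesis unfolding corr_eq corr_def by simp
qed

lemma YV_integrable: "integrable lborel (\<lambda>z. Y z * V (z + (0, \<sigma>)))"
proof -
  have "integrable lborel (\<lambda>z. (sqrt (a (fst z)) * Y z) * (V (z + (0, \<sigma>)) / sqrt (a (fst (z + (0, \<sigma>))))))"
  proof (rule integrable_mult_L2)
    have m[measurable]: "(\<lambda>z. V z / sqrt (a (fst z))) \<in> borel_measurable borel" by (rule L2_factors)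
    have "(\<lambda>z. V (z + (0, \<sigma>)) / sqrt (a (fst (z + (0, \<sigma>))))) \<in> borel_measurable borel"
      by (rule measurable_compose[OF _ m]) simp
    then show "(\<lambda>z. V (z + (0, \<sigma>)) / sqrt (a (fst (z + (0, \<sigma>))))) \<in> borel_measurable lborel" by simp
    show "integrable lborel (\<lambda>z. (V (z + (0, \<sigma>)) / sqrt (a (fst (z + (0, \<sigma>)))))\<^sup>2)"
      by (subst lborel_shift(1)[of "\<lambda>z. (V z / sqrt (a (fst z)))\<^sup>2"]) (simp, rule L2_factors)
  qed (use L2_factors in auto)
  then show ?thesis unfolding corr_eq .
qed

text \<open>The bound is uniform in \<sigma>, as Fubini for the pair of \<sigma> and the point of
  the plane requires.\<close>

lemma corr_bounded: "(\<integral>z. norm (Y z * V (z + (0, \<sigma>))) \<partial>lborel)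
    \<le> (\<integral>z. a (fst z) * (Y z)\<^sup>2 \<partial>lborel) + (\<integral>z. (V z)\<^sup>2 / a (fst z) \<partial>lborel)"
proof -
  let ?f = "\<lambda>z :: real \<times> real. (V z)\<^sup>2 / a (fst z)"
  have m[measurable]: "?f \<in> borel_measurable borel" using V_int by auto
  have i: "integrable lborel (\<lambda>z. ?f (z + (0, \<sigma>)))" "(\<integral>z. ?f (z + (0, \<sigma>)) \<partial>lborel) = (\<integral>z. ?f z \<partial>lborel)"
    using lborel_shift[OF m, of "(0, \<sigma>)"] V_int by auto
  have "(\<integral>z. norm (Y z * V (z + (0, \<sigma>))) \<partial>lborel) \<le> (\<integral>z. a (fst z) * (Y z)\<^sup>2 + ?f (z + (0, \<sigma>)) \<partial>lborel)"
  proof (rule integral_mono)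
    fix z :: "real \<times> real"
    have p: "a (fst z) > 0" by (rule a_pos)
    have "2 * \<bar>sqrt (a (fst z)) * Y z\<bar> * \<bar>V (z + (0, \<sigma>)) / sqrt (a (fst z))\<bar>
        \<le> \<bar>sqrt (a (fst z)) * Y z\<bar>\<^sup>2 + \<bar>V (z + (0, \<sigma>)) / sqrt (a (fst z))\<bar>\<^sup>2"
      by (rule sum_squares_bound)
    then have "2 * norm (Y z * V (z + (0, \<sigma>))) \<le> a (fst z) * (Y z)\<^sup>2 + ?f (z + (0, \<sigma>))"
      using p by (simp add: abs_mult abs_divide power_mult_distrib power_divide)
    then show "norm (Y z * V (z + (0, \<sigma>))) \<le> a (fst z) * (Y z)\<^sup>2 + ?f (z + (0, \<sigma>))"
      using norm_ge_zero[of "Y z * V (z + (0, \<sigma>))"] by linarith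
  qed (intro integrable_norm YV_integrable Bochner_Integration.integrable_add Y_int i)+
  also have "\<dots> = (\<integral>z. a (fst z) * (Y z)\<^sup>2 \<partial>lborel) + (\<integral>z. ?f (z + (0, \<sigma>)) \<partial>lborel)"
    by (rule Bochner_Integration.integral_add[OF Y_int i(1)])
  finally show ?thesis unfolding i(2) .
qed

text \<open>The increment of \<open>Zc\<close> from t to t + h is the integral of V (x, t +
  \<sigma>) over \<sigma> in [0,h); exchanging this integral with the one over the plane leaves
  \<open>corr\<close>.\<close>

lemma increment_pairing:
  assumes h: "h > 0"
  shows "integrable lborel (\<lambda>t. \<integral>x. Y (x, t) * (Zc (t + h) x - Zc t x) \<partial>lborel)"
    and "(\<integral>t. \<integral>x. Y (x, t) * (Zc (t + h) x - Zc t x) \<partial>lborel \<partial>lborel) = (\<integral>\<sigma>. indicator {0..<h} \<sigma> * corr \<sigma> \<partial>lborel)"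
    and "integrable lborel (\<lambda>\<sigma>. indicator {0..<h} \<sigma> * corr \<sigma>)"
proof -
  define K where "K \<sigma> z = indicator {0..<h} \<sigma> * (Y z * V (z + (0, \<sigma>)))" for \<sigma> :: real and z :: "real \<times> real"
  let ?B = "(\<integral>z. a (fst z) * (Y z)\<^sup>2 \<partial>lborel) + (\<integral>z. (V z)\<^sup>2 / a (fst z) \<partial>lborel)"
  have sh: "(\<lambda>(\<sigma>, z). z + (0, \<sigma>)) \<in> measurable (lborel \<Otimes>\<^sub>M lborel) (borel :: (real \<times> real) measure)"
    by (simp add: lborel_prod case_prod_beta')
       (intro borel_measurable_continuous_onI continuous_intros)
  have Km: "(\<lambda>(\<sigma>, z). K \<sigma> z) \<in> borel_measurable (lborel \<Otimes>\<^sub>M lborel)"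
  proof -
    have "(\<lambda>w. V (case w of (\<sigma>, z) \<Rightarrow> z + (0, \<sigma>))) \<in> borel_measurable (lborel \<Otimes>\<^sub>M lborel)"
      by (rule measurable_compose[OF sh V_meas])
    then have [measurable]: "(\<lambda>w. V (snd w + (0, fst w))) \<in> borel_measurable (lborel \<Otimes>\<^sub>M lborel)"
      by (simp only: case_prod_beta')
    show ?thesis unfolding K_def case_prod_beta' by measurable
  qed
  have Kn: "(\<integral>z. norm (K \<sigma> z) \<partial>lborel) \<le> indicator {0..<h} \<sigma> * ?B" for \<sigma>
    using corr_bounded[of \<sigma>] by (auto simp: K_def split: split_indicator)
  have Kint: "integrable (lborel \<Otimes>\<^sub>M lborel) (\<lambda>(\<sigma>, z). K \<sigma> z)"
  proof (rule lborel_pair.Fubini_integrable[OF Km])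
    have i: "integrable lborel (\<lambda>\<sigma>. indicator {0..<h} \<sigma> * ?B)"
      using h by (intro integrable_mult_left) (simp add: integrable_indicator_iff)
    show "integrable lborel (\<lambda>\<sigma>. \<integral>z. norm (case (\<sigma>, z) of (\<sigma>, z) \<Rightarrow> K \<sigma> z) \<partial>lborel)"
    proof (rule Bochner_Integration.integrable_bound[OF i])
      have "(\<lambda>w. norm (case w of (\<sigma>, z) \<Rightarrow> K \<sigma> z)) \<in> borel_measurable (lborel \<Otimes>\<^sub>M lborel)"
        using Km by measurable
      then show "(\<lambda>\<sigma>. \<integral>z. norm (case (\<sigma>, z) of (\<sigma>, z) \<Rightarrow> K \<sigma> z) \<partial>lborel) \<in> borel_measurable lborel"
        by (intro lborel.borel_measurable_lebesgue_integral) (simp only: case_prod_beta' prod.collapse fst_conv snd_conv)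
      show "AE \<sigma> in lborel. norm (\<integral>z. norm (case (\<sigma>, z) of (\<sigma>, z) \<Rightarrow> K \<sigma> z) \<partial>lborel) \<le> norm (indicator {0..<h} \<sigma> * ?B)"
        using Kn by (intro AE_I2) (simp add: order.trans[OF _ abs_ge_self])
    qed
    show "AE \<sigma> in lborel. integrable lborel (\<lambda>z. case (\<sigma>, z) of (\<sigma>, z) \<Rightarrow> K \<sigma> z)"
      using YV_integrable by (simp add: K_def)
  qed
  define G where "G z = (\<integral>\<sigma>. K \<sigma> z \<partial>lborel)" for z
  have Gi: "integrable lborel G" unfolding G_def by (rule lborel_pair.integrable_snd[OF Kint])
  have Gm: "G \<in> borel_measurable borel" using Gi by auto
  have cK: "(\<integral>z. K \<sigma> z \<partial>lborel) = indicator {0..<h} \<sigma> * corr \<sigma>" for \<sigma>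
    by (simp add: K_def corr_def)
  show "integrable lborel (\<lambda>\<sigma>. indicator {0..<h} \<sigma> * corr \<sigma>)"
    using lborel_pair.integrable_fst[OF Kint] by (simp add: cK)
  have GJ: "(\<integral>x. G (x, t) \<partial>lborel) = (\<integral>x. Y (x, t) * (Zc (t + h) x - Zc t x) \<partial>lborel)" for t
  proof (rule integral_cong_AE)
    show "(\<lambda>x. G (x, t)) \<in> borel_measurable lborel" using Pair_measurable_fst[OF Gm] by simp
    show "(\<lambda>x. Y (x, t) * (Zc (t + h) x - Zc t x)) \<in> borel_measurable lborel"
      using Pair_measurable_fst[OF Y_meas, of t] by measurable
    show "AE x in lborel. G (x, t) = Y (x, t) * (Zc (t + h) x - Zc t x)"
      using V_slice
    proof eventually_elim
      case (elim x)
      have [measurable]: "(\<lambda>t. V (x, t)) \<in> borel_measurable borel" by (rule Pair_measurable_snd[OF V_meas])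
      have "G (x, t) = Y (x, t) * (\<integral>\<sigma>. indicator {0..<h} \<sigma> * V (x, t + \<sigma>) \<partial>lborel)"
        unfolding G_def K_def by (simp add: ac_simps flip: integral_mult_right_zero)
      also have "(\<integral>\<sigma>. indicator {0..<h} \<sigma> * V (x, t + \<sigma>) \<partial>lborel)
          = (\<integral>\<sigma>. (\<lambda>\<tau>. indicator {t..<t+h} \<tau> * V (x, \<tau>)) (\<sigma> + t) \<partial>lborel)"
        by (intro Bochner_Integration.integral_cong) (auto split: split_indicator simp: add.commute)
      also have "\<dots> = (\<integral>\<tau>. indicator {t..<t+h} \<tau> * V (x, \<tau>) \<partial>lborel)"
        by (rule lborel_shift(2)) measurable
      also have "\<dots> = Zc (t + h) x - Zc t x"
        using elim h by (intro Zc_diff[symmetric]) auto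
      finally show ?case .
    qed
  qed
  show "integrable lborel (\<lambda>t. \<integral>x. Y (x, t) * (Zc (t + h) x - Zc t x) \<partial>lborel)"
    using Fubini_plane_snd(2)[OF Gi] unfolding GJ .
  have "(\<integral>t. \<integral>x. Y (x, t) * (Zc (t + h) x - Zc t x) \<partial>lborel \<partial>lborel) = (\<integral>z. G z \<partial>lborel)"
    using Fubini_plane_snd(3)[OF Gi] unfolding GJ .
  also have "\<dots> = (\<integral>\<sigma>. \<integral>z. K \<sigma> z \<partial>lborel \<partial>lborel)"
    unfolding G_def by (rule lborel_pair.Fubini_integral[OF Kint])
  finally show "(\<integral>t. \<integral>x. Y (x, t) * (Zc (t + h) x - Zc t x) \<partial>lborel \<partial>lborel) = (\<integral>\<sigma>. indicator {0..<h} \<sigma> * corr \<sigma> \<partial>lborel)"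
    unfolding cK .
qed

text \<open>Convexity of the Dirichlet integral gives \<open>e t - e (t + h) \<le> 2 \<langle>Y t, Zc (t + h) - Zc t\<rangle>\<close>; the
  left-hand side telescopes upon integration, with \<open>Zc\<close> constantly continued by \<open>g\<close> after \<open>T\<close>.\<close>

lemma discrete_energy_inequality:
  assumes q: "H10_pair g q" and h: "h > 0"
  shows "- (h * (\<integral>x. (q x)\<^sup>2 \<partial>lborel)) \<le> 2 * (\<integral>\<sigma>. indicator {0..<h} \<sigma> * corr \<sigma> \<partial>lborel)"
proof -
  define Q2 where "Q2 = (\<integral>x. (q x)\<^sup>2 \<partial>lborel)"
  have Q2: "Q2 \<ge> 0" by (simp add: Q2_def)
  let ?J = "\<lambda>t. \<integral>x. Y (x, t) * (Zc (t + h) x - Zc t x) \<partial>lborel"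
  have e0: "e t = 0" if "\<not> (0 < t \<and> t < T)" for t using supp that by (simp add: e_def)
  have J0: "?J t = 0" if "\<not> (0 < t \<and> t < T)" for t using supp that by simp
  have main: "e t - w2 \<le> 2 * ?J t"
    if t: "good t" and w: "H10_pair (Zc (t + h)) w'" "integrable lborel (\<lambda>x. (Zc (t + h) x)\<^sup>2 / a x)"
      "w2 = (\<integral>x. (w' x)\<^sup>2 \<partial>lborel)" for t w' w2
  proof -
    have "0 \<le> (\<integral>x. (w' x - X (x, t))\<^sup>2 \<partial>lborel)" by simp
    then show ?thesis unfolding energy_identity[OF t w(1,2)] w(3) by linarith
  qed
  \<comment> \<open>The indicator compensates for two different extensions beyond T:
    \<open>Zc\<close> continues as \<open>g\<close>, whose energy is \<open>Q2\<close>, whereas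
    \<open>e\<close> continues as 0.\<close>
  have ae: "AE t in lborel. e t - e (t + h) - Q2 * indicator {T - h..<T} t \<le> 2 * ?J t"
    using AE_good AE_shift[OF AE_good, of h]
  proof eventually_elim
    case (elim t)
    consider "\<not> (0 < t \<and> t < T)" | "0 < t" "t < T" "t + h < T" | "0 < t" "t < T" "T \<le> t + h" by linarith
    then show ?case
    proof cases
      \<comment> \<open>This includes -h < t \<le> 0, where t + h may lie in (0,T): the energy there
        enters with a minus sign and is dropped. It is the contribution of the initial time.\<close>
      case 1
      have "Q2 * indicator {T - h..<T} t \<ge> 0" using Q2 by simp
      then show ?thesis using e0[OF 1] J0[OF 1] e_nonneg[of "t + h"] by simp
    next
      case 2
      then have g: "good t" "good (t + h)" using elim h by auto
      have "e t - e (t + h) \<le> 2 * ?J t"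
        by (rule main[OF g(1), where w'="\<lambda>x. X (x, t + h)"]) (use g(2) in \<open>auto simp: good_def e_def\<close>)
      moreover have "Q2 * indicator {T - h..<T} t \<ge> 0" using Q2 by simp
      ultimately show ?thesis by linarith
    next
      case 3
      have Zg: "Zc (t + h) = g" using Zc_at_T[OF 3(3)] by (rule ext)
      have "e t - Q2 \<le> 2 * ?J t"
        by (rule main[where w'=q]) (use elim 3 q g_int in \<open>auto simp: Zg Q2_def\<close>)
      moreover have "e (t + h) = 0" using 3 by (intro e0) auto
      moreover have "indicator {T - h..<T} t = (1 :: real)" using 3 by simp
      ultimately show ?thesis by simp
    qed
  qed
  have em[measurable]: "e \<in> borel_measurable borel" using e_integrable by auto
  have es: "integrable lborel (\<lambda>t. e (t + h))" "(\<integral>t. e (t + h) \<partial>lborel) = (\<integral>t. e t \<partial>lborel)"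
    using lborel_shift[OF em, of h] e_integrable by auto
  have i1: "integrable lborel (\<lambda>t. indicator {T - h..<T} t :: real)"
    using h by (simp add: integrable_indicator_iff)
  have li: "integrable lborel (\<lambda>t. e t - e (t + h) - Q2 * indicator {T - h..<T} t)"
    by (intro Bochner_Integration.integrable_diff integrable_mult_right e_integrable es i1)
  have "(\<integral>t. e t - e (t + h) - Q2 * indicator {T - h..<T} t \<partial>lborel) \<le> (\<integral>t. 2 * ?J t \<partial>lborel)"
    by (rule integral_mono_AE[OF li _ ae]) (intro integrable_mult_right increment_pairing h)
  moreover have "(\<integral>t. e t - e (t + h) - Q2 * indicator {T - h..<T} t \<partial>lborel) = - (h * Q2)"
  proof -
    have "(\<integral>t. e t - e (t + h) - Q2 * indicator {T - h..<T} t \<partial>lborel)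
        = (\<integral>t. e t \<partial>lborel) - (\<integral>t. e (t + h) \<partial>lborel) - Q2 * (\<integral>t. indicator {T - h..<T} t \<partial>lborel)"
      by (simp add: e_integrable es i1)
    moreover have "(\<integral>t. indicator {T - h..<T} t \<partial>lborel) = h" using h by simp
    ultimately show ?thesis unfolding es(2) by simp
  qed
  ultimately show ?thesis using increment_pairing(2)[OF h] by (simp add: Q2_def)
qed

text \<open>Formally, twice the pairing of Z_t with Z_xx is minus the time derivative of the
  Dirichlet integral, so the left-hand side is minus the final energy. The proof divides the
  discrete inequality by h and uses that \<open>corr\<close> is continuous at 0.\<close>

theorem energy_inequality:
  assumes q: "H10_pair g q"
  shows "- (\<integral>x. (q x)\<^sup>2 \<partial>lborel) \<le> 2 * (\<integral>z. Y z * V z \<partial>lborel)"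
proof (rule ccontr)
  define Q2 where "Q2 = (\<integral>x. (q x)\<^sup>2 \<partial>lborel)"
  assume "\<not> ?thesis"
  moreover have "corr 0 = (\<integral>z. Y z * V z \<partial>lborel)" by (simp add: corr_def flip: zero_prod_def)
  ultimately have neg: "2 * corr 0 < - Q2" by (simp add: Q2_def)
  \<comment> \<open>The midpoint of \<open>corr 0\<close> and -Q2 / 2. By continuity
    \<open>corr\<close> is at most \<open>m\<close> on a short interval [0,h), which contradicts the
    discrete inequality for that h.\<close>
  define m where "m = (2 * corr 0 - Q2) / 4"
  have m: "corr 0 < m" "2 * m < - Q2" using neg by (auto simp: m_def field_simps)
  have "\<forall>\<^sub>F \<sigma> in at 0. corr \<sigma> < m" by (rule order_tendstoD(2)[OF corr_continuous m(1)])
  then obtain d where d: "d > 0" "\<And>\<sigma>. \<sigma> \<noteq> 0 \<Longrightarrow> \<bar>\<sigma>\<bar> < d \<Longrightarrow> corr \<sigma> < m"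
    by (auto simp: eventually_at dist_real_def)
  define h where "h = d / 2"
  have h: "h > 0" "h < d" using d by (auto simp: h_def)
  have "(\<integral>\<sigma>. indicator {0..<h} \<sigma> * corr \<sigma> \<partial>lborel) \<le> (\<integral>\<sigma>. m * indicator {0..<h} \<sigma> \<partial>lborel)"
  proof (rule integral_mono[OF increment_pairing(3)[OF h(1)]])
    show "integrable lborel (\<lambda>\<sigma>. m * indicator {0..<h} \<sigma>)"
      using h by (intro integrable_mult_right) (simp add: integrable_indicator_iff)
    fix \<sigma>
    have "corr \<sigma> \<le> m" if "\<sigma> \<in> {0..<h}" using d(2)[of \<sigma>] m(1) that h by (cases "\<sigma> = 0") (auto intro: less_imp_le)
    then show "indicator {0..<h} \<sigma> * corr \<sigma> \<le> m * indicator {0..<h} \<sigma>" by (auto split: split_indicator)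
  qed
  also have "\<dots> = m * h" using h by simp
  finally have "- (h * Q2) \<le> 2 * (m * h)"
    using discrete_energy_inequality[OF q h(1)] unfolding Q2_def by linarith
  then have "h * (- Q2) \<le> h * (2 * m)" by (simp add: ac_simps)
  then have "- Q2 \<le> 2 * m" using h(1) by (simp only: mult_le_cancel_left_pos)
  then show False using m(2) by simp
qed

end

section \<open>The weighted estimate\<close>

lemma AE_fst:
  fixes P :: "real \<Rightarrow> bool"
  assumes "AE x in lborel. P x"
  shows "AE z in (lborel :: (real \<times> real) measure). P (fst z)"
proof -
  obtain N where N: "N \<in> null_sets lborel" "{x. \<not> P x} \<subseteq> N"
    using assms by (auto simp: eventually_ae_filter)
  then have [measurable]: "N \<in> sets borel" by auto
  have "AE z in lborel \<Otimes>\<^sub>M lborel. fst z \<notin> N"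
  proof (rule lborel_pair.AE_pair_measure)
    show "AE x in lborel. AE y in lborel. fst (x, y) \<notin> N" using AE_not_in[OF N(1)] by eventually_elim simp
  qed measurable
  then have "AE z in (lborel :: (real \<times> real) measure). fst z \<notin> N" unfolding lborel_prod .
  then show ?thesis by eventually_elim (use N(2) in auto)
qed

lemma integrable_bounded_mult:
  fixes f w :: "real \<times> real \<Rightarrow> real"
  assumes f: "integrable lborel f" and w: "w \<in> borel_measurable borel"
    and b: "\<And>z. f z \<noteq> 0 \<Longrightarrow> \<bar>w z\<bar> \<le> M"
  shows "integrable lborel (\<lambda>z. w z * f z)"
proof (rule Bochner_Integration.integrable_bound)
  show "integrable lborel (\<lambda>z. M * f z)" using f by simp
  show "AE z in lborel. norm (w z * f z) \<le> norm (M * f z)"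
  proof (rule AE_I2)
    fix z
    show "norm (w z * f z) \<le> norm (M * f z)"
    proof (cases "f z = 0")
      case False
      have "\<bar>w z\<bar> * \<bar>f z\<bar> \<le> \<bar>M\<bar> * \<bar>f z\<bar>"
        using b[OF False] by (intro mult_right_mono) auto
      then show ?thesis by (simp add: abs_mult)
    qed simp
  qed
  show "(\<lambda>z. w z * f z) \<in> borel_measurable lborel" using f w by measurable
qed

lemma integral_six:
  fixes f\<^sub>1 :: "'a \<Rightarrow> real"
  assumes "integrable M f\<^sub>1" "integrable M f\<^sub>2" "integrable M f\<^sub>3" "integrable M f\<^sub>4" "integrable M f\<^sub>5" "integrable M f\<^sub>6"
  shows "(\<integral>x. f\<^sub>1 x + f\<^sub>2 x + f\<^sub>3 x + 2 * f\<^sub>4 x - 2 * f\<^sub>5 x - 2 * f\<^sub>6 x \<partial>M) =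
    (\<integral>x. f\<^sub>1 x \<partial>M) + (\<integral>x. f\<^sub>2 x \<partial>M) + (\<integral>x. f\<^sub>3 x \<partial>M) + 2 * (\<integral>x. f\<^sub>4 x \<partial>M) - 2 * (\<integral>x. f\<^sub>5 x \<partial>M) - 2 * (\<integral>x. f\<^sub>6 x \<partial>M)"
  using assms by simp

lemma H10_pair_cmult:
  assumes "H10_pair p q" shows "H10_pair (\<lambda>x. k * p x) (\<lambda>x. k * q x)"
proof -
  obtain P where P: "primitive_on {0..1} q P" "P 0 = 0" "P 1 = 0" "AE x in lborel. 0 < x \<and> x < 1 \<longrightarrow> p x = P x"
    using assms by (auto simp: H10_pair_def)
  have "AE x in lborel. 0 < x \<and> x < 1 \<longrightarrow> k * p x = k * P x"
    using P(4) by eventually_elim auto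
  then have "\<exists>P. primitive_on {0..1} (\<lambda>x. k * q x) P \<and> P 0 = 0 \<and> P 1 = 0 \<and> (AE x in lborel. 0 < x \<and> x < 1 \<longrightarrow> k * p x = P x)"
    using primitive_on_cmult[OF P(1), of k] P(2,3) by (intro exI[of _ "\<lambda>x. k * P x"]) simp
  moreover have [measurable]: "p \<in> borel_measurable borel" "q \<in> borel_measurable borel"
    using assms by (auto simp: H10_pair_def)
  have "(\<lambda>x. k * p x) \<in> borel_measurable borel" "(\<lambda>x. k * q x) \<in> borel_measurable borel" by measurable
  ultimately show ?thesis using assms unfolding H10_pair_def by (simp add: power_mult_distrib)
qed

lemma weak_deriv_pair_cmult:
  assumes "weak_deriv_pair q r" shows "weak_deriv_pair (\<lambda>x. k * q x) (\<lambda>x. k * r x)"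
proof -
  obtain Q where Q: "primitive_on {0<..<1} r Q" "AE x in lborel. 0 < x \<and> x < 1 \<longrightarrow> q x = Q x"
    using assms by (auto simp: weak_deriv_pair_def)
  have "AE x in lborel. 0 < x \<and> x < 1 \<longrightarrow> k * q x = k * Q x"
    using Q(2) by eventually_elim auto
  then have "\<exists>Q. primitive_on {0<..<1} (\<lambda>x. k * r x) Q \<and> (AE x in lborel. 0 < x \<and> x < 1 \<longrightarrow> k * q x = Q x)"
    using primitive_on_cmult[OF Q(1), of k] by blast
  moreover have [measurable]: "r \<in> borel_measurable borel" using assms by (auto simp: weak_deriv_pair_def)
  have "(\<lambda>x. k * r x) \<in> borel_measurable borel" by measurable
  ultimately show ?thesis using assms unfolding weak_deriv_pair_def by simp
qed

context evolution_setting
begin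

section \<open>Bilinear expressions of the evolution under a weight in time\<close>

lemma primitive_Zc:
  assumes "integrable lborel (\<lambda>\<tau>. V (x, \<tau>))"
  shows "primitive_on UNIV (\<lambda>t. V (x, t)) (\<lambda>t. Zc t x)"
  unfolding Zc_def by (rule primitive_tail_integral[OF assms])

lemma AE_time_slice:
  "AE x in lborel. integrable lborel (\<lambda>t. V (x, t)) \<and>
     (AE t in lborel. 0 < x \<and> x < 1 \<and> 0 < t \<and> t < T \<longrightarrow> Z (x, t) = Zc t x)"
  using V_slice AE_plane(1)[OF time]
  by eventually_elim (auto simp: Zc_def elim!: eventually_mono)

lemma product_integrable:
  "integrable lborel (\<lambda>z. Y z * Z z)" "integrable lborel (\<lambda>z. Z z * V z / a (fst z))"
  "integrable lborel (\<lambda>z. Y z * V z)"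
proof -
  note sqrt_a_meas[measurable]
  have e: "(sqrt (a (fst z)) * Y z) * (P / sqrt (a (fst z))) = Y z * P"
    "(Z z / sqrt (a (fst z))) * (V z / sqrt (a (fst z))) = Z z * V z / a (fst z)"
    "(sqrt (a (fst z)) * Y z)\<^sup>2 = a (fst z) * (Y z)\<^sup>2" "(P / sqrt (a (fst z)))\<^sup>2 = P\<^sup>2 / a (fst z)" for z P
    using a_pos[of "fst z"] by (auto simp: power_mult_distrib power_divide)
  have m: "(\<lambda>z. sqrt (a (fst z)) * Y z) \<in> borel_measurable lborel" "(\<lambda>z. Z z / sqrt (a (fst z))) \<in> borel_measurable lborel"
    "(\<lambda>z. V z / sqrt (a (fst z))) \<in> borel_measurable lborel"
    by measurable
  show "integrable lborel (\<lambda>z. Y z * Z z)" "integrable lborel (\<lambda>z. Z z * V z / a (fst z))"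
    "integrable lborel (\<lambda>z. Y z * V z)"
    using integrable_mult_L2[OF m(1,2)] integrable_mult_L2[OF m(2,3)] integrable_mult_L2[OF m(1,3)] Z_int V_int Y_int
    by (simp_all only: e)
qed

lemma continuous_mult_integrable:
  fixes f :: "real \<times> real \<Rightarrow> real"
  assumes w: "continuous_on UNIV w" and f: "integrable lborel f"
    and z: "\<And>x t. \<not> (0 < x \<and> x < 1 \<and> 0 < t \<and> t < T) \<Longrightarrow> f (x, t) = 0"
  shows "integrable lborel (\<lambda>z. w (snd z) * f z)"
proof -
  have "compact (w ` {0..T})"
    by (intro compact_continuous_image continuous_on_subset[OF w]) auto
  then have "bounded (w ` {0..T})" by (rule compact_imp_bounded)
  then obtain M where M: "\<And>t. t \<in> {0..T} \<Longrightarrow> \<bar>w t\<bar> \<le> M"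
    unfolding bounded_iff by (metis imageI real_norm_def)
  show ?thesis
  proof (rule integrable_bounded_mult[OF f, of _ M])
    show "(\<lambda>z :: real \<times> real. w (snd z)) \<in> borel_measurable borel"
      by (intro snd_measurable borel_measurable_continuous_onI w)
    fix z assume "f z \<noteq> 0"
    then have "0 < snd z \<and> snd z < T" using z[of "fst z" "snd z"] by force
    then show "\<bar>w (snd z)\<bar> \<le> M" by (intro M) auto
  qed
qed

context
  fixes \<psi> \<psi>' :: "real \<Rightarrow> real"
  assumes \<psi>_deriv: "\<And>t. (\<psi> has_real_derivative \<psi>' t) (at t)" and \<psi>'_cont: "continuous_on UNIV \<psi>'"
    and \<psi>'_nonneg: "\<And>t. 0 \<le> \<psi>' t" and \<psi>_nonneg: "\<And>t. 0 \<le> \<psi> t"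
begin

lemma \<psi>_cont: "continuous_on UNIV \<psi>"
  using \<psi>_deriv by (meson DERIV_isCont continuous_at_imp_continuous_on)

lemmas \<psi>_mult_integrable = continuous_mult_integrable[OF \<psi>_cont]

text \<open>The weight depends on time only, so integration by parts is done on each slice and
  Fubini collects the result.\<close>

lemma weighted_parts: "(\<integral>z. \<psi> (snd z) * (Y z * Z z) \<partial>lborel) = - (\<integral>z. \<psi> (snd z) * (X z)\<^sup>2 \<partial>lborel)"
proof -
  have i1: "integrable lborel (\<lambda>z. \<psi> (snd z) * (Y z * Z z))"
    by (rule \<psi>_mult_integrable[OF product_integrable(1)]) (use supp in auto)
  have i2: "integrable lborel (\<lambda>z. \<psi> (snd z) * (X z)\<^sup>2)"
    by (rule \<psi>_mult_integrable[OF X_int]) (use supp in auto)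
  have "AE t in lborel. (\<integral>x. \<psi> t * (Y (x, t) * Z (x, t)) \<partial>lborel) = - (\<integral>x. \<psi> t * (X (x, t))\<^sup>2 \<partial>lborel)"
    using space Fubini_plane_snd(1)[OF product_integrable(1)]
  proof eventually_elim
    case (elim t)
    show ?case
    proof (cases "0 < t \<and> t < T")
      case True
      have [measurable]: "(\<lambda>x. X (x, t)) \<in> borel_measurable borel" by (rule Pair_measurable_fst[OF X_meas])
      have H: "H10_pair (\<lambda>x. Z (x, t)) (\<lambda>x. X (x, t))" "weak_deriv_pair (\<lambda>x. X (x, t)) (\<lambda>x. Y (x, t))"
        using elim True by auto
      have "(\<integral>x. Y (x, t) * Z (x, t) \<partial>lborel) = - (\<integral>x. X (x, t) * X (x, t) \<partial>lborel)"
        by (rule H10_integration_by_parts[OF H(1) _ _ _ H(2)])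
           (use supp elim(2) H(1) in \<open>auto simp: H10_pair_def\<close>)
      then show ?thesis by (simp add: power2_eq_square)
    next
      case False
      then show ?thesis using supp by simp
    qed
  qed
  then have "(\<integral>t. (\<integral>x. \<psi> t * (Y (x, t) * Z (x, t)) \<partial>lborel) \<partial>lborel) = (\<integral>t. - (\<integral>x. \<psi> t * (X (x, t))\<^sup>2 \<partial>lborel) \<partial>lborel)"
    using Fubini_plane_snd(2)[OF i1] Fubini_plane_snd(2)[OF i2] by (intro integral_cong_AE) auto
  then show ?thesis using Fubini_plane_snd(3)[OF i1] Fubini_plane_snd(3)[OF i2] by simp
qed

text \<open>For fixed x, 2 \<psi> Z V is the time derivative of \<psi> Z^2 minus \<psi>' Z^2. Since
  \<psi> and \<psi>' are nonnegative, the value at t = 0 and the term with \<psi>' have the sign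
  that allows dropping them.\<close>

lemma weighted_time_derivative:
  "2 * (\<integral>z. \<psi> (snd z) * (Z z * V z / a (fst z)) \<partial>lborel) \<le> \<psi> T * (\<integral>x. (g x)\<^sup>2 / a x \<partial>lborel)"
proof -
  have i: "integrable lborel (\<lambda>z. \<psi> (snd z) * (Z z * V z / a (fst z)))"
    by (rule \<psi>_mult_integrable[OF product_integrable(2)]) (use supp in auto)
  have le: "AE x in lborel. 2 * (\<integral>t. \<psi> t * (Z (x, t) * V (x, t) / a x) \<partial>lborel) \<le> \<psi> T * ((g x)\<^sup>2 / a x)"
    using AE_time_slice Fubini_plane_fst(1)[OF i]
  proof eventually_elim
    case (elim x)
    have [measurable]: "(\<lambda>t. V (x, t)) \<in> borel_measurable borel" "(\<lambda>t. Z (x, t)) \<in> borel_measurable borel"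
      by (rule Pair_measurable_snd[OF V_meas] Pair_measurable_snd[OF Z_meas])+
    have [measurable]: "\<psi> \<in> borel_measurable borel" using \<psi>_cont by (rule borel_measurable_continuous_onI)
    define f where "f t = Zc t x" for t
    have P: "primitive_on UNIV (\<lambda>t. V (x, t)) f" unfolding f_def using elim by (intro primitive_Zc) auto
    have fc: "continuous_on A f" if "A = {c..d}" for A c d unfolding that
      by (rule primitive_continuous[OF primitive_on_subset[OF P subset_UNIV]])
    have P2: "primitive_on UNIV (\<lambda>t. V (x, t) * f t + f t * V (x, t)) (\<lambda>t. f t * f t)"
      by (rule primitive_mult[OF P P]) simp
    have P\<psi>: "primitive_on UNIV \<psi>' \<psi>" by (rule primitive_on_deriv[OF \<psi>_deriv \<psi>'_cont])
    have P3: "primitive_on UNIV (\<lambda>t. \<psi>' t * (f t * f t) + \<psi> t * (V (x, t) * f t + f t * V (x, t))) (\<lambda>t. \<psi> t * (f t * f t))"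
      by (rule primitive_mult[OF P\<psi> P2]) simp
    have T0: "0 \<le> T" using T by simp
    have s1: "set_integrable lborel {0..T} (\<lambda>t. \<psi>' t * (f t * f t))"
      by (intro borel_integrable_atLeastAtMost' continuous_intros fc[OF refl] continuous_on_subset[OF \<psi>'_cont]) auto
    have s3: "set_integrable lborel {0..T} (\<lambda>t. \<psi>' t * (f t * f t) + \<psi> t * (V (x, t) * f t + f t * V (x, t)))"
      by (rule primitive_onD(1)[OF P3 _ _ T0]) auto
    have s2: "set_integrable lborel {0..T} (\<lambda>t. \<psi> t * (V (x, t) * f t + f t * V (x, t)))"
      using set_integral_diff(1)[OF s3 s1] by simp
    have "(LINT t:{0..T}|lborel. \<psi>' t * (f t * f t)) + (LINT t:{0..T}|lborel. \<psi> t * (V (x, t) * f t + f t * V (x, t)))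
        = \<psi> T * (f T * f T) - \<psi> 0 * (f 0 * f 0)"
      using primitive_onD(2)[OF P3 _ _ T0] set_integral_add(2)[OF s1 s2] by simp
    moreover have "0 \<le> (LINT t:{0..T}|lborel. \<psi>' t * (f t * f t))"
      unfolding set_lebesgue_integral_def using \<psi>'_nonneg by (intro Bochner_Integration.integral_nonneg) simp
    moreover have "0 \<le> \<psi> 0 * (f 0 * f 0)" using \<psi>_nonneg by simp
    moreover have "f T = g x" unfolding f_def by (rule Zc_at_T) simp
    ultimately have b: "(LINT t:{0..T}|lborel. \<psi> t * (V (x, t) * f t + f t * V (x, t))) \<le> \<psi> T * (g x)\<^sup>2"
      by (simp add: power2_eq_square)
    have "(\<integral>t. 2 * (\<psi> t * (Z (x, t) * V (x, t))) \<partial>lborel) = (LINT t:{0..T}|lborel. \<psi> t * (V (x, t) * f t + f t * V (x, t)))"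
      unfolding set_lebesgue_integral_def real_scaleR_def
    proof (rule integral_cong_AE)
      show "AE t in lborel. 2 * (\<psi> t * (Z (x, t) * V (x, t))) = indicator {0..T} t * (\<psi> t * (V (x, t) * f t + f t * V (x, t)))"
        using elim(1)[THEN conjunct2]
      proof eventually_elim
        case (elim t)
        show ?case
        proof (cases "0 < x \<and> x < 1 \<and> 0 < t \<and> t < T")
          case True
          then show ?thesis using elim by (simp add: f_def)
        next
          case False
          then show ?thesis using supp[OF False] by simp
        qed
      qed
      show "(\<lambda>t. indicator {0..T} t * (\<psi> t * (V (x, t) * f t + f t * V (x, t)))) \<in> borel_measurable lborel"
        using s2 by (simp add: set_integrable_def)
    qed measurable
    then have "2 * (\<integral>t. \<psi> t * (Z (x, t) * V (x, t)) \<partial>lborel) \<le> \<psi> T * (g x)\<^sup>2" using b by simp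
    then have "2 * (\<integral>t. \<psi> t * (Z (x, t) * V (x, t)) \<partial>lborel) / a x \<le> \<psi> T * (g x)\<^sup>2 / a x"
      using a_pos[of x] by (intro divide_right_mono) auto
    then show ?case by simp
  qed
  note F = Fubini_plane_fst(2,3)[OF i, unfolded fst_conv snd_conv]
  have "(\<integral>x. 2 * (\<integral>t. \<psi> t * (Z (x, t) * V (x, t) / a x) \<partial>lborel) \<partial>lborel) \<le> (\<integral>x. \<psi> T * ((g x)\<^sup>2 / a x) \<partial>lborel)"
    by (rule integral_mono_AE[OF integrable_mult_right[OF F(1)] integrable_mult_right[OF g_int] le])
  then show ?thesis unfolding integral_mult_right_zero F(2) .
qed

text \<open>The three cross terms of G^2 / a are treated separately:
  \<open>energy_inequality\<close> for Y V, exact integration by parts for \<psi> Y Z, and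
  \<open>weighted_time_derivative\<close> for \<psi> Z V / a. The second one yields the gradient
  term with coefficient 2, half of which is reserved for the drift.\<close>

theorem weighted_estimate:
  assumes q: "H10_pair g q"
  defines "G \<equiv> \<lambda>z. V z + a (fst z) * Y z - \<psi> (snd z) * Z z"
  shows "integrable lborel (\<lambda>z. (\<psi> (snd z))\<^sup>2 * ((Z z)\<^sup>2 / a (fst z)))" "integrable lborel (\<lambda>z. \<psi> (snd z) * (X z)\<^sup>2)"
    "(\<integral>z. (V z)\<^sup>2 / a (fst z) \<partial>lborel) + (\<integral>z. a (fst z) * (Y z)\<^sup>2 \<partial>lborel)
      + 2 * (\<integral>z. \<psi> (snd z) * (X z)\<^sup>2 \<partial>lborel) + (\<integral>z. (\<psi> (snd z))\<^sup>2 * ((Z z)\<^sup>2 / a (fst z)) \<partial>lborel)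
    \<le> (\<integral>z. (G z)\<^sup>2 / a (fst z) \<partial>lborel) + (\<integral>x. (q x)\<^sup>2 \<partial>lborel) + \<psi> T * (\<integral>x. (g x)\<^sup>2 / a x \<partial>lborel)"
proof -
  have iZ: "integrable lborel (\<lambda>z. \<psi> (snd z) * ((Z z)\<^sup>2 / a (fst z)))"
    by (rule \<psi>_mult_integrable[OF Z_int]) (use supp in auto)
  have "integrable lborel (\<lambda>z. \<psi> (snd z) * (\<psi> (snd z) * ((Z z)\<^sup>2 / a (fst z))))"
    by (rule \<psi>_mult_integrable[OF iZ]) (use supp in auto)
  then show i2: "integrable lborel (\<lambda>z. (\<psi> (snd z))\<^sup>2 * ((Z z)\<^sup>2 / a (fst z)))" by (simp add: power2_eq_square mult.assoc)
  show i3: "integrable lborel (\<lambda>z. \<psi> (snd z) * (X z)\<^sup>2)"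
    by (rule \<psi>_mult_integrable[OF X_int]) (use supp in auto)
  have i4: "integrable lborel (\<lambda>z. \<psi> (snd z) * (Y z * Z z))"
    by (rule \<psi>_mult_integrable[OF product_integrable(1)]) (use supp in auto)
  have i5: "integrable lborel (\<lambda>z. \<psi> (snd z) * (Z z * V z / a (fst z)))"
    by (rule \<psi>_mult_integrable[OF product_integrable(2)]) (use supp in auto)
  have e: "(G z)\<^sup>2 / a (fst z) = (V z)\<^sup>2 / a (fst z) + a (fst z) * (Y z)\<^sup>2 + (\<psi> (snd z))\<^sup>2 * ((Z z)\<^sup>2 / a (fst z))
      + 2 * (Y z * V z) - 2 * (\<psi> (snd z) * (Y z * Z z)) - 2 * (\<psi> (snd z) * (Z z * V z / a (fst z)))" for z
    unfolding G_def using a_pos[of "fst z"] by (simp add: field_simps power2_eq_square)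
  have "(\<integral>z. (G z)\<^sup>2 / a (fst z) \<partial>lborel) = (\<integral>z. (V z)\<^sup>2 / a (fst z) \<partial>lborel) + (\<integral>z. a (fst z) * (Y z)\<^sup>2 \<partial>lborel)
      + (\<integral>z. (\<psi> (snd z))\<^sup>2 * ((Z z)\<^sup>2 / a (fst z)) \<partial>lborel) + 2 * (\<integral>z. Y z * V z \<partial>lborel)
      - 2 * (\<integral>z. \<psi> (snd z) * (Y z * Z z) \<partial>lborel) - 2 * (\<integral>z. \<psi> (snd z) * (Z z * V z / a (fst z)) \<partial>lborel)"
    unfolding e by (rule integral_six[OF V_int Y_int i2 product_integrable(3) i4 i5])
  then show "(\<integral>z. (V z)\<^sup>2 / a (fst z) \<partial>lborel) + (\<integral>z. a (fst z) * (Y z)\<^sup>2 \<partial>lborel)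
      + 2 * (\<integral>z. \<psi> (snd z) * (X z)\<^sup>2 \<partial>lborel) + (\<integral>z. (\<psi> (snd z))\<^sup>2 * ((Z z)\<^sup>2 / a (fst z)) \<partial>lborel)
    \<le> (\<integral>z. (G z)\<^sup>2 / a (fst z) \<partial>lborel) + (\<integral>x. (q x)\<^sup>2 \<partial>lborel) + \<psi> T * (\<integral>x. (g x)\<^sup>2 / a x \<partial>lborel)"
    using energy_inequality[OF q] weighted_time_derivative weighted_parts by linarith
qed

end

end

section \<open>Conjugation with the Carleman weight\<close>

context evolution_setting
begin

text \<open>Multiplication by a function of time changes the time derivative to \<rho> V + \<rho>' Z
  and the final value to \<rho>(T) g, while the x-derivatives are only multiplied. The essential
  point is the integrated time equation, which is the product rule for \<rho> and
  \<open>Zc\<close>.\<close>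

lemma conjugated_setting:
  assumes \<rho>_deriv: "\<And>t. (\<rho> has_real_derivative \<rho>' t) (at t)" and \<rho>'_cont: "continuous_on UNIV \<rho>'"
  shows "evolution_setting a T (\<lambda>z. \<rho> (snd z) * Z z) (\<lambda>z. \<rho> (snd z) * X z) (\<lambda>z. \<rho> (snd z) * Y z)
    (\<lambda>z. \<rho> (snd z) * V z + \<rho>' (snd z) * Z z) (\<lambda>x. \<rho> T * g x)"
proof
  have \<rho>_cont: "continuous_on UNIV \<rho>"
    using \<rho>_deriv by (meson DERIV_isCont continuous_at_imp_continuous_on)
  have [measurable]: "(\<lambda>z :: real \<times> real. \<rho> (snd z)) \<in> borel_measurable borel"
    "(\<lambda>z :: real \<times> real. \<rho>' (snd z)) \<in> borel_measurable borel"
    by (intro snd_measurable borel_measurable_continuous_onI \<rho>_cont \<rho>'_cont)+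
  have c2: "continuous_on UNIV (\<lambda>t. (\<rho> t)\<^sup>2)" "continuous_on UNIV (\<lambda>t. (\<rho>' t)\<^sup>2)"
    by (intro continuous_intros \<rho>_cont \<rho>'_cont)+
  show "0 < T" "a \<in> borel_measurable borel" "\<And>x. 0 < a x" by (rule T a_meas a_pos)+
  show "(\<lambda>z. \<rho> (snd z) * Z z) \<in> borel_measurable borel" "(\<lambda>z. \<rho> (snd z) * X z) \<in> borel_measurable borel"
    "(\<lambda>z. \<rho> (snd z) * Y z) \<in> borel_measurable borel"
    "(\<lambda>z. \<rho> (snd z) * V z + \<rho>' (snd z) * Z z) \<in> borel_measurable borel" "(\<lambda>x. \<rho> T * g x) \<in> borel_measurable borel"
    by measurable
  show "\<rho> (snd (x, t)) * Z (x, t) = 0 \<and> \<rho> (snd (x, t)) * X (x, t) = 0 \<and> \<rho> (snd (x, t)) * Y (x, t) = 0 \<and>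
      \<rho> (snd (x, t)) * V (x, t) + \<rho>' (snd (x, t)) * Z (x, t) = 0"
    if "\<not> (0 < x \<and> x < 1 \<and> 0 < t \<and> t < T)" for x t
    using supp[OF that] by simp
  show "\<rho> T * g x = 0" if "\<not> (0 < x \<and> x < 1)" for x using g_supp[OF that] by simp
  have iZ: "integrable lborel (\<lambda>z. (\<rho> (snd z))\<^sup>2 * ((Z z)\<^sup>2 / a (fst z)))"
    and iZ': "integrable lborel (\<lambda>z. (\<rho>' (snd z))\<^sup>2 * ((Z z)\<^sup>2 / a (fst z)))"
    and iV: "integrable lborel (\<lambda>z. (\<rho> (snd z))\<^sup>2 * ((V z)\<^sup>2 / a (fst z)))"
    and iX: "integrable lborel (\<lambda>z. (\<rho> (snd z))\<^sup>2 * (X z)\<^sup>2)"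
    and iY: "integrable lborel (\<lambda>z. (\<rho> (snd z))\<^sup>2 * (a (fst z) * (Y z)\<^sup>2))"
    by (rule continuous_mult_integrable[OF c2(1)] continuous_mult_integrable[OF c2(2)];
        use Z_int V_int X_int Y_int supp in simp)+
  show "integrable lborel (\<lambda>z. (\<rho> (snd z) * Z z)\<^sup>2 / a (fst z))" using iZ by (simp add: power_mult_distrib)
  show "integrable lborel (\<lambda>z. (\<rho> (snd z) * X z)\<^sup>2)" using iX by (simp add: power_mult_distrib)
  show "integrable lborel (\<lambda>z. a (fst z) * (\<rho> (snd z) * Y z)\<^sup>2)" using iY by (simp add: power_mult_distrib ac_simps)
  have a_fst[measurable]: "(\<lambda>z :: real \<times> real. a (fst z)) \<in> borel_measurable borel" by (rule fst_measurable[OF a_meas])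
  show "integrable lborel (\<lambda>z. (\<rho> (snd z) * V z + \<rho>' (snd z) * Z z)\<^sup>2 / a (fst z))"
  proof (rule Bochner_Integration.integrable_bound)
    show "integrable lborel (\<lambda>z. 2 * ((\<rho> (snd z))\<^sup>2 * ((V z)\<^sup>2 / a (fst z))) + 2 * ((\<rho>' (snd z))\<^sup>2 * ((Z z)\<^sup>2 / a (fst z))))"
      by (intro Bochner_Integration.integrable_add integrable_mult_right iV iZ')
    show "AE z in lborel. norm ((\<rho> (snd z) * V z + \<rho>' (snd z) * Z z)\<^sup>2 / a (fst z)) \<le>
        norm (2 * ((\<rho> (snd z))\<^sup>2 * ((V z)\<^sup>2 / a (fst z))) + 2 * ((\<rho>' (snd z))\<^sup>2 * ((Z z)\<^sup>2 / a (fst z))))"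
    proof (rule AE_I2)
      fix z :: "real \<times> real"
      have "(\<rho> (snd z) * V z + \<rho>' (snd z) * Z z)\<^sup>2 / a (fst z)
          \<le> (2 * (\<rho> (snd z) * V z)\<^sup>2 + 2 * (\<rho>' (snd z) * Z z)\<^sup>2) / a (fst z)"
        using a_pos[of "fst z"] by (intro divide_right_mono sq_sum_le) auto
      also have "\<dots> = 2 * ((\<rho> (snd z))\<^sup>2 * ((V z)\<^sup>2 / a (fst z))) + 2 * ((\<rho>' (snd z))\<^sup>2 * ((Z z)\<^sup>2 / a (fst z)))"
        by (simp add: power_mult_distrib add_divide_distrib)
      finally show "norm ((\<rho> (snd z) * V z + \<rho>' (snd z) * Z z)\<^sup>2 / a (fst z)) \<le>
        norm (2 * ((\<rho> (snd z))\<^sup>2 * ((V z)\<^sup>2 / a (fst z))) + 2 * ((\<rho>' (snd z))\<^sup>2 * ((Z z)\<^sup>2 / a (fst z))))"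
        using a_pos[of "fst z"] by simp
    qed
  qed measurable
  show "AE t in lborel. 0 < t \<and> t < T \<longrightarrow>
      H10_pair (\<lambda>x. \<rho> (snd (x, t)) * Z (x, t)) (\<lambda>x. \<rho> (snd (x, t)) * X (x, t)) \<and>
      weak_deriv_pair (\<lambda>x. \<rho> (snd (x, t)) * X (x, t)) (\<lambda>x. \<rho> (snd (x, t)) * Y (x, t))"
    using space by eventually_elim (simp add: H10_pair_cmult weak_deriv_pair_cmult)
  show "AE z in lborel. fst z \<in> {0<..<1} \<and> snd z \<in> {0<..<T} \<longrightarrow>
      \<rho> (snd z) * Z z = \<rho> T * g (fst z) - (\<integral>\<tau>. indicator {snd z..} \<tau> *
        (\<rho> (snd (fst z, \<tau>)) * V (fst z, \<tau>) + \<rho>' (snd (fst z, \<tau>)) * Z (fst z, \<tau>)) \<partial>lborel)"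
    using AE_fst[OF AE_time_slice] time
  proof eventually_elim
    case (elim z)
    show ?case
    proof
      assume z: "fst z \<in> {0<..<1} \<and> snd z \<in> {0<..<T}"
      define x where "x = fst z"
      define t where "t = snd z"
      have xt: "0 < x" "x < 1" "0 < t" "t < T" using z by (auto simp: x_def t_def)
      have Vi: "integrable lborel (\<lambda>t. V (x, t))" and ZZ: "AE t in lborel. 0 < x \<and> x < 1 \<and> 0 < t \<and> t < T \<longrightarrow> Z (x, t) = Zc t x"
        using elim(1) by (auto simp: x_def)
      have Zz: "Z z = Zc t x" using elim(2) z by (simp add: Zc_def x_def t_def)
      have P: "primitive_on UNIV (\<lambda>t. \<rho>' t * Zc t x + \<rho> t * V (x, t)) (\<lambda>t. \<rho> t * Zc t x)"
        by (rule primitive_mult[OF primitive_on_deriv[OF \<rho>_deriv \<rho>'_cont] primitive_Zc[OF Vi]]) simp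
      have tT: "t \<le> T" using xt by simp
      have [measurable]: "(\<lambda>t. V (x, t)) \<in> borel_measurable borel" "(\<lambda>t. Z (x, t)) \<in> borel_measurable borel"
        by (rule Pair_measurable_snd[OF V_meas] Pair_measurable_snd[OF Z_meas])+
      have [measurable]: "\<rho> \<in> borel_measurable borel" "\<rho>' \<in> borel_measurable borel"
        by (intro borel_measurable_continuous_onI \<rho>_cont \<rho>'_cont)+
      \<comment> \<open>Under the integral \<open>Z\<close> is exchanged for the absolutely
        continuous \<open>Zc\<close>, after cutting the half-line at T, beyond which
        \<open>V\<close> and \<open>Z\<close> vanish.\<close>
      have "(\<integral>\<tau>. indicator {t..} \<tau> * (\<rho> \<tau> * V (x, \<tau>) + \<rho>' \<tau> * Z (x, \<tau>)) \<partial>lborel)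
          = (\<integral>\<tau>. indicator {t..T} \<tau> * (\<rho>' \<tau> * Zc \<tau> x + \<rho> \<tau> * V (x, \<tau>)) \<partial>lborel)"
      proof (rule integral_cong_AE)
        show "AE \<tau> in lborel. indicator {t..} \<tau> * (\<rho> \<tau> * V (x, \<tau>) + \<rho>' \<tau> * Z (x, \<tau>))
            = indicator {t..T} \<tau> * (\<rho>' \<tau> * Zc \<tau> x + \<rho> \<tau> * V (x, \<tau>))"
          using ZZ AE_lborel_singleton[of T]
        proof eventually_elim
          case (elim \<tau>)
          consider "\<tau> < t" | "t \<le> \<tau>" "\<tau> < T" | "T < \<tau>" using elim(2) by linarith
          then show ?case
          proof cases
            case 2
            then show ?thesis using elim(1) xt by (simp add: algebra_simps)
          next
            case 3
            then show ?thesis using supp[of x \<tau>] by simp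
          qed (use xt in simp)
        qed
        show "(\<lambda>\<tau>. indicator {t..T} \<tau> * (\<rho>' \<tau> * Zc \<tau> x + \<rho> \<tau> * V (x, \<tau>))) \<in> borel_measurable lborel"
          using primitive_onD(1)[OF P _ _ tT] by (simp add: set_integrable_def)
      qed measurable
      also have "\<dots> = \<rho> T * Zc T x - \<rho> t * Zc t x"
        using primitive_onD(2)[OF P _ _ tT] by (simp add: set_lebesgue_integral_def)
      also have "Zc T x = g x" by (rule Zc_at_T) simp
      finally have "\<rho> t * Zc t x = \<rho> T * g x - (\<integral>\<tau>. indicator {t..} \<tau> * (\<rho> \<tau> * V (x, \<tau>) + \<rho>' \<tau> * Z (x, \<tau>)) \<partial>lborel)"
        by simp
      then show "\<rho> (snd z) * Z z = \<rho> T * g (fst z) - (\<integral>\<tau>. indicator {snd z..} \<tau> *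
          (\<rho> (snd (fst z, \<tau>)) * V (fst z, \<tau>) + \<rho>' (snd (fst z, \<tau>)) * Z (fst z, \<tau>)) \<partial>lborel)"
        using Zz by (simp add: x_def t_def)
    qed
  qed
qed

text \<open>The drift enters only as a deviation of \<open>F\<close> from V + a Y by at most K
  sqrt(a) |X|; its square divided by a is at most K^2 X^2, free of the degenerate weight. Since 2
  K^2 \<le> s \<lambda> \<le> \<psi> for t > 0, one of the two copies of \<psi> X^2 absorbs it. The
  constant 6 is the factor 2 from splitting off the deviation times the factor 3 from undoing the
  conjugation.\<close>

theorem carleman_estimate:
  fixes F :: "real \<times> real \<Rightarrow> real" and K s lam :: real
  assumes q: "H10_pair g q" and F[measurable]: "F \<in> borel_measurable borel"
    and F_supp: "\<And>x t. \<not> (0 < x \<and> x < 1 \<and> 0 < t \<and> t < T) \<Longrightarrow> F (x, t) = 0"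
    and eq: "AE z in lborel. \<bar>F z - (V z + a (fst z) * Y z)\<bar> \<le> K * sqrt (a (fst z)) * \<bar>X z\<bar>"
    and s: "s > 0" and lam: "lam > 0" and sK: "2 * K\<^sup>2 \<le> s * lam"
  defines "\<phi> \<equiv> \<lambda>t. exp (lam * t)"
  defines "L \<equiv> \<lambda>z. ((V z)\<^sup>2 / a (fst z) + a (fst z) * (Y z)\<^sup>2 + s * lam * \<phi> (snd z) * (X z)\<^sup>2
      + s\<^sup>2 * lam\<^sup>2 * (\<phi> (snd z))\<^sup>2 / a (fst z) * (Z z)\<^sup>2) * exp (2 * s * \<phi> (snd z))"
  shows "integrable lborel L" "integrable lborel (\<lambda>z. exp (2 * s * \<phi> (snd z)) * ((F z)\<^sup>2 / a (fst z)))"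
    "(\<integral>z. L z \<partial>lborel) \<le> 6 * (\<integral>z. exp (2 * s * \<phi> (snd z)) * ((F z)\<^sup>2 / a (fst z)) \<partial>lborel)
      + 3 * (exp (2 * s * \<phi> T) * ((\<integral>x. (q x)\<^sup>2 \<partial>lborel) + s * lam * \<phi> T * (\<integral>x. (g x)\<^sup>2 / a x \<partial>lborel)))"
proof -
  define \<psi> where "\<psi> t = s * lam * \<phi> t" for t
  define \<psi>' where "\<psi>' t = s * lam * (lam * \<phi> t)" for t
  define \<rho> where "\<rho> t = exp (s * \<phi> t)" for t
  \<comment> \<open>\<psi> = s \<phi>' is the logarithmic derivative of \<rho> = exp (s \<phi>);
    therefore conjugation changes the operator by -\<psi> times the unknown, as the identity
    \<open>G\<close> records.\<close>
  define \<rho>' where "\<rho>' t = \<psi> t * \<rho> t" for t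
  have \<phi>d: "(\<phi> has_real_derivative lam * \<phi> t) (at t)" for t
    unfolding \<phi>_def by (auto intro!: derivative_eq_intros)
  have \<phi>c: "continuous_on A \<phi>" for A unfolding \<phi>_def by (intro continuous_intros)
  have \<psi>d: "(\<psi> has_real_derivative \<psi>' t) (at t)" for t
    unfolding \<psi>_def \<psi>'_def by (rule DERIV_cmult[OF \<phi>d])
  have \<rho>d: "(\<rho> has_real_derivative \<rho>' t) (at t)" for t
    using DERIV_chain2[OF DERIV_exp DERIV_cmult[OF \<phi>d, of s]] unfolding \<rho>_def \<rho>'_def \<psi>_def by (simp add: ac_simps)
  have \<phi>0: "\<phi> t > 0" for t by (simp add: \<phi>_def)
  have \<psi>0: "\<psi> t \<ge> 0" "\<psi>' t \<ge> 0" for t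
    using \<phi>0[of t] s lam by (auto simp: \<psi>_def \<psi>'_def)
  have \<psi>'c: "continuous_on UNIV \<psi>'" unfolding \<psi>'_def by (intro continuous_intros \<phi>c)
  have \<rho>c: "continuous_on UNIV \<rho>" unfolding \<rho>_def by (intro continuous_intros \<phi>c)
  have \<rho>'c: "continuous_on UNIV \<rho>'" unfolding \<rho>'_def \<psi>_def by (intro continuous_intros \<phi>c \<rho>c)
  have \<rho>2: "exp (2 * s * \<phi> t) = (\<rho> t)\<^sup>2" for t
    unfolding \<rho>_def by (simp flip: exp_double)
  have [measurable]: "(\<lambda>z :: real \<times> real. a (fst z)) \<in> borel_measurable borel" by (rule fst_measurable[OF a_meas])
  interpret C: evolution_setting a T "\<lambda>z. \<rho> (snd z) * Z z" "\<lambda>z. \<rho> (snd z) * X z" "\<lambda>z. \<rho> (snd z) * Y z"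
    "\<lambda>z. \<rho> (snd z) * V z + \<rho>' (snd z) * Z z" "\<lambda>x. \<rho> T * g x"
    by (rule conjugated_setting[OF \<rho>d \<rho>'c])
  let ?Z = "\<lambda>z. \<rho> (snd z) * Z z" and ?X = "\<lambda>z. \<rho> (snd z) * X z" and ?Y = "\<lambda>z. \<rho> (snd z) * Y z"
    and ?V = "\<lambda>z. \<rho> (snd z) * V z + \<rho>' (snd z) * Z z"
  note W = C.weighted_estimate[OF \<psi>d \<psi>'c \<psi>0(2) \<psi>0(1) H10_pair_cmult[OF q, of "\<rho> T"]]
  have G: "?V z + a (fst z) * ?Y z - \<psi> (snd z) * ?Z z = \<rho> (snd z) * (V z + a (fst z) * Y z)" for z
    by (simp add: \<rho>'_def algebra_simps)
  have Ki: "integrable lborel (\<lambda>z. 4 * ((V z)\<^sup>2 / a (fst z)) + 4 * (a (fst z) * (Y z)\<^sup>2) + 2 * K\<^sup>2 * (X z)\<^sup>2)"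
    by (intro Bochner_Integration.integrable_add integrable_mult_right V_int Y_int X_int)
  have dev: "(F z - (V z + a (fst z) * Y z))\<^sup>2 / a (fst z) \<le> K\<^sup>2 * (X z)\<^sup>2"
    if "\<bar>F z - (V z + a (fst z) * Y z)\<bar> \<le> K * sqrt (a (fst z)) * \<bar>X z\<bar>" for z
  proof -
    have "(F z - (V z + a (fst z) * Y z))\<^sup>2 \<le> (K * sqrt (a (fst z)) * \<bar>X z\<bar>)\<^sup>2"
      using that by (metis abs_ge_zero power2_abs power_mono)
    also have "\<dots> = K\<^sup>2 * (X z)\<^sup>2 * a (fst z)"
      using a_pos[of "fst z"] by (simp add: power_mult_distrib)
    finally show ?thesis using a_pos[of "fst z"] by (simp add: pos_divide_le_eq)
  qed
  have F2: "integrable lborel (\<lambda>z. (F z)\<^sup>2 / a (fst z))"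
  proof (rule Bochner_Integration.integrable_bound[OF Ki])
    show "AE z in lborel. norm ((F z)\<^sup>2 / a (fst z)) \<le>
        norm (4 * ((V z)\<^sup>2 / a (fst z)) + 4 * (a (fst z) * (Y z)\<^sup>2) + 2 * K\<^sup>2 * (X z)\<^sup>2)"
      using eq
    proof eventually_elim
      case (elim z)
      have p: "a (fst z) > 0" by (rule a_pos)
      have "(F z)\<^sup>2 \<le> 2 * (V z + a (fst z) * Y z)\<^sup>2 + 2 * (F z - (V z + a (fst z) * Y z))\<^sup>2"
        using sq_sum_le[of "V z + a (fst z) * Y z" "F z - (V z + a (fst z) * Y z)"] by simp
      also have "(V z + a (fst z) * Y z)\<^sup>2 \<le> 2 * (V z)\<^sup>2 + 2 * (a (fst z) * Y z)\<^sup>2" by (rule sq_sum_le)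
      finally have "(F z)\<^sup>2 / a (fst z) \<le> (4 * (V z)\<^sup>2 + 4 * (a (fst z) * Y z)\<^sup>2 + 2 * (F z - (V z + a (fst z) * Y z))\<^sup>2) / a (fst z)"
        using p by (intro divide_right_mono) auto
      also have "\<dots> = 4 * ((V z)\<^sup>2 / a (fst z)) + 4 * (a (fst z) * (Y z)\<^sup>2) + 2 * ((F z - (V z + a (fst z) * Y z))\<^sup>2 / a (fst z))"
        using p by (simp add: field_simps power2_eq_square)
      also have "\<dots> \<le> 4 * ((V z)\<^sup>2 / a (fst z)) + 4 * (a (fst z) * (Y z)\<^sup>2) + 2 * K\<^sup>2 * (X z)\<^sup>2"
        using dev[OF elim] by simp
      finally show ?case using p by simp
    qed
  qed measurable
  show iF: "integrable lborel (\<lambda>z. exp (2 * s * \<phi> (snd z)) * ((F z)\<^sup>2 / a (fst z)))"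
    by (rule continuous_mult_integrable[OF _ F2]) (use F_supp in \<open>auto intro!: continuous_intros \<phi>c\<close>)
  have Gle: "(\<integral>z. (\<rho> (snd z) * (V z + a (fst z) * Y z))\<^sup>2 / a (fst z) \<partial>lborel)
      \<le> 2 * (\<integral>z. exp (2 * s * \<phi> (snd z)) * ((F z)\<^sup>2 / a (fst z)) \<partial>lborel) + (\<integral>z. \<psi> (snd z) * (?X z)\<^sup>2 \<partial>lborel)"
  proof -
    have i: "integrable lborel (\<lambda>z. 2 * (exp (2 * s * \<phi> (snd z)) * ((F z)\<^sup>2 / a (fst z))) + \<psi> (snd z) * (?X z)\<^sup>2)"
      by (intro Bochner_Integration.integrable_add integrable_mult_right iF W)
    have le: "AE z in lborel. (\<rho> (snd z) * (V z + a (fst z) * Y z))\<^sup>2 / a (fst z)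
        \<le> 2 * (exp (2 * s * \<phi> (snd z)) * ((F z)\<^sup>2 / a (fst z))) + \<psi> (snd z) * (?X z)\<^sup>2"
      using eq
    proof eventually_elim
      case (elim z)
      have p: "a (fst z) > 0" by (rule a_pos)
      have KX: "2 * (K\<^sup>2 * (X z)\<^sup>2) \<le> \<psi> (snd z) * (X z)\<^sup>2"
      \<comment> \<open>The bound 1 \<le> \<phi> is available for t > 0; for the other times
        \<open>X\<close> is 0.\<close>
      proof (cases "0 < snd z")
        case True
        have "1 \<le> \<phi> (snd z)" using True lam by (simp add: \<phi>_def)
        then have "s * lam * 1 \<le> \<psi> (snd z)" unfolding \<psi>_def using s lam by (intro mult_left_mono) auto
        then have "2 * K\<^sup>2 \<le> \<psi> (snd z)" using sK by simp
        then show ?thesis using mult_right_mono[of "2 * K\<^sup>2" "\<psi> (snd z)" "(X z)\<^sup>2"] by simp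
      next
        case False
        then show ?thesis using supp[of "fst z" "snd z"] by simp
      qed
      have "(V z + a (fst z) * Y z)\<^sup>2 \<le> 2 * (F z)\<^sup>2 + 2 * (F z - (V z + a (fst z) * Y z))\<^sup>2"
        using sq_sum_le[of "F z" "(V z + a (fst z) * Y z) - F z"] by (simp add: power2_commute)
      then have "(V z + a (fst z) * Y z)\<^sup>2 / a (fst z) \<le> (2 * (F z)\<^sup>2 + 2 * (F z - (V z + a (fst z) * Y z))\<^sup>2) / a (fst z)"
        using p by (intro divide_right_mono) auto
      also have "\<dots> = 2 * ((F z)\<^sup>2 / a (fst z)) + 2 * ((F z - (V z + a (fst z) * Y z))\<^sup>2 / a (fst z))"
        by (simp add: add_divide_distrib)
      also have "\<dots> \<le> 2 * ((F z)\<^sup>2 / a (fst z)) + \<psi> (snd z) * (X z)\<^sup>2"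
        using dev[OF elim] KX by simp
      finally have "(\<rho> (snd z))\<^sup>2 * ((V z + a (fst z) * Y z)\<^sup>2 / a (fst z))
          \<le> (\<rho> (snd z))\<^sup>2 * (2 * ((F z)\<^sup>2 / a (fst z)) + \<psi> (snd z) * (X z)\<^sup>2)"
        by (rule mult_left_mono) simp
      moreover have "(\<rho> (snd z) * (V z + a (fst z) * Y z))\<^sup>2 / a (fst z) = (\<rho> (snd z))\<^sup>2 * ((V z + a (fst z) * Y z)\<^sup>2 / a (fst z))"
        by (simp only: power_mult_distrib times_divide_eq_right)
      moreover have "(\<rho> (snd z))\<^sup>2 * (2 * ((F z)\<^sup>2 / a (fst z)) + \<psi> (snd z) * (X z)\<^sup>2)
          = 2 * ((\<rho> (snd z))\<^sup>2 * ((F z)\<^sup>2 / a (fst z))) + \<psi> (snd z) * (?X z)\<^sup>2"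
        by (simp add: power_mult_distrib algebra_simps)
      ultimately show ?case unfolding \<rho>2 by (simp only:)
    qed
    have i': "integrable lborel (\<lambda>z. (\<rho> (snd z) * (V z + a (fst z) * Y z))\<^sup>2 / a (fst z))"
    proof (rule Bochner_Integration.integrable_bound[OF i])
      show "AE z in lborel. norm ((\<rho> (snd z) * (V z + a (fst z) * Y z))\<^sup>2 / a (fst z)) \<le>
          norm (2 * (exp (2 * s * \<phi> (snd z)) * ((F z)\<^sup>2 / a (fst z))) + \<psi> (snd z) * (?X z)\<^sup>2)"
        using le
      proof eventually_elim
        case (elim z)
        have "0 \<le> (\<rho> (snd z) * (V z + a (fst z) * Y z))\<^sup>2 / a (fst z)" using a_pos[of "fst z"] by simp
        then show ?case using elim unfolding real_norm_def by linarith
      qed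
      have [measurable]: "(\<lambda>z :: real \<times> real. \<rho> (snd z)) \<in> borel_measurable borel"
        by (intro snd_measurable borel_measurable_continuous_onI \<rho>c)
      show "(\<lambda>z. (\<rho> (snd z) * (V z + a (fst z) * Y z))\<^sup>2 / a (fst z)) \<in> borel_measurable lborel" by measurable
    qed
    have "(\<integral>z. (\<rho> (snd z) * (V z + a (fst z) * Y z))\<^sup>2 / a (fst z) \<partial>lborel)
        \<le> (\<integral>z. 2 * (exp (2 * s * \<phi> (snd z)) * ((F z)\<^sup>2 / a (fst z))) + \<psi> (snd z) * (?X z)\<^sup>2 \<partial>lborel)"
      by (rule integral_mono_AE[OF i' i le])
    also have "\<dots> = (\<integral>z. 2 * (exp (2 * s * \<phi> (snd z)) * ((F z)\<^sup>2 / a (fst z))) \<partial>lborel) + (\<integral>z. \<psi> (snd z) * (?X z)\<^sup>2 \<partial>lborel)"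
      by (intro Bochner_Integration.integral_add integrable_mult_right iF W)
    finally show ?thesis by (simp only: integral_mult_right_zero)
  qed
  \<comment> \<open>Only one copy of the gradient term is retained here; the other one is spent on
    the bound \<open>Gle\<close>.\<close>
  define R where "R z = (?V z)\<^sup>2 / a (fst z) + a (fst z) * (?Y z)\<^sup>2 + \<psi> (snd z) * (?X z)\<^sup>2 + (\<psi> (snd z))\<^sup>2 * ((?Z z)\<^sup>2 / a (fst z))" for z
  have Ri: "integrable lborel R"
    unfolding R_def by (intro Bochner_Integration.integrable_add C.V_int C.Y_int W)
  have RI: "(\<integral>z. R z \<partial>lborel) = (\<integral>z. (?V z)\<^sup>2 / a (fst z) \<partial>lborel) + (\<integral>z. a (fst z) * (?Y z)\<^sup>2 \<partial>lborel)
      + (\<integral>z. \<psi> (snd z) * (?X z)\<^sup>2 \<partial>lborel) + (\<integral>z. (\<psi> (snd z))\<^sup>2 * ((?Z z)\<^sup>2 / a (fst z)) \<partial>lborel)"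
  proof -
    have "(\<integral>x. f\<^sub>1 x + f\<^sub>2 x + f\<^sub>3 x + f\<^sub>4 x \<partial>M) = (\<integral>x. f\<^sub>1 x \<partial>M) + (\<integral>x. f\<^sub>2 x \<partial>M) + (\<integral>x. f\<^sub>3 x \<partial>M) + (\<integral>x. f\<^sub>4 x \<partial>M)"
      if "integrable M f\<^sub>1" "integrable M f\<^sub>2" "integrable M f\<^sub>3" "integrable M f\<^sub>4"
      for M :: "(real \<times> real) measure" and f\<^sub>1 f\<^sub>2 f\<^sub>3 f\<^sub>4 :: "real \<times> real \<Rightarrow> real"
      using that by simp
    from this[OF C.V_int C.Y_int W(2) W(1)] show ?thesis unfolding R_def .
  qed
  \<comment> \<open>Undoing the conjugation: \<rho> V = ?V - \<psi> ?Z costs twice the squares of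
    both summands. Together with the square of \<psi> ?Z that is already present this needs at most
    3 R.\<close>
  have LR: "0 \<le> L z \<and> L z \<le> 3 * R z" for z
  proof -
    have p: "a (fst z) > 0" by (rule a_pos)
    have "(\<rho> (snd z) * V z)\<^sup>2 \<le> 2 * (?V z)\<^sup>2 + 2 * (- (\<psi> (snd z) * ?Z z))\<^sup>2"
      using sq_sum_le[of "?V z" "- (\<psi> (snd z) * ?Z z)"] by (simp add: \<rho>'_def algebra_simps)
    then have "(\<rho> (snd z) * V z)\<^sup>2 / a (fst z) \<le> (2 * (?V z)\<^sup>2 + 2 * (- (\<psi> (snd z) * ?Z z))\<^sup>2) / a (fst z)"
      using p by (intro divide_right_mono) auto
    also have "\<dots> = 2 * ((?V z)\<^sup>2 / a (fst z)) + 2 * ((\<psi> (snd z))\<^sup>2 * ((?Z z)\<^sup>2 / a (fst z)))"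
      by (simp add: add_divide_distrib power_mult_distrib)
    finally have 1: "(\<rho> (snd z) * V z)\<^sup>2 / a (fst z) \<le> 2 * ((?V z)\<^sup>2 / a (fst z)) + 2 * ((\<psi> (snd z))\<^sup>2 * ((?Z z)\<^sup>2 / a (fst z)))" .
    have L: "L z = (\<rho> (snd z) * V z)\<^sup>2 / a (fst z) + a (fst z) * (?Y z)\<^sup>2 + \<psi> (snd z) * (?X z)\<^sup>2 + (\<psi> (snd z))\<^sup>2 * ((?Z z)\<^sup>2 / a (fst z))"
      unfolding L_def \<rho>2 \<psi>_def by (simp add: power_mult_distrib algebra_simps)
    have n: "0 \<le> (\<rho> (snd z) * V z)\<^sup>2 / a (fst z)" "0 \<le> (?V z)\<^sup>2 / a (fst z)" "0 \<le> a (fst z) * (?Y z)\<^sup>2" "0 \<le> \<psi> (snd z) * (?X z)\<^sup>2"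
      "0 \<le> (\<psi> (snd z))\<^sup>2 * ((?Z z)\<^sup>2 / a (fst z))"
      using p \<psi>0 by auto
    have "0 \<le> x + y + w + u \<and> x + y + w + u \<le> 3 * (x' + y + w + u)"
      if "x \<le> 2 * x' + 2 * u" "0 \<le> x" "0 \<le> x'" "0 \<le> y" "0 \<le> w" "0 \<le> u" for x x' y w u :: real
      using that by simp
    from this[OF 1 n] show ?thesis unfolding L R_def .
  qed
  have \<phi>m[measurable]: "(\<lambda>z :: real \<times> real. \<phi> (snd z)) \<in> borel_measurable borel"
    by (intro snd_measurable borel_measurable_continuous_onI \<phi>c)
  show Li: "integrable lborel L"
  proof (rule Bochner_Integration.integrable_bound)
    show "integrable lborel (\<lambda>z. 3 * R z)" using Ri by simp
    show "AE z in lborel. norm (L z) \<le> norm (3 * R z)"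
    proof (rule AE_I2)
      fix z show "norm (L z) \<le> norm (3 * R z)"
        using LR[of z] unfolding real_norm_def by linarith
    qed
    show "L \<in> borel_measurable lborel" unfolding L_def by measurable
  qed
  have q2: "(\<integral>x. (\<rho> T * q x)\<^sup>2 \<partial>lborel) = (\<rho> T)\<^sup>2 * (\<integral>x. (q x)\<^sup>2 \<partial>lborel)"
    by (simp add: power_mult_distrib)
  have g2: "(\<integral>x. (\<rho> T * g x)\<^sup>2 / a x \<partial>lborel) = (\<rho> T)\<^sup>2 * (\<integral>x. (g x)\<^sup>2 / a x \<partial>lborel)"
    unfolding power_mult_distrib times_divide_eq_right[symmetric] integral_mult_right_zero ..
  have "(\<integral>z. L z \<partial>lborel) \<le> (\<integral>z. 3 * R z \<partial>lborel)"
    using LR Ri by (intro integral_mono Li) auto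
  also have "\<dots> = 3 * (\<integral>z. R z \<partial>lborel)" by simp
  also have "(\<integral>z. R z \<partial>lborel) \<le> 2 * (\<integral>z. exp (2 * s * \<phi> (snd z)) * ((F z)\<^sup>2 / a (fst z)) \<partial>lborel)
      + (\<rho> T)\<^sup>2 * ((\<integral>x. (q x)\<^sup>2 \<partial>lborel) + \<psi> T * (\<integral>x. (g x)\<^sup>2 / a x \<partial>lborel))"
    using W(3) Gle unfolding G q2 g2 RI by (simp add: algebra_simps)
  finally show "(\<integral>z. L z \<partial>lborel) \<le> 6 * (\<integral>z. exp (2 * s * \<phi> (snd z)) * ((F z)\<^sup>2 / a (fst z)) \<partial>lborel)
      + 3 * (exp (2 * s * \<phi> T) * ((\<integral>x. (q x)\<^sup>2 \<partial>lborel) + s * lam * \<phi> T * (\<integral>x. (g x)\<^sup>2 / a x \<partial>lborel)))"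
    unfolding \<rho>2 \<psi>_def by simp
qed

end

section \<open>Weak derivatives and Borel representatives\<close>

lemma AE_lebesgue_on:
  fixes S :: "'a::euclidean_space set"
  assumes "S \<in> sets borel"
  shows "(AE x in lebesgue_on S. P x) \<longleftrightarrow> (AE x in lborel. x \<in> S \<longrightarrow> P x)"
  using assms by (subst AE_restrict_space_iff) (auto simp: AE_completion_iff)

lemma nn_integral_lebesgue_on:
  fixes S :: "'a::euclidean_space set"
  assumes "S \<in> sets borel"
  shows "(\<integral>\<^sup>+x. f x \<partial>lebesgue_on S) = (\<integral>\<^sup>+x. f x * indicator S x \<partial>lborel)"
  using assms by (subst nn_integral_restrict_space) (auto simp: nn_integral_completion)

lemma nn_integral_lebesgue_on_eq:
  fixes S :: "'a::euclidean_space set"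
  assumes "S \<in> sets borel" "AE x in lborel. x \<in> S \<longrightarrow> f x = f' x" "\<And>x. x \<notin> S \<Longrightarrow> f' x = 0"
  shows "(\<integral>\<^sup>+x. f x \<partial>lebesgue_on S) = (\<integral>\<^sup>+x. f' x \<partial>lborel)"
  unfolding nn_integral_lebesgue_on[OF assms(1)]
proof (rule nn_integral_cong_AE)
  show "AE x in lborel. f x * indicator S x = f' x"
    using assms(2) by eventually_elim (use assms(3) in \<open>auto split: split_indicator\<close>)
qed

lemma borel_version:
  fixes f :: "'a::euclidean_space \<Rightarrow> real"
  assumes f: "f \<in> borel_measurable (lebesgue_on S)" and S: "S \<in> sets borel"
  obtains f' where "f' \<in> borel_measurable borel" "\<And>x. x \<notin> S \<Longrightarrow> f' x = 0" "AE x in lborel. x \<in> S \<longrightarrow> f x = f' x"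
proof -
  have "(\<lambda>x. indicator S x *\<^sub>R f x) \<in> borel_measurable lebesgue"
    using f S by (subst (asm) borel_measurable_restrict_space_iff) auto
  then obtain h where h: "h \<in> borel_measurable lborel" "AE x in lborel. indicator S x *\<^sub>R f x = h x"
    using completion_ex_borel_measurable_real by blast
  show thesis
  proof (rule that[of "\<lambda>x. indicator S x * h x"])
    show "(\<lambda>x. indicator S x * h x) \<in> borel_measurable borel" using h(1) S by measurable
    show "AE x in lborel. x \<in> S \<longrightarrow> f x = indicator S x * h x"
      using h(2) by eventually_elim auto
  qed auto
qed

lemma integral_lebesgue_on_eq:
  fixes h h' :: "'a::euclidean_space \<Rightarrow> real"
  assumes S: "S \<in> sets borel" and h': "h' \<in> borel_measurable borel" "\<And>x. x \<notin> S \<Longrightarrow> h' x = 0"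
    and eq: "AE x in lborel. x \<in> S \<longrightarrow> h x = h' x"
  shows "(\<integral>x. h x \<partial>lebesgue_on S) = (\<integral>x. h' x \<partial>lborel)"
proof -
  have ae: "AE x in lebesgue. h' x = indicator S x *\<^sub>R h x"
    unfolding AE_completion_iff using eq by eventually_elim (use h'(2) in \<open>auto split: split_indicator\<close>)
  have m: "h' \<in> borel_measurable lebesgue" using h'(1) by (simp add: measurable_completion)
  have "(\<integral>x. h x \<partial>lebesgue_on S) = (\<integral>x. indicator S x *\<^sub>R h x \<partial>lebesgue)"
    using S by (subst integral_restrict_space) auto
  also have "\<dots> = (\<integral>x. h' x \<partial>lebesgue)"
    using ae by (intro integral_cong_AE borel_measurable_AE[OF m ae] m) (auto elim!: eventually_mono)
  also have "\<dots> = (\<integral>x. h' x \<partial>lborel)" using h'(1) by (intro integral_completion) simp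
  finally show ?thesis .
qed

lemma set_integrable_lebesgue_iff:
  fixes h h' :: "real \<Rightarrow> real"
  assumes h': "h' \<in> borel_measurable borel" and eq: "AE x in lborel. x \<in> {c..d} \<longrightarrow> h x = h' x"
  shows "set_integrable lebesgue {c..d} h \<longleftrightarrow> set_integrable lborel {c..d} h'"
proof -
  have ae: "AE x in lebesgue. indicator {c..d} x * h' x = indicator {c..d} x * h x"
    unfolding AE_completion_iff using eq by eventually_elim (auto split: split_indicator)
  have b: "(\<lambda>x. indicator {c..d} x * h' x) \<in> borel_measurable lborel" using h' by measurable
  have m: "(\<lambda>x. indicator {c..d} x * h' x) \<in> borel_measurable lebesgue" using b by (rule measurable_completion)
  have "integrable lebesgue (\<lambda>x. indicator {c..d} x * h x) \<longleftrightarrow> integrable lebesgue (\<lambda>x. indicator {c..d} x * h' x)"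
    using ae by (intro integrable_cong_AE borel_measurable_AE[OF m ae] m) (auto elim!: eventually_mono)
  also have "\<dots> \<longleftrightarrow> integrable lborel (\<lambda>x. indicator {c..d} x * h' x)"
    by (rule integrable_completion[OF b])
  finally show ?thesis by (simp add: set_integrable_def)
qed

text \<open>Local integrability gives measurability on compact subintervals; the restrictions to an
  exhausting sequence of these converge pointwise, which gives measurability on (l,r).\<close>

lemma locally_integrable_borel_version:
  assumes g: "locally_integrable l r g"
  obtains g' where "g' \<in> borel_measurable borel" "\<And>x. x \<notin> {l<..<r} \<Longrightarrow> g' x = 0"
    "AE x in lborel. l < x \<and> x < r \<longrightarrow> g x = g' x"
proof -
  have S: "{l<..<r} \<in> sets borel" by simp
  let ?I = "\<lambda>n. {l + inverse (real (Suc n))..r - inverse (real (Suc n))}"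
  have "(\<lambda>x. indicator {l<..<r} x * g x) \<in> borel_measurable lebesgue"
  proof (rule borel_measurable_LIMSEQ_real)
    show "(\<lambda>x. indicator (?I n) x * g x) \<in> borel_measurable lebesgue" for n
    proof -
      have "set_integrable lebesgue (?I n) g" using g unfolding locally_integrable_def by simp
      then show ?thesis unfolding set_integrable_def real_scaleR_def by (rule borel_measurable_integrable)
    qed
    fix x
    show "(\<lambda>n. indicator (?I n) x * g x) \<longlonglongrightarrow> indicator {l<..<r} x * g x"
    proof (cases "x \<in> {l<..<r}")
      case True
      have "\<forall>\<^sub>F n in sequentially. inverse (real (Suc n)) < min (x - l) (r - x)"
        using True by (intro order_tendstoD(2)[OF LIMSEQ_inverse_real_of_nat]) auto
      then have "\<forall>\<^sub>F n in sequentially. indicator (?I n) x * g x = indicator {l<..<r} x * g x"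
        by eventually_elim (use True in \<open>auto split: split_indicator\<close>)
      then show ?thesis by (rule tendsto_eventually)
    next
      case False
      then have "x \<notin> ?I n" for n by (smt (verit) atLeastAtMost_iff greaterThanLessThan_iff inverse_positive_iff_positive of_nat_0_less_iff zero_less_Suc)
      with False show ?thesis by simp
    qed
  qed
  then have "g \<in> borel_measurable (lebesgue_on {l<..<r})"
    by (subst borel_measurable_restrict_space_iff) auto
  then obtain g' where "g' \<in> borel_measurable borel" "\<And>x. x \<notin> {l<..<r} \<Longrightarrow> g' x = 0" "AE x in lborel. x \<in> {l<..<r} \<longrightarrow> g x = g' x"
    by (rule borel_version[OF _ S]) blast
  then show thesis using that[of g'] by simp
qed

lemma test_function_zero:
  assumes "test_function l r \<phi>" "x \<notin> {l<..<r}"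
  shows "\<phi> x = 0" "deriv \<phi> x = 0"
proof -
  obtain c d where cd: "l < c" "d < r" "\<And>x. x \<notin> {c..d} \<Longrightarrow> \<phi> x = 0"
    using assms(1) unfolding test_function_def by blast
  then show "\<phi> x = 0" using assms(2) by auto
  have "((\<lambda>x. 0) has_real_derivative 0) (at x)" by simp
  then have "(\<phi> has_real_derivative 0) (at x)"
    by (rule has_field_derivative_transform_within_open[where S="- {c..d}"]) (use cd assms(2) in auto)
  then show "deriv \<phi> x = 0" by (rule DERIV_imp_deriv)
qed

lemma test_function_measurable:
  assumes "test_function l r \<phi>"
  shows "\<phi> \<in> borel_measurable borel" "deriv \<phi> \<in> borel_measurable borel"
  using assms unfolding test_function_smooth
  by (auto intro!: borel_measurable_continuous_onI smooth_continuous smooth_deriv)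

text \<open>The bridge from test functions to absolute continuity: one direction is the du
  Bois-Reymond lemma, the other integration by parts. As the right-hand side only mentions Borel
  representatives, the lemma also allows replacing \<open>f\<close> and \<open>g\<close> by
  functions that agree with them almost everywhere.\<close>

lemma has_weak_deriv_iff_primitive:
  assumes lr: "l < r" and f': "f' \<in> borel_measurable borel" "AE x in lborel. l < x \<and> x < r \<longrightarrow> f x = f' x"
    and g': "g' \<in> borel_measurable borel" "AE x in lborel. l < x \<and> x < r \<longrightarrow> g x = g' x"
  shows "has_weak_deriv l r f g \<longleftrightarrow>
    (\<exists>G. primitive_on {l<..<r} g' G \<and> (AE x in lborel. l < x \<and> x < r \<longrightarrow> f' x = G x))"
proof -
  note f'(1)[measurable] g'(1)[measurable]
  have lint: "(LINT x|lebesgue_on {l<..<r}. h x * \<phi> x) = (\<integral>x. h' x * \<phi> x \<partial>lborel)"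
    if "h' \<in> borel_measurable borel" "AE x in lborel. l < x \<and> x < r \<longrightarrow> h x = h' x" "\<phi> \<in> borel_measurable borel"
      "\<And>x. x \<notin> {l<..<r} \<Longrightarrow> \<phi> x = 0" for h h' \<phi> :: "real \<Rightarrow> real"
  proof (rule integral_lebesgue_on_eq)
    show "(\<lambda>x. h' x * \<phi> x) \<in> borel_measurable borel" using that by measurable
    show "AE x in lborel. x \<in> {l<..<r} \<longrightarrow> h x * \<phi> x = h' x * \<phi> x"
      using that(2) by eventually_elim simp
  qed (use that in auto)
  have weak: "((LINT x|lebesgue_on {l<..<r}. f x * deriv \<phi> x) = - (LINT x|lebesgue_on {l<..<r}. g x * \<phi> x))
      \<longleftrightarrow> ((\<integral>x. f' x * deriv \<phi> x \<partial>lborel) = - (\<integral>x. g' x * \<phi> x \<partial>lborel))"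
    if \<phi>: "test_function l r \<phi>" for \<phi>
    using lint[OF f' test_function_measurable(2)[OF \<phi>] test_function_zero(2)[OF \<phi>]]
      lint[OF g' test_function_measurable(1)[OF \<phi>] test_function_zero(1)[OF \<phi>]] by simp
  have loc: "locally_integrable l r h \<longleftrightarrow> (\<forall>c d. l < c \<longrightarrow> d < r \<longrightarrow> set_integrable lborel {c..d} h')"
    if "h' \<in> borel_measurable borel" "AE x in lborel. l < x \<and> x < r \<longrightarrow> h x = h' x" for h h'
  proof -
    have "set_integrable lebesgue {c..d} h \<longleftrightarrow> set_integrable lborel {c..d} h'" if "l < c" "d < r" for c d
      using that \<open>AE x in lborel. l < x \<and> x < r \<longrightarrow> h x = h' x\<close>
      by (intro set_integrable_lebesgue_iff \<open>h' \<in> borel_measurable borel\<close>) (auto elim!: eventually_mono)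
    then show ?thesis unfolding locally_integrable_def by blast
  qed
  show ?thesis
  proof
    assume w: "has_weak_deriv l r f g"
    show "\<exists>G. primitive_on {l<..<r} g' G \<and> (AE x in lborel. l < x \<and> x < r \<longrightarrow> f' x = G x)"
    proof (rule du_bois_reymond[OF lr])
      fix \<T>
      assume \<T>: "\<And>\<phi>. \<phi> \<in> \<T> \<Longrightarrow> test_function l r \<phi>"
        and det: "\<And>f g. (\<And>c d. l < c \<Longrightarrow> d < r \<Longrightarrow> set_integrable lborel {c..d} f) \<Longrightarrow>
          (\<And>c d. l < c \<Longrightarrow> d < r \<Longrightarrow> set_integrable lborel {c..d} g) \<Longrightarrow>
          (\<And>\<phi>. \<phi> \<in> \<T> \<Longrightarrow> (\<integral>x. f x * deriv \<phi> x \<partial>lborel) = - (\<integral>x. g x * \<phi> x \<partial>lborel)) \<Longrightarrow>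
          \<exists>G. primitive_on {l<..<r} g G \<and> (AE x in lborel. l < x \<and> x < r \<longrightarrow> f x = G x)"
      show "\<exists>G. primitive_on {l<..<r} g' G \<and> (AE x in lborel. l < x \<and> x < r \<longrightarrow> f' x = G x)"
      proof (rule det)
        show "set_integrable lborel {c..d} f'" "set_integrable lborel {c..d} g'" if "l < c" "d < r" for c d
          using w that loc[OF f'] loc[OF g'] unfolding has_weak_deriv_def by auto
        show "(\<integral>x. f' x * deriv \<phi> x \<partial>lborel) = - (\<integral>x. g' x * \<phi> x \<partial>lborel)" if "\<phi> \<in> \<T>" for \<phi>
          using w weak[OF \<T>[OF that]] \<T>[OF that] unfolding has_weak_deriv_def by blast
      qed
    qed
  next
    assume "\<exists>G. primitive_on {l<..<r} g' G \<and> (AE x in lborel. l < x \<and> x < r \<longrightarrow> f' x = G x)"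
    then obtain G where G: "primitive_on {l<..<r} g' G" and fG: "AE x in lborel. l < x \<and> x < r \<longrightarrow> f' x = G x" by blast
    have gi: "set_integrable lborel {c..d} g'" if "l < c" "d < r" for c d
    proof (cases "c \<le> d")
      case True
      then show ?thesis using primitive_onD(1)[OF G] that by auto
    qed (simp add: set_integrable_def)
    have fi: "set_integrable lborel {c..d} f'" if "l < c" "d < r" for c d
      unfolding set_integrable_def
    proof (rule integrable_cong_AE_imp)
      show "integrable lborel (\<lambda>x. indicator {c..d} x *\<^sub>R G x)"
        unfolding set_integrable_def[symmetric]
        by (rule borel_integrable_atLeastAtMost'[OF primitive_continuous[OF primitive_on_subset[OF G]]]) (use that in auto)
      show "AE x in lborel. indicator {c..d} x *\<^sub>R G x = indicator {c..d} x *\<^sub>R f' x"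
        using fG by eventually_elim (use that in \<open>auto split: split_indicator\<close>)
    qed measurable
    have "(\<integral>x. f' x * deriv \<phi> x \<partial>lborel) = - (\<integral>x. g' x * \<phi> x \<partial>lborel)" if \<phi>: "test_function l r \<phi>" for \<phi>
    proof -
      note test_function_measurable[OF \<phi>, measurable]
      have "(\<integral>x. f' x * deriv \<phi> x \<partial>lborel) = (\<integral>x. G x * deriv \<phi> x \<partial>lborel)"
      proof (rule integral_cong_AE)
        show "AE x in lborel. f' x * deriv \<phi> x = G x * deriv \<phi> x"
          using fG
        proof eventually_elim
          case (elim x)
          then show ?case using test_function_zero(2)[OF \<phi>, of x] by (cases "l < x \<and> x < r") auto
        qed
        show "(\<lambda>x. G x * deriv \<phi> x) \<in> borel_measurable lborel"
          using primitive_test_function(2)[OF G \<phi>] by auto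
      qed measurable
      then show ?thesis using primitive_test_function(3)[OF G \<phi>] by simp
    qed
    then show "has_weak_deriv l r f g"
      unfolding has_weak_deriv_def loc[OF f'] loc[OF g'] using weak gi fi by blast
  qed
qed

text \<open>G - H is continuous and vanishes almost everywhere, hence everywhere, because otherwise
  it would be nonzero on a whole interval. Consequently all interval integrals of g - h are
  0.\<close>

lemma primitive_unique_AE:
  assumes lr: "l < r" and "primitive_on {l<..<r} g G" "primitive_on {l<..<r} h H"
    and eq: "AE x in lborel. l < x \<and> x < r \<longrightarrow> G x = H x"
  shows "AE x in lborel. l < x \<and> x < r \<longrightarrow> g x = h x"
proof -
  define D where "D x = G x - H x" for x
  have P: "primitive_on {l<..<r} (\<lambda>x. g x - h x) D"
    unfolding D_def by (rule primitive_on_diff[OF assms(2,3)])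
  have D0: "D x = 0" if x: "x \<in> {l<..<r}" for x
  proof (rule ccontr)
    assume nz: "D x \<noteq> 0"
    obtain c d where cd: "l < c" "c < x" "x < d" "d < r"
      using x dense by (metis greaterThanLessThan_iff)
    have "continuous_on {c..d} D"
      using cd by (intro primitive_continuous[OF primitive_on_subset[OF P]]) auto
    then have "isCont D x" using cd by (simp add: continuous_on_interior)
    then have "\<forall>\<^sub>F y in at x. D y \<noteq> 0" using nz unfolding isCont_def by (rule tendsto_imp_eventually_ne)
    then obtain e where e: "e > 0" "\<And>y. y \<noteq> x \<Longrightarrow> dist y x < e \<Longrightarrow> D y \<noteq> 0" by (auto simp: eventually_at)
    define u where "u = min d (x + e)"
    have u: "x < u" "u \<le> d" "u \<le> x + e" using cd e by (auto simp: u_def)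
    have "AE y in lborel. y \<notin> {x<..<u}"
      using eq
    proof eventually_elim
      case (elim y)
      show ?case
      proof
        assume "y \<in> {x<..<u}"
        then have "D y \<noteq> 0" "l < y \<and> y < r" using e(2)[of y] u x cd by (auto simp: dist_real_def)
        then show False using elim by (simp add: D_def)
      qed
    qed
    then have "emeasure lborel {x<..<u} = 0" by (subst (asm) AE_iff_measurable[of "{x<..<u}"]) auto
    then show False using u by simp
  qed
  have "AE x in lborel. l < x \<and> x < r \<longrightarrow> g x - h x = 0"
  proof (rule AE_0_if_rational_integrals_0[OF _ lr])
    show "set_integrable lborel {c..d} (\<lambda>x. g x - h x)" if "l < c" "d < r" for c d
    proof (cases "c \<le> d")
      case True
      then show ?thesis using primitive_onD(1)[OF P] that by auto
    qed (simp add: set_integrable_def)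
    show "(LINT x:{c..d}|lborel. g x - h x) = 0" if "l < c" "c < d" "d < r" for c d
      using primitive_onD(2)[OF P, of c d] that D0[of c] D0[of d] by auto
  qed
  then show ?thesis by eventually_elim auto
qed

text \<open>\<open>wderiv\<close> is an arbitrary choice among weak derivatives; uniqueness
  identifies the norms defined through it with integrals of a given derivative.\<close>

lemma has_weak_deriv_unique:
  assumes lr: "l < r" and g: "has_weak_deriv l r f g" and h: "has_weak_deriv l r f h"
  shows "AE x in lborel. l < x \<and> x < r \<longrightarrow> g x = h x"
proof -
  obtain f' where f': "f' \<in> borel_measurable borel" "AE x in lborel. l < x \<and> x < r \<longrightarrow> f x = f' x"
    using locally_integrable_borel_version[of l r f] g unfolding has_weak_deriv_def by metis
  obtain g' where g': "g' \<in> borel_measurable borel" "AE x in lborel. l < x \<and> x < r \<longrightarrow> g x = g' x"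
    using locally_integrable_borel_version[of l r g] g unfolding has_weak_deriv_def by metis
  obtain h' where h': "h' \<in> borel_measurable borel" "AE x in lborel. l < x \<and> x < r \<longrightarrow> h x = h' x"
    using locally_integrable_borel_version[of l r h] h unfolding has_weak_deriv_def by metis
  obtain G where G: "primitive_on {l<..<r} g' G" "AE x in lborel. l < x \<and> x < r \<longrightarrow> f' x = G x"
    using g unfolding has_weak_deriv_iff_primitive[OF lr f' g'] by blast
  obtain H where H: "primitive_on {l<..<r} h' H" "AE x in lborel. l < x \<and> x < r \<longrightarrow> f' x = H x"
    using h unfolding has_weak_deriv_iff_primitive[OF lr f' h'] by blast
  have "AE x in lborel. l < x \<and> x < r \<longrightarrow> G x = H x"
    using G(2) H(2) by eventually_elim auto
  from primitive_unique_AE[OF lr G(1) H(1) this] g'(2) h'(2)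
  show ?thesis by eventually_elim auto
qed

lemma weak_deriv_pairI:
  assumes w: "has_weak_deriv 0 1 q r"
    and q': "q' \<in> borel_measurable borel" "AE x in lborel. 0 < x \<and> x < 1 \<longrightarrow> q x = q' x"
    and r': "r' \<in> borel_measurable borel" "AE x in lborel. 0 < x \<and> x < 1 \<longrightarrow> r x = r' x" "\<And>x. x \<notin> {0<..<1} \<Longrightarrow> r' x = 0"
  shows "weak_deriv_pair q' r'"
  using w r'(1,3) unfolding has_weak_deriv_iff_primitive[OF zero_less_one q' r'(1,2)] weak_deriv_pair_def by blast

lemma H10_pair_has_weak_deriv:
  assumes H: "H10_pair p' q'" and p: "AE x in lborel. 0 < x \<and> x < 1 \<longrightarrow> p x = p' x"
  shows "has_weak_deriv 0 1 p q'"
proof -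
  obtain P where P: "primitive_on {0..1} q' P" "AE x in lborel. 0 < x \<and> x < 1 \<longrightarrow> p' x = P x"
    using H by (auto simp: H10_pair_def)
  have m: "p' \<in> borel_measurable borel" "q' \<in> borel_measurable borel" using H by (auto simp: H10_pair_def)
  have "primitive_on {0<..<1} q' P" by (rule primitive_on_subset[OF P(1)]) auto
  then show ?thesis
    using P(2) by (subst has_weak_deriv_iff_primitive[OF zero_less_one m(1) p m(2)]) auto
qed

lemma continuous_eq_if_AE_eq:
  fixes f h :: "real \<Rightarrow> real"
  assumes "continuous_on {0..1} f" "continuous_on {0..1} h"
    and eq: "AE x in lborel. 0 < x \<and> x < 1 \<longrightarrow> f x = h x" and x: "x \<in> {0..1}"
  shows "f x = h x"
proof (rule ccontr)
  assume "f x \<noteq> h x"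
  have "continuous_on {0..1} (\<lambda>y. f y - h y)" by (intro continuous_intros assms)
  then obtain e where e: "e > 0" "\<And>y. y \<in> {0..1} \<Longrightarrow> dist y x < e \<Longrightarrow> dist (f y - h y) (f x - h x) < \<bar>f x - h x\<bar>"
    using x \<open>f x \<noteq> h x\<close> unfolding continuous_on_iff by (metis right_minus_eq zero_less_abs_iff)
  define u where "u = max 0 (x - e)"
  define v where "v = min 1 (x + e)"
  have uv: "u < v" using e x by (auto simp: u_def v_def)
  have "AE y in lborel. y \<notin> {u<..<v}"
    using eq
  proof eventually_elim
    case (elim y)
    show ?case
    proof
      assume y: "y \<in> {u<..<v}"
      then have "dist y x < e" "0 < y \<and> y < 1" by (auto simp: u_def v_def dist_real_def)
      then show False using elim e(2)[of y] by (simp add: dist_real_def)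
    qed
  qed
  then have "emeasure lborel {u<..<v} = 0" by (subst (asm) AE_iff_measurable[of "{u<..<v}"]) auto
  then show False using uv by simp
qed

text \<open>The weak derivative gives a primitive on the open interval. Square integrability of
  \<open>q'\<close> continues it to [0,1], and its values at 0 and 1 are those of the continuous
  representative \<open>w\<close>, with which it agrees almost everywhere and so everywhere.\<close>

lemma H10_pairI:
  assumes w: "has_weak_deriv 0 1 p q"
    and p': "p' \<in> borel_measurable borel" "AE x in lborel. 0 < x \<and> x < 1 \<longrightarrow> p x = p' x" "\<And>x. x \<notin> {0<..<1} \<Longrightarrow> p' x = 0"
    and q': "q' \<in> borel_measurable borel" "AE x in lborel. 0 < x \<and> x < 1 \<longrightarrow> q x = q' x" "\<And>x. x \<notin> {0<..<1} \<Longrightarrow> q' x = 0"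
    and q2: "integrable lborel (\<lambda>x. (q' x)\<^sup>2)"
    and c: "continuous_on {0..1} w" "AE x in lborel. 0 < x \<and> x < 1 \<longrightarrow> w x = p x" "w 0 = 0" "w 1 = 0"
  shows "H10_pair p' q'"
proof -
  obtain G where G: "primitive_on {0<..<1} q' G" "AE x in lborel. 0 < x \<and> x < 1 \<longrightarrow> p' x = G x"
    using w unfolding has_weak_deriv_iff_primitive[OF zero_less_one p'(1,2) q'(1,2)] by blast
  have qs: "indicator {0..1} x * q' x = q' x" for x using q'(3)[of x] by (auto split: split_indicator)
  have qi: "integrable lborel q'"
    using square_integral_interval_le(2)[OF q'(1) q2, of 0 1 "{0..1}"] unfolding qs by simp
  have qA: "set_integrable lborel {c..d} q'" for c d
    using integrable_mult_indicator[of "{c..d}" lborel, OF _ qi] by (simp add: set_integrable_def)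
  \<comment> \<open>\<open>q'\<close> is integrable on the whole line, so it has a primitive around
    [0,1]; its constant is then adjusted at 1/2 to match \<open>G\<close>.\<close>
  obtain P where P: "primitive_on {-1<..<2} q' P"
    using primitive_exists[of "-1" 2 q'] qA by auto
  have P01: "primitive_on {0..1} q' (\<lambda>x. P x + (G (1/2) - P (1/2)))"
    by (intro primitive_on_add_const primitive_on_subset[OF P]) auto
  have PG: "P x + (G (1/2) - P (1/2)) = G x" if "0 < x" "x < 1" for x
  proof (cases "x \<le> 1/2")
    case True
    then show ?thesis
      using primitive_onD(2)[OF P, of x "1/2"] primitive_onD(2)[OF G(1), of x "1/2"] that by auto
  next
    case False
    then show ?thesis
      using primitive_onD(2)[OF P, of "1/2" x] primitive_onD(2)[OF G(1), of "1/2" x] that by auto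
  qed
  have pP: "AE x in lborel. 0 < x \<and> x < 1 \<longrightarrow> p' x = P x + (G (1/2) - P (1/2))"
    using G(2) by eventually_elim (use PG in auto)
  have "AE x in lborel. 0 < x \<and> x < 1 \<longrightarrow> w x = P x + (G (1/2) - P (1/2))"
    using pP p'(2) c(2) by eventually_elim auto
  from continuous_eq_if_AE_eq[OF c(1) primitive_continuous[OF P01] this]
  have "P 0 + (G (1/2) - P (1/2)) = 0" "P 1 + (G (1/2) - P (1/2)) = 0" using c(3,4) by force+
  then show ?thesis
    unfolding H10_pair_def using p'(1,3) q'(1,3) q2 P01 pP
    by (intro conjI exI[of _ "\<lambda>x. P x + (G (1/2) - P (1/2))"]) auto
qed

section \<open>Representatives in time\<close>

text \<open>\<open>h\<close> will be a squared norm of the slice at time t, about whose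
  measurability in t nothing is said; only monotonicity of \<open>nn_integral\<close> is applied to
  it.\<close>

lemma integrable_from_slices:
  fixes f :: "real \<times> real \<Rightarrow> real"
  assumes [measurable]: "f \<in> borel_measurable borel" and nonneg: "\<And>z. 0 \<le> f z"
    and z: "\<And>x t. \<not> (0 < t \<and> t < T) \<Longrightarrow> f (x, t) = 0"
    and le: "AE t in lborel. 0 < t \<and> t < T \<longrightarrow> (\<integral>\<^sup>+x. ennreal (f (x, t)) \<partial>lborel) \<le> h t"
    and h: "(\<integral>\<^sup>+t. h t \<partial>lebesgue_on {0<..<T}) < \<infinity>"
  shows "integrable lborel f"
proof (rule integrableI_bounded)
  have m: "(\<lambda>z. ennreal (f z)) \<in> borel_measurable (lborel \<Otimes>\<^sub>M lborel)" by (simp add: lborel_prod)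
  have "(\<integral>\<^sup>+z. ennreal (norm (f z)) \<partial>lborel) = (\<integral>\<^sup>+z. ennreal (f z) \<partial>(lborel \<Otimes>\<^sub>M lborel))"
    using nonneg by (simp add: lborel_prod)
  also have "\<dots> = (\<integral>\<^sup>+t. \<integral>\<^sup>+x. ennreal (f (x, t)) \<partial>lborel \<partial>lborel)"
    by (rule lborel_pair.nn_integral_snd[OF m[unfolded case_prod_eta[symmetric]], symmetric, unfolded split])
  also have "\<dots> = (\<integral>\<^sup>+t. (\<integral>\<^sup>+x. ennreal (f (x, t)) \<partial>lborel) \<partial>lebesgue_on {0<..<T})"
    using z by (intro nn_integral_lebesgue_on_eq[symmetric]) auto
  also have "\<dots> \<le> (\<integral>\<^sup>+t. h t \<partial>lebesgue_on {0<..<T})"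
    by (rule nn_integral_mono_AE) (use le in \<open>simp add: AE_lebesgue_on\<close>)
  finally show "(\<integral>\<^sup>+z. ennreal (norm (f z)) \<partial>lborel) < \<infinity>" using h by (rule order.strict_trans1)
qed measurable

text \<open>For almost every x, \<open>du_bois_reymond\<close> in time shows that U plus the tail
  integral of \<open>V\<close> is constant in t. The exceptional null sets of the single test
  functions are united over the countable family.\<close>

lemma time_representation:
  fixes U V :: "real \<times> real \<Rightarrow> real" and a :: "real \<Rightarrow> real"
  assumes T: "0 < T" and a: "\<And>x. 0 < a x"
    and Um: "U \<in> borel_measurable borel" and Vm: "V \<in> borel_measurable borel"
    and supp: "\<And>x t. \<not> (0 < x \<and> x < 1 \<and> 0 < t \<and> t < T) \<Longrightarrow> U (x, t) = 0 \<and> V (x, t) = 0"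
    and Ui: "integrable lborel (\<lambda>z. (U z)\<^sup>2 / a (fst z))" and Vi: "integrable lborel (\<lambda>z. (V z)\<^sup>2 / a (fst z))"
    and weak: "\<And>\<phi>. test_function 0 T \<phi> \<Longrightarrow> AE x in lborel. 0 < x \<and> x < 1 \<longrightarrow>
      (\<integral>t. U (x, t) * deriv \<phi> t \<partial>lborel) = - (\<integral>t. V (x, t) * \<phi> t \<partial>lborel)"
  obtains g where "g \<in> borel_measurable borel" "\<And>x. \<not> (0 < x \<and> x < 1) \<Longrightarrow> g x = 0"
    "AE z in lborel. fst z \<in> {0<..<1} \<and> snd z \<in> {0<..<T} \<longrightarrow>
      U z = g (fst z) - (\<integral>\<tau>. indicator {snd z..} \<tau> * V (fst z, \<tau>) \<partial>lborel)"
proof -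
  define tail where "tail z = (\<integral>\<tau>. indicator {snd z..} \<tau> * V (fst z, \<tau>) \<partial>lborel)" for z
  have tm[measurable]: "tail \<in> borel_measurable borel" unfolding tail_def by (rule tail_integral_measurable[OF Vm])
  note Um[measurable] Vm[measurable]
  \<comment> \<open>The constant is recovered as a time average, which makes it a Borel function of
    x.\<close>
  define g where "g x = indicator {0<..<1} x * ((\<integral>t. indicator {0<..<T} t * (U (x, t) + tail (x, t)) \<partial>lborel) / T)" for x
  have gm[measurable]: "g \<in> borel_measurable borel"
  proof -
    have "(\<lambda>z :: real \<times> real. indicator {0<..<T} (snd z) :: real) \<in> borel_measurable borel"
      by (rule snd_measurable) simp
    then have "(\<lambda>z. indicator {0<..<T} (snd z) * (U z + tail z)) \<in> borel_measurable (lborel :: (real \<times> real) measure)"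
      by measurable
    then have "(\<lambda>(x, t). indicator {0<..<T} t * (U (x, t) + tail (x, t))) \<in> borel_measurable (lborel \<Otimes>\<^sub>M lborel)"
      by (simp add: lborel_prod case_prod_beta')
    then have "(\<lambda>x. \<integral>t. indicator {0<..<T} t * (U (x, t) + tail (x, t)) \<partial>lborel) \<in> borel_measurable lborel"
      by (rule lborel.borel_measurable_lebesgue_integral)
    then show ?thesis unfolding g_def by measurable
  qed
  have "AE x in lborel. 0 < x \<and> x < 1 \<longrightarrow> (AE t in lborel. 0 < t \<and> t < T \<longrightarrow> U (x, t) = g x - tail (x, t))"
  proof (rule du_bois_reymond[OF T])
    fix \<T>
    assume \<T>: "countable \<T>" "\<And>\<phi>. \<phi> \<in> \<T> \<Longrightarrow> test_function 0 T \<phi>"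
      and det: "\<And>f g. (\<And>c d. 0 < c \<Longrightarrow> d < T \<Longrightarrow> set_integrable lborel {c..d} f) \<Longrightarrow>
          (\<And>c d. 0 < c \<Longrightarrow> d < T \<Longrightarrow> set_integrable lborel {c..d} g) \<Longrightarrow>
          (\<And>\<phi>. \<phi> \<in> \<T> \<Longrightarrow> (\<integral>x. f x * deriv \<phi> x \<partial>lborel) = - (\<integral>x. g x * \<phi> x \<partial>lborel)) \<Longrightarrow>
          \<exists>G. primitive_on {0<..<T} g G \<and> (AE x in lborel. 0 < x \<and> x < T \<longrightarrow> f x = G x)"
    have "AE x in lborel. \<forall>\<phi>\<in>\<T>. 0 < x \<and> x < 1 \<longrightarrow>
        (\<integral>t. U (x, t) * deriv \<phi> t \<partial>lborel) = - (\<integral>t. V (x, t) * \<phi> t \<partial>lborel)"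
      using \<T> weak by (intro AE_ball_countable') auto
    moreover have "AE x in lborel. integrable lborel (\<lambda>t. (U (x, t))\<^sup>2) \<and> integrable lborel (\<lambda>t. U (x, t))"
      by (rule weighted_slice_integrable[OF T a Um Ui]) (use supp in auto)
    moreover have "AE x in lborel. integrable lborel (\<lambda>t. (V (x, t))\<^sup>2) \<and> integrable lborel (\<lambda>t. V (x, t))"
      by (rule weighted_slice_integrable[OF T a Vm Vi]) (use supp in auto)
    ultimately show "AE x in lborel. 0 < x \<and> x < 1 \<longrightarrow> (AE t in lborel. 0 < t \<and> t < T \<longrightarrow> U (x, t) = g x - tail (x, t))"
    proof eventually_elim
      case (elim x)
      show ?case
      proof
        assume x: "0 < x \<and> x < 1"
        have Vx: "integrable lborel (\<lambda>t. V (x, t))" and Ux: "integrable lborel (\<lambda>t. U (x, t))" using elim by auto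
        have si: "set_integrable lborel {c..d} f" if "integrable lborel f" for f :: "real \<Rightarrow> real" and c d
          using integrable_mult_indicator[of "{c..d}" lborel, OF _ that] by (simp add: set_integrable_def)
        obtain G where G: "primitive_on {0<..<T} (\<lambda>t. V (x, t)) G" "AE t in lborel. 0 < t \<and> t < T \<longrightarrow> U (x, t) = G t"
          using det[of "\<lambda>t. U (x, t)" "\<lambda>t. V (x, t)", OF si[OF Ux] si[OF Vx]] elim x by blast
        have P: "primitive_on {0<..<T} (\<lambda>t. V (x, t)) (\<lambda>t. 0 - tail (x, t))"
          unfolding tail_def fst_conv snd_conv by (rule primitive_on_subset[OF primitive_tail_integral[OF Vx]]) simp
        have D: "primitive_on {0<..<T} (\<lambda>t. 0) (\<lambda>t. G t + tail (x, t))"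
          using primitive_on_diff[OF G(1) P] by simp
        define c where "c = G (T / 2) + tail (x, T / 2)"
        have const: "G t + tail (x, t) = c" if "0 < t" "t < T" for t
          using primitive_onD(2)[OF D, of t "T / 2"] primitive_onD(2)[OF D, of "T / 2" t] that T
          by (cases "t \<le> T / 2") (auto simp: c_def set_lebesgue_integral_def)
        have UT: "AE t in lborel. 0 < t \<and> t < T \<longrightarrow> U (x, t) + tail (x, t) = c"
          using G(2) by eventually_elim (use const in auto)
        have [measurable]: "(\<lambda>t. U (x, t)) \<in> borel_measurable borel" "(\<lambda>t. tail (x, t)) \<in> borel_measurable borel"
          by (rule Pair_measurable_snd[OF Um] Pair_measurable_snd[OF tm])+
        have "(\<integral>t. indicator {0<..<T} t * (U (x, t) + tail (x, t)) \<partial>lborel) = (\<integral>t. indicator {0<..<T} t * c \<partial>lborel)"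
        proof (rule integral_cong_AE)
          show "AE t in lborel. indicator {0<..<T} t * (U (x, t) + tail (x, t)) = indicator {0<..<T} t * c"
            using UT by eventually_elim (auto split: split_indicator)
        qed measurable
        also have "\<dots> = T * c" using T by simp
        finally have "g x = c" using x T by (simp add: g_def)
        then show "AE t in lborel. 0 < t \<and> t < T \<longrightarrow> U (x, t) = g x - tail (x, t)"
          using UT by (auto elim!: eventually_mono)
      qed
    qed
  qed
  then have ae: "AE x in lborel. AE t in lborel. fst (x, t) \<in> {0<..<1} \<and> snd (x, t) \<in> {0<..<T} \<longrightarrow> U (x, t) = g (fst (x, t)) - tail (x, t)"
    by eventually_elim (auto elim!: eventually_mono)
  have g_fst[measurable]: "(\<lambda>z :: real \<times> real. g (fst z)) \<in> borel_measurable borel" by (rule fst_measurable[OF gm])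
  \<comment> \<open>The identity holds for almost every x at almost every t. Its solution set is
    Borel, so it holds almost everywhere in the plane.\<close>
  define S where "S = {z :: real \<times> real. fst z \<in> {0<..<1} \<and> snd z \<in> {0<..<T} \<longrightarrow> U z = g (fst z) - tail z}"
  have "S \<in> sets (borel :: (real \<times> real) measure)"
  proof -
    have "{z \<in> space borel. U z = g (fst z) - tail z} \<in> sets (borel :: (real \<times> real) measure)" by measurable
    moreover have "{0<..<1} \<times> {0<..<T} \<in> sets (borel :: (real \<times> real) measure)" by (intro borel_open open_Times) auto
    moreover have "S = {z \<in> space borel. U z = g (fst z) - tail z} \<union> - ({0<..<1} \<times> {0<..<T})"
      by (auto simp: S_def)
    ultimately show ?thesis by auto
  qed
  then have "{z \<in> space (lborel \<Otimes>\<^sub>M lborel). z \<in> S} \<in> sets (lborel \<Otimes>\<^sub>M lborel :: (real \<times> real) measure)"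
    by (simp only: lborel_prod space_lborel sets_lborel) simp
  then have "AE z in lborel \<Otimes>\<^sub>M lborel. z \<in> S"
    by (rule lborel_pair.AE_pair_measure) (use ae in \<open>simp add: S_def\<close>)
  then have "AE z in lborel. z \<in> S" unfolding lborel_prod .
  then show thesis
    by (intro that[OF gm]) (auto simp: g_def S_def tail_def elim!: eventually_mono)
qed

context evolution_setting
begin

text \<open>Arbitrarily close to T there are times at which \<open>w t\<close> and
  \<open>Zc t\<close> agree almost everywhere. In the weighted norm the first tends to
  \<open>w T\<close> by assumption and the second to \<open>g\<close> by the bound on increments.
  Here \<open>b\<close> is the given coefficient and \<open>a\<close> its positive
  modification.\<close>

lemma trace_eq_final_value:
  assumes b: "\<And>x. 0 < x \<Longrightarrow> x < 1 \<Longrightarrow> b x = a x"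
    and w: "\<And>t. t \<in> {0..T} \<Longrightarrow> w t \<in> L2w_space b"
    and lim: "((\<lambda>\<tau>. L2w_normsq b (\<lambda>x. w \<tau> x - w T x)) \<longlongrightarrow> 0) (at T within {0..T})"
    and ae: "AE t in lborel. 0 < t \<and> t < T \<longrightarrow> (AE x in lborel. 0 < x \<and> x < 1 \<longrightarrow> w t x = Z (x, t))"
  shows "AE x in lborel. 0 < x \<and> x < 1 \<longrightarrow> w T x = g x"
proof -
  let ?M = "lebesgue_on {0<..<1::real}"
  have AEM: "(AE x in ?M. P x) \<longleftrightarrow> (AE x in lborel. 0 < x \<and> x < 1 \<longrightarrow> P x)" for P
    by (simp add: AE_lebesgue_on)
  have meas: "f \<in> borel_measurable borel \<Longrightarrow> f \<in> borel_measurable ?M" for f :: "real \<Rightarrow> real"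
    by (intro measurable_restrict_space1 measurable_completion) simp
  have am[measurable]: "a \<in> borel_measurable ?M" by (rule meas[OF a_meas])
  have wm: "w t \<in> borel_measurable ?M" if "t \<in> {0..T}" for t
    using w[OF that] by (simp add: L2w_space_def L2_space_def)
  have norm: "L2w_normsq b f = (\<integral>\<^sup>+x. ennreal ((f x)\<^sup>2 / a x) \<partial>?M)" for f
    unfolding L2w_normsq_def by (rule nn_integral_cong) (simp add: b)
  have gT: "Zc T x = g x" for x by (rule Zc_at_T) simp
  define B where "B = (\<integral>s. v s \<partial>lborel)"
  have B: "B \<ge> 0" unfolding B_def using v_nonneg by simp
  have est: "(\<integral>\<^sup>+x. ennreal ((w T x - g x)\<^sup>2 / a x) \<partial>?M)
      \<le> 2 * L2w_normsq b (\<lambda>x. w t x - w T x) + 2 * ennreal ((T - t) * B)"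
    if t: "0 < t" "t < T" and wz: "AE x in lborel. 0 < x \<and> x < 1 \<longrightarrow> w t x = Zc t x" for t
  proof -
    have [measurable]: "w t \<in> borel_measurable ?M" "w T \<in> borel_measurable ?M" by (intro wm; use t in simp)+
    have [measurable]: "Zc t \<in> borel_measurable ?M" "Zc T \<in> borel_measurable ?M" by (intro meas Zc_meas)+
    have "(\<integral>\<^sup>+x. ennreal ((w T x - g x)\<^sup>2 / a x) \<partial>?M)
        \<le> (\<integral>\<^sup>+x. 2 * ennreal ((w t x - w T x)\<^sup>2 / a x) + 2 * ennreal ((Zc T x - Zc t x)\<^sup>2 / a x) \<partial>?M)"
    proof (rule nn_integral_mono_AE)
      show "AE x in ?M. ennreal ((w T x - g x)\<^sup>2 / a x)
          \<le> 2 * ennreal ((w t x - w T x)\<^sup>2 / a x) + 2 * ennreal ((Zc T x - Zc t x)\<^sup>2 / a x)"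
        unfolding AEM using wz
      proof eventually_elim
        case (elim x)
        show ?case
        proof
          assume "0 < x \<and> x < 1"
          then have "w T x - g x = - (w t x - w T x) + - (Zc T x - Zc t x)" using elim gT[of x] by simp
          then have "(w T x - g x)\<^sup>2 \<le> 2 * (w t x - w T x)\<^sup>2 + 2 * (Zc T x - Zc t x)\<^sup>2"
            using sq_sum_le[of "- (w t x - w T x)" "- (Zc T x - Zc t x)"] by (simp only: power2_minus)
          then have "(w T x - g x)\<^sup>2 / a x \<le> (2 * (w t x - w T x)\<^sup>2 + 2 * (Zc T x - Zc t x)\<^sup>2) / a x"
            using a_pos[of x] by (intro divide_right_mono) auto
          also have "\<dots> = 2 * ((w t x - w T x)\<^sup>2 / a x) + 2 * ((Zc T x - Zc t x)\<^sup>2 / a x)"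
            by (simp add: add_divide_distrib)
          finally have "ennreal ((w T x - g x)\<^sup>2 / a x)
              \<le> ennreal (2 * ((w t x - w T x)\<^sup>2 / a x) + 2 * ((Zc T x - Zc t x)\<^sup>2 / a x))" by (rule ennreal_leI)
          also have "\<dots> = 2 * ennreal ((w t x - w T x)\<^sup>2 / a x) + 2 * ennreal ((Zc T x - Zc t x)\<^sup>2 / a x)"
          proof -
            have "ennreal (2 * p + 2 * r) = 2 * ennreal p + 2 * ennreal r" if "0 \<le> p" "0 \<le> r" for p r
              using that by (simp add: ennreal_plus ennreal_mult)
            then show ?thesis using a_pos[of x] by (metis divide_nonneg_pos zero_le_power2)
          qed
          finally show "ennreal ((w T x - g x)\<^sup>2 / a x)
              \<le> 2 * ennreal ((w t x - w T x)\<^sup>2 / a x) + 2 * ennreal ((Zc T x - Zc t x)\<^sup>2 / a x)" .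
        qed
      qed
    qed
    also have "\<dots> = 2 * (\<integral>\<^sup>+x. ennreal ((w t x - w T x)\<^sup>2 / a x) \<partial>?M) + 2 * (\<integral>\<^sup>+x. ennreal ((Zc T x - Zc t x)\<^sup>2 / a x) \<partial>?M)"
      by (subst nn_integral_add) (simp_all add: nn_integral_cmult)
    also have "(\<integral>\<^sup>+x. ennreal ((Zc T x - Zc t x)\<^sup>2 / a x) \<partial>?M) \<le> ennreal ((T - t) * B)"
    proof -
      have "(\<integral>\<^sup>+x. ennreal ((Zc T x - Zc t x)\<^sup>2 / a x) \<partial>?M) \<le> (\<integral>\<^sup>+x. ennreal ((Zc T x - Zc t x)\<^sup>2 / a x) \<partial>lborel)"
        unfolding nn_integral_lebesgue_on[of "{0<..<1::real}", simplified]
        by (intro nn_integral_mono) (auto split: split_indicator)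
      also have "\<dots> = ennreal (\<integral>x. (Zc T x - Zc t x)\<^sup>2 / a x \<partial>lborel)"
        using Zc_increment_integral(1)[of t T] t a_pos by (intro nn_integral_eq_integral) (auto simp: less_imp_le)
      also have "\<dots> \<le> ennreal ((T - t) * B)"
      proof (rule ennreal_leI)
        have "(\<integral>\<tau>. indicator {t..<T} \<tau> * v \<tau> \<partial>lborel) \<le> B"
          unfolding B_def using v_nonneg v_integrable integrable_mult_indicator[of "{t..<T}" lborel v]
          by (intro integral_mono) (auto split: split_indicator)
        then have "(T - t) * (\<integral>\<tau>. indicator {t..<T} \<tau> * v \<tau> \<partial>lborel) \<le> (T - t) * B"
          using t by (intro mult_left_mono) auto
        then show "(\<integral>x. (Zc T x - Zc t x)\<^sup>2 / a x \<partial>lborel) \<le> (T - t) * B"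
          using Zc_increment_integral(2)[OF less_imp_le[OF t(2)]] by (rule order.trans[rotated])
      qed
      finally show ?thesis .
    qed
    finally show ?thesis unfolding norm by (simp add: mult_left_mono add_left_mono)
  qed
  \<comment> \<open>Agreement is known for almost every t, so one time is selected in each of the
    intervals (T - T / (n + 1), T); \<open>exists_le_average\<close> with the function 0 does
    this.\<close>
  have "\<exists>t. T - T * inverse (real (Suc n)) < t \<and> t < T \<and> (AE x in lborel. 0 < x \<and> x < 1 \<longrightarrow> w t x = Zc t x)" for n
  proof -
    have lt: "T - T * inverse (real (Suc n)) < T" using T by simp
    have "T * inverse (real (Suc n)) \<le> T * 1" using T by (intro mult_left_mono) (auto simp: inverse_le_1_iff)
    then have ge: "0 \<le> T - T * inverse (real (Suc n))" by simp
    have P: "AE t in lborel. T - T * inverse (real (Suc n)) < t \<and> t < T \<longrightarrow> (AE x in lborel. 0 < x \<and> x < 1 \<longrightarrow> w t x = Zc t x)"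
      using ae AE_plane(2)[OF time]
    proof eventually_elim
      case (elim t)
      show ?case
      proof
        assume "T - T * inverse (real (Suc n)) < t \<and> t < T"
        then have t: "0 < t" "t < T" using ge by linarith+
        then have "AE x in lborel. 0 < x \<and> x < 1 \<longrightarrow> w t x = Z (x, t)" using elim(1) by simp
        then show "AE x in lborel. 0 < x \<and> x < 1 \<longrightarrow> w t x = Zc t x"
          using elim(2) by eventually_elim (use t in \<open>auto simp: Zc_def\<close>)
      qed
    qed
    show ?thesis
      by (rule exists_le_average[OF lt _ P, of "\<lambda>x. 0"]) (auto simp: set_integrable_def)
  qed
  then obtain t where t: "\<And>n. T - T * inverse (real (Suc n)) < t n" "\<And>n. t n < T"
    "\<And>n. AE x in lborel. 0 < x \<and> x < 1 \<longrightarrow> w (t n) x = Zc (t n) x"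
    by metis
  have t0: "0 < t n" for n
  proof -
    have "T * inverse (real (Suc n)) \<le> T * 1" using T by (intro mult_left_mono) (auto simp: inverse_le_1_iff)
    then show ?thesis using t(1)[of n] by linarith
  qed
  have tT: "t \<longlonglongrightarrow> T"
  proof (rule tendsto_sandwich[of "\<lambda>n. T - T * inverse (real (Suc n))" _ _ "\<lambda>n. T"])
    have "(\<lambda>n. T - T * inverse (real (Suc n))) \<longlonglongrightarrow> T - T * 0"
      by (intro tendsto_intros LIMSEQ_inverse_real_of_nat)
    then show "(\<lambda>n. T - T * inverse (real (Suc n))) \<longlonglongrightarrow> T" by simp
    show "\<forall>\<^sub>F n in sequentially. T - T * inverse (real (Suc n)) \<le> t n" using t(1) by (intro always_eventually allI less_imp_le)
    show "\<forall>\<^sub>F n in sequentially. t n \<le> T" using t(2) by (intro always_eventually allI less_imp_le)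
  qed simp
  have "filterlim t (at T within {0..T}) sequentially"
  proof -
    have "\<forall>\<^sub>F n in sequentially. t n \<in> {0..T} \<and> t n \<noteq> T"
    proof (rule always_eventually, rule allI)
      fix n show "t n \<in> {0..T} \<and> t n \<noteq> T" using t0[of n] t(2)[of n] by simp
    qed
    then show ?thesis using tT unfolding filterlim_at by blast
  qed
  from filterlim_compose[OF lim this]
  have l1: "(\<lambda>n. L2w_normsq b (\<lambda>x. w (t n) x - w T x)) \<longlonglongrightarrow> 0" .
  have "(\<lambda>n. (T - t n) * B) \<longlonglongrightarrow> (T - T) * B" by (intro tendsto_intros tT)
  then have l2: "(\<lambda>n. ennreal ((T - t n) * B)) \<longlonglongrightarrow> ennreal 0" by (intro tendsto_ennrealI) simp
  have "(\<lambda>n. 2 * L2w_normsq b (\<lambda>x. w (t n) x - w T x) + 2 * ennreal ((T - t n) * B)) \<longlonglongrightarrow> 2 * 0 + 2 * ennreal 0"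
    by (intro tendsto_add ennreal_tendsto_cmult l1 l2) auto
  then have "(\<integral>\<^sup>+x. ennreal ((w T x - g x)\<^sup>2 / a x) \<partial>?M) \<le> 2 * 0 + 2 * ennreal 0"
    by (rule LIMSEQ_le_const) (use est[OF t0 t(2,3)] in auto)
  then have z: "(\<integral>\<^sup>+x. ennreal ((w T x - g x)\<^sup>2 / a x) \<partial>?M) = 0" by simp
  have [measurable]: "w T \<in> borel_measurable ?M" "g \<in> borel_measurable ?M" using wm[of T] T meas[OF g_meas] by auto
  have "AE x in ?M. ennreal ((w T x - g x)\<^sup>2 / a x) = 0"
    using z by (subst (asm) nn_integral_0_iff_AE) auto
  then show ?thesis unfolding AEM
  proof eventually_elim
    case (elim x)
    then show ?case using a_pos[of x] by (auto simp: ennreal_eq_0_iff divide_le_0_iff)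
  qed
qed

end

section \<open>The Carleman estimate\<close>

lemma QT_borel: "QT T \<in> sets borel"
  unfolding QT_def by (intro borel_open open_Times) auto

lemma has_weak_deriv_wderiv: "has_weak_deriv 0 1 f g \<Longrightarrow> has_weak_deriv 0 1 f (wderiv f)"
  unfolding wderiv_def by (rule someI[of "\<lambda>g. has_weak_deriv 0 1 f g"])

text \<open>Borel representatives of the data are shown to form an \<open>evolution_setting\<close>,
  and the real estimate there is read back as one between extended integrals. The derivatives
  \<open>wderiv\<close> chosen inside the norms have to be matched with the given
  \<open>u\<^sub>x\<close> and \<open>u\<^sub>x\<^sub>x\<close>, and the trace
  \<open>u\<^sub>T\<close> with the final value \<open>g\<close>.\<close>

lemma carleman_estimate_ennreal:
  fixes a :: "real \<Rightarrow> real" and b :: "real \<times> real \<Rightarrow> real" and T K lam s :: real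
    and u u\<^sub>t u\<^sub>x u\<^sub>x\<^sub>x F :: "real \<times> real \<Rightarrow> real" and u\<^sub>T :: "real \<Rightarrow> real"
  assumes T: "T > 0" and a_cont: "continuous_on {0..1} a" and a_pos: "\<forall>x\<in>{0<..<1}. a x > 0"
    and b: "b \<in> Linf_QT T" and bK: "AE (x, t) in lebesgue_on (QT T). \<bar>b (x, t)\<bar> \<le> K * sqrt (a x)"
    and lam: "lam > 1" and s1: "s \<ge> 1" and sK: "s \<ge> 2 * K\<^sup>2"
    and u_L2: "u \<in> L2_time T (H2w_space a) (H2w_normsq a)"
    and dt: "has_weak_dt a T u u\<^sub>t" and dx: "has_weak_dx T u u\<^sub>x" and dxx: "has_weak_dx T u\<^sub>x u\<^sub>x\<^sub>x"
    and eq: "AE (x, t) in lebesgue_on (QT T). u\<^sub>t (x, t) + a x * u\<^sub>x\<^sub>x (x, t) + b (x, t) * u\<^sub>x (x, t) = F (x, t)"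
    and bdry: "vanishes_on_lateral_boundary T u" and trace: "has_time_trace a T u T u\<^sub>T"
  shows "(\<integral>\<^sup>+ (x, t). ennreal
          ((1 / a x * \<bar>u\<^sub>t (x, t)\<bar>\<^sup>2 + a x * \<bar>u\<^sub>x\<^sub>x (x, t)\<bar>\<^sup>2
            + s * lam * carleman_phi lam t * \<bar>u\<^sub>x (x, t)\<bar>\<^sup>2
            + s\<^sup>2 * lam\<^sup>2 * (carleman_phi lam t)\<^sup>2 / a x * \<bar>u (x, t)\<bar>\<^sup>2)
           * exp (2 * s * carleman_phi lam t)) \<partial>lebesgue_on (QT T))
      \<le> ennreal 6 *
          (\<integral>\<^sup>+ (x, t). ennreal
             (s * carleman_phi lam t * (1 / a x) * \<bar>F (x, t)\<bar>\<^sup>2 * exp (2 * s * carleman_phi lam t))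
             \<partial>lebesgue_on (QT T))
        + ennreal (6 * s) *
          (ennreal (s * lam * carleman_phi lam T) * L2w_normsq a u\<^sub>T + H1w_normsq a u\<^sub>T)
          * ennreal (exp (2 * s * carleman_phi lam T))"
proof -
  \<comment> \<open>The value 1 off (0,1) makes the coefficient positive on the whole line; the
    other functions are extended by 0, so no integral changes.\<close>
  define a' where "a' x = (if 0 < x \<and> x < 1 then a x else 1)" for x
  have a'0: "a' x > 0" for x using a_pos by (simp add: a'_def)
  have aa': "a' x = a x" if "0 < x" "x < 1" for x using that by (simp add: a'_def)
  have a'm[measurable]: "a' \<in> borel_measurable borel"
  proof -
    have [measurable]: "(\<lambda>x. indicator {0..1} x * a x) \<in> borel_measurable borel"
      using borel_measurable_continuous_on_indicator[OF _ a_cont] by simp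
    have "a' = (\<lambda>x. if x \<in> {0<..<1} then indicator {0..1} x * a x else 1)" by (auto simp: a'_def fun_eq_iff)
    moreover have "(\<lambda>x. if x \<in> {0<..<1::real} then indicator {0..1} x * a x else 1) \<in> borel_measurable borel" by measurable
    ultimately show ?thesis by simp
  qed
  have memQ: "(x, t) \<in> QT T \<longleftrightarrow> 0 < x \<and> x < 1 \<and> 0 < t \<and> t < T" for x t by (auto simp: QT_def)
  have AEt: "(AE t in lebesgue_on {0<..<T}. P t) \<longleftrightarrow> (AE t in lborel. 0 < t \<and> t < T \<longrightarrow> P t)" for P
    by (simp add: AE_lebesgue_on)
  have AEx: "(AE x in lebesgue_on {0<..<1}. P x) \<longleftrightarrow> (AE x in lborel. 0 < x \<and> x < 1 \<longrightarrow> P x)" for P :: "real \<Rightarrow> bool"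
    by (simp add: AE_lebesgue_on)
  have u_L2w: "u \<in> L2_time T (L2w_space a) (L2w_normsq a)" and ut_L2w: "u\<^sub>t \<in> L2_time T (L2w_space a) (L2w_normsq a)"
    using dt by (auto simp: has_weak_dt_def)
  have bm: "u \<in> borel_measurable (lebesgue_on (QT T))" "u\<^sub>t \<in> borel_measurable (lebesgue_on (QT T))"
    "u\<^sub>x \<in> borel_measurable (lebesgue_on (QT T))" "u\<^sub>x\<^sub>x \<in> borel_measurable (lebesgue_on (QT T))"
    "b \<in> borel_measurable (lebesgue_on (QT T))"
    using u_L2 ut_L2w dx dxx b by (simp_all add: L2_time_def has_weak_dx_def Linf_QT_def)
  obtain U where Um[measurable]: "U \<in> borel_measurable borel" and U0: "\<And>z. z \<notin> QT T \<Longrightarrow> U z = 0"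
    and uU: "AE z in lborel. z \<in> QT T \<longrightarrow> u z = U z"
    by (rule borel_version[OF bm(1) QT_borel]) blast
  obtain V where Vm[measurable]: "V \<in> borel_measurable borel" and V0: "\<And>z. z \<notin> QT T \<Longrightarrow> V z = 0"
    and uV: "AE z in lborel. z \<in> QT T \<longrightarrow> u\<^sub>t z = V z"
    by (rule borel_version[OF bm(2) QT_borel]) blast
  obtain X where Xm[measurable]: "X \<in> borel_measurable borel" and X0: "\<And>z. z \<notin> QT T \<Longrightarrow> X z = 0"
    and uX: "AE z in lborel. z \<in> QT T \<longrightarrow> u\<^sub>x z = X z"
    by (rule borel_version[OF bm(3) QT_borel]) blast
  obtain Y where Ym[measurable]: "Y \<in> borel_measurable borel" and Y0: "\<And>z. z \<notin> QT T \<Longrightarrow> Y z = 0"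
    and uY: "AE z in lborel. z \<in> QT T \<longrightarrow> u\<^sub>x\<^sub>x z = Y z"
    by (rule borel_version[OF bm(4) QT_borel]) blast
  obtain b' where b'm[measurable]: "b' \<in> borel_measurable borel" and b0: "\<And>z. z \<notin> QT T \<Longrightarrow> b' z = 0"
    and bb: "AE z in lborel. z \<in> QT T \<longrightarrow> b z = b' z"
    by (rule borel_version[OF bm(5) QT_borel]) blast
  note secm = Pair_measurable_fst[OF Um] Pair_measurable_fst[OF Vm] Pair_measurable_fst[OF Xm] Pair_measurable_fst[OF Ym]
  note secm[measurable]
  have slice: "AE t in lborel. 0 < t \<and> t < T \<longrightarrow> (AE x in lborel. 0 < x \<and> x < 1 \<longrightarrow> f (x, t) = f' (x, t))"
    if "AE z in lborel. z \<in> QT T \<longrightarrow> f z = f' z" for f f' :: "real \<times> real \<Rightarrow> real"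
    using AE_plane(2)[OF that]
    by eventually_elim (auto simp: memQ elim!: eventually_mono)
  have nn: "(\<integral>\<^sup>+x. f x \<partial>lebesgue_on {0<..<1}) = (\<integral>\<^sup>+x. f' x \<partial>lborel)"
    if "AE x in lborel. 0 < x \<and> x < 1 \<longrightarrow> f x = f' x" "\<And>x. \<not> (0 < x \<and> x < 1) \<Longrightarrow> f' x = 0" for f f' :: "real \<Rightarrow> ennreal"
    using that by (intro nn_integral_lebesgue_on_eq) auto
  have w1: "AE t in lborel. 0 < t \<and> t < T \<longrightarrow> has_weak_deriv 0 1 (\<lambda>x. u (x, t)) (\<lambda>x. u\<^sub>x (x, t))"
    using dx by (simp add: has_weak_dx_def AEt)
  have w2: "AE t in lborel. 0 < t \<and> t < T \<longrightarrow> has_weak_deriv 0 1 (\<lambda>x. u\<^sub>x (x, t)) (\<lambda>x. u\<^sub>x\<^sub>x (x, t))"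
    using dxx by (simp add: has_weak_dx_def AEt)
  have H2: "AE t in lborel. 0 < t \<and> t < T \<longrightarrow> (\<lambda>x. u (x, t)) \<in> H2w_space a"
    and H2fin: "(\<integral>\<^sup>+t. H2w_normsq a (\<lambda>x. u (x, t)) \<partial>lebesgue_on {0<..<T}) < \<infinity>"
    using u_L2 by (auto simp: L2_time_def AEt)
  \<comment> \<open>The squared H^2 norm of a slice in terms of Borel representatives. It dominates
    each of its three summands, whose integrability over the plane follows since \<open>u\<close> is
    in the corresponding L^2 space over time.\<close>
  have slices: "AE t in lborel. 0 < t \<and> t < T \<longrightarrow>
      (\<integral>\<^sup>+x. ennreal ((U (x, t))\<^sup>2 / a' x) \<partial>lborel) + (\<integral>\<^sup>+x. ennreal ((X (x, t))\<^sup>2) \<partial>lborel)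
        + (\<integral>\<^sup>+x. ennreal (a' x * (Y (x, t))\<^sup>2) \<partial>lborel) = H2w_normsq a (\<lambda>x. u (x, t))"
    using w1 w2 H2 slice[OF uU] slice[OF uX] slice[OF uY]
  proof eventually_elim
    case (elim t)
    show ?case
    proof
      assume t: "0 < t \<and> t < T"
      define p where "p x = u (x, t)" for x
      have e: "AE x in lborel. 0 < x \<and> x < 1 \<longrightarrow> p x = U (x, t)"
        "AE x in lborel. 0 < x \<and> x < 1 \<longrightarrow> u\<^sub>x (x, t) = X (x, t)"
        "AE x in lborel. 0 < x \<and> x < 1 \<longrightarrow> u\<^sub>x\<^sub>x (x, t) = Y (x, t)"
        using elim t by (auto simp: p_def)
      have p1: "has_weak_deriv 0 1 p (\<lambda>x. u\<^sub>x (x, t))" and q1: "has_weak_deriv 0 1 (\<lambda>x. u\<^sub>x (x, t)) (\<lambda>x. u\<^sub>x\<^sub>x (x, t))"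
        using elim t by (auto simp: p_def[abs_def])
      have "AE x in lborel. 0 < x \<and> x < 1 \<longrightarrow> wderiv p x = u\<^sub>x (x, t)"
        by (rule has_weak_deriv_unique[OF zero_less_one has_weak_deriv_wderiv[OF p1] p1])
      then have wX: "AE x in lborel. 0 < x \<and> x < 1 \<longrightarrow> wderiv p x = X (x, t)"
        using e(2) by eventually_elim auto
      \<comment> \<open>\<open>wderiv p\<close> agrees with \<open>u\<^sub>x\<close> only almost
        everywhere; the weak derivative is transferred through their common Borel representative
        \<open>X\<close>.\<close>
      have "has_weak_deriv 0 1 (wderiv p) (\<lambda>x. u\<^sub>x\<^sub>x (x, t))"
        using q1 unfolding has_weak_deriv_iff_primitive[OF zero_less_one secm(3) e(2) secm(4) e(3)]
          has_weak_deriv_iff_primitive[OF zero_less_one secm(3) wX secm(4) e(3)] .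
      note q2 = this
      have "AE x in lborel. 0 < x \<and> x < 1 \<longrightarrow> wderiv (wderiv p) x = u\<^sub>x\<^sub>x (x, t)"
        by (rule has_weak_deriv_unique[OF zero_less_one has_weak_deriv_wderiv[OF q2] q2])
      then have wY: "AE x in lborel. 0 < x \<and> x < 1 \<longrightarrow> wderiv (wderiv p) x = Y (x, t)"
        using e(3) by eventually_elim auto
      have "L2w_normsq a p = (\<integral>\<^sup>+x. ennreal ((U (x, t))\<^sup>2 / a' x) \<partial>lborel)"
        unfolding L2w_normsq_def
      proof (rule nn)
        show "AE x in lborel. 0 < x \<and> x < 1 \<longrightarrow> ennreal ((p x)\<^sup>2 / a x) = ennreal ((U (x, t))\<^sup>2 / a' x)"
          using e(1) by eventually_elim (auto simp: aa')
      qed (auto simp: U0 memQ)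
      moreover have "L2_normsq (wderiv p) = (\<integral>\<^sup>+x. ennreal ((X (x, t))\<^sup>2) \<partial>lborel)"
        unfolding L2_normsq_def
      proof (rule nn)
        show "AE x in lborel. 0 < x \<and> x < 1 \<longrightarrow> ennreal ((wderiv p x)\<^sup>2) = ennreal ((X (x, t))\<^sup>2)"
          using wX by eventually_elim auto
      qed (auto simp: X0 memQ)
      moreover have "(\<integral>\<^sup>+x. ennreal (a x * (wderiv (wderiv p) x)\<^sup>2) \<partial>lebesgue_on {0<..<1}) = (\<integral>\<^sup>+x. ennreal (a' x * (Y (x, t))\<^sup>2) \<partial>lborel)"
      proof (rule nn)
        show "AE x in lborel. 0 < x \<and> x < 1 \<longrightarrow> ennreal (a x * (wderiv (wderiv p) x)\<^sup>2) = ennreal (a' x * (Y (x, t))\<^sup>2)"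
          using wY by eventually_elim (auto simp: aa')
      qed (auto simp: Y0 memQ)
      ultimately show "(\<integral>\<^sup>+x. ennreal ((U (x, t))\<^sup>2 / a' x) \<partial>lborel) + (\<integral>\<^sup>+x. ennreal ((X (x, t))\<^sup>2) \<partial>lborel)
        + (\<integral>\<^sup>+x. ennreal (a' x * (Y (x, t))\<^sup>2) \<partial>lborel) = H2w_normsq a (\<lambda>x. u (x, t))"
        by (simp add: H2w_normsq_def H1w_normsq_def p_def[abs_def])
    qed
  qed
  have a'f[measurable]: "(\<lambda>z :: real \<times> real. a' (fst z)) \<in> borel_measurable borel" by (rule fst_measurable[OF a'm])
  have U_int: "integrable lborel (\<lambda>z. (U z)\<^sup>2 / a' (fst z))"
  proof (rule integrable_from_slices[OF _ _ _ _ H2fin])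
    show "AE t in lborel. 0 < t \<and> t < T \<longrightarrow> (\<integral>\<^sup>+x. ennreal ((U (x, t))\<^sup>2 / a' (fst (x, t))) \<partial>lborel) \<le> H2w_normsq a (\<lambda>x. u (x, t))"
      using slices by eventually_elim (auto simp: add.assoc dest!: sym[where t="H2w_normsq a _"] intro!: add_increasing2)
  qed (use a'0 in \<open>auto simp: U0 memQ less_imp_le\<close>)
  have X_int: "integrable lborel (\<lambda>z. (X z)\<^sup>2)"
  proof (rule integrable_from_slices[OF _ _ _ _ H2fin])
    show "AE t in lborel. 0 < t \<and> t < T \<longrightarrow> (\<integral>\<^sup>+x. ennreal ((X (x, t))\<^sup>2) \<partial>lborel) \<le> H2w_normsq a (\<lambda>x. u (x, t))"
      using slices by eventually_elim (auto dest!: sym[where t="H2w_normsq a _"] intro!: add_increasing2 add_increasing)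
  qed (auto simp: X0 memQ)
  have Y_int: "integrable lborel (\<lambda>z. a' (fst z) * (Y z)\<^sup>2)"
  proof (rule integrable_from_slices[OF _ _ _ _ H2fin])
    show "AE t in lborel. 0 < t \<and> t < T \<longrightarrow> (\<integral>\<^sup>+x. ennreal (a' (fst (x, t)) * (Y (x, t))\<^sup>2) \<partial>lborel) \<le> H2w_normsq a (\<lambda>x. u (x, t))"
      using slices by eventually_elim (auto dest!: sym[where t="H2w_normsq a _"] intro!: add_increasing)
  qed (use a'0 in \<open>auto simp: Y0 memQ less_imp_le\<close>)
  have V_int: "integrable lborel (\<lambda>z. (V z)\<^sup>2 / a' (fst z))"
  proof (rule integrable_from_slices[where h="\<lambda>t. L2w_normsq a (\<lambda>x. u\<^sub>t (x, t))"])
    show "AE t in lborel. 0 < t \<and> t < T \<longrightarrow> (\<integral>\<^sup>+x. ennreal ((V (x, t))\<^sup>2 / a' (fst (x, t))) \<partial>lborel) \<le> L2w_normsq a (\<lambda>x. u\<^sub>t (x, t))"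
      using slice[OF uV]
    proof eventually_elim
      case (elim t)
      show ?case
      proof
        assume t: "0 < t \<and> t < T"
        have "L2w_normsq a (\<lambda>x. u\<^sub>t (x, t)) = (\<integral>\<^sup>+x. ennreal ((V (x, t))\<^sup>2 / a' x) \<partial>lborel)"
          unfolding L2w_normsq_def
        proof (rule nn)
          show "AE x in lborel. 0 < x \<and> x < 1 \<longrightarrow> ennreal ((u\<^sub>t (x, t))\<^sup>2 / a x) = ennreal ((V (x, t))\<^sup>2 / a' x)"
            using elim[rule_format, OF t] by eventually_elim (auto simp: aa')
        qed (auto simp: V0 memQ)
        then show "(\<integral>\<^sup>+x. ennreal ((V (x, t))\<^sup>2 / a' (fst (x, t))) \<partial>lborel) \<le> L2w_normsq a (\<lambda>x. u\<^sub>t (x, t))" by simp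
      qed
    qed
    show "(\<integral>\<^sup>+t. L2w_normsq a (\<lambda>x. u\<^sub>t (x, t)) \<partial>lebesgue_on {0<..<T}) < \<infinity>" using ut_L2w by (simp add: L2_time_def)
  qed (use a'0 in \<open>auto simp: V0 memQ less_imp_le\<close>)
  have space: "AE t in lborel. 0 < t \<and> t < T \<longrightarrow>
      H10_pair (\<lambda>x. U (x, t)) (\<lambda>x. X (x, t)) \<and> weak_deriv_pair (\<lambda>x. X (x, t)) (\<lambda>x. Y (x, t))"
    using w1 w2 slice[OF uU] slice[OF uX] slice[OF uY] bdry[unfolded vanishes_on_lateral_boundary_def AEt AEx] Fubini_plane_snd(1)[OF X_int]
  proof eventually_elim
    case (elim t)
    show ?case
    proof
      assume t: "0 < t \<and> t < T"
      obtain w where w: "continuous_on {0..1} w" "AE x in lborel. 0 < x \<and> x < 1 \<longrightarrow> w x = u (x, t)" "w 0 = 0" "w 1 = 0"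
        using elim t by auto
      have "H10_pair (\<lambda>x. U (x, t)) (\<lambda>x. X (x, t))"
        by (rule H10_pairI[OF elim(1)[rule_format, OF t] secm(1) elim(3)[rule_format, OF t] _ secm(3) elim(4)[rule_format, OF t] _ elim(7) w])
           (auto simp: U0 X0 memQ)
      moreover have "weak_deriv_pair (\<lambda>x. X (x, t)) (\<lambda>x. Y (x, t))"
        by (rule weak_deriv_pairI[OF elim(2)[rule_format, OF t] secm(3) elim(4)[rule_format, OF t] secm(4) elim(5)[rule_format, OF t]])
           (auto simp: Y0 memQ)
      ultimately show "H10_pair (\<lambda>x. U (x, t)) (\<lambda>x. X (x, t)) \<and> weak_deriv_pair (\<lambda>x. X (x, t)) (\<lambda>x. Y (x, t))" ..
    qed
  qed
  have weak: "AE x in lborel. 0 < x \<and> x < 1 \<longrightarrow> (\<integral>t. U (x, t) * deriv \<phi> t \<partial>lborel) = - (\<integral>t. V (x, t) * \<phi> t \<partial>lborel)"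
    if \<phi>: "test_function 0 T \<phi>" for \<phi>
  proof -
    have "AE x in lborel. 0 < x \<and> x < 1 \<longrightarrow>
        (LINT t|lebesgue_on {0<..<T}. u (x, t) * deriv \<phi> t) = - (LINT t|lebesgue_on {0<..<T}. u\<^sub>t (x, t) * \<phi> t)"
      using dt \<phi> by (simp add: has_weak_dt_def AEx)
    then show ?thesis using AE_plane(1)[OF uU] AE_plane(1)[OF uV]
    proof eventually_elim
      case (elim x)
      show ?case
      proof
        assume x: "0 < x \<and> x < 1"
        note test_function_measurable[OF \<phi>, measurable]
        have [measurable]: "(\<lambda>t. U (x, t)) \<in> borel_measurable borel" "(\<lambda>t. V (x, t)) \<in> borel_measurable borel"
          by (rule Pair_measurable_snd[OF Um] Pair_measurable_snd[OF Vm])+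
        have "(LINT t|lebesgue_on {0<..<T}. u (x, t) * deriv \<phi> t) = (\<integral>t. U (x, t) * deriv \<phi> t \<partial>lborel)"
        proof (rule integral_lebesgue_on_eq)
          show "AE t in lborel. t \<in> {0<..<T} \<longrightarrow> u (x, t) * deriv \<phi> t = U (x, t) * deriv \<phi> t"
            using elim(2) by eventually_elim (use x in \<open>auto simp: memQ\<close>)
        qed (auto simp: U0 memQ)
        moreover have "(LINT t|lebesgue_on {0<..<T}. u\<^sub>t (x, t) * \<phi> t) = (\<integral>t. V (x, t) * \<phi> t \<partial>lborel)"
        proof (rule integral_lebesgue_on_eq)
          show "AE t in lborel. t \<in> {0<..<T} \<longrightarrow> u\<^sub>t (x, t) * \<phi> t = V (x, t) * \<phi> t"
            using elim(3) by eventually_elim (use x in \<open>auto simp: memQ\<close>)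
        qed (auto simp: V0 memQ)
        ultimately show "(\<integral>t. U (x, t) * deriv \<phi> t \<partial>lborel) = - (\<integral>t. V (x, t) * \<phi> t \<partial>lborel)"
          using elim(1) x by simp
      qed
    qed
  qed
  obtain g where gm: "g \<in> borel_measurable borel" and g0: "\<And>x. \<not> (0 < x \<and> x < 1) \<Longrightarrow> g x = 0"
    and time: "AE z in lborel. fst z \<in> {0<..<1} \<and> snd z \<in> {0<..<T} \<longrightarrow>
      U z = g (fst z) - (\<integral>\<tau>. indicator {snd z..} \<tau> * V (fst z, \<tau>) \<partial>lborel)"
    by (rule time_representation[OF T a'0 Um Vm _ U_int V_int weak]) (auto simp: U0 V0 memQ)
  interpret E: evolution_setting a' T U X Y V g
    by unfold_locales (use T a'0 U_int X_int Y_int V_int space time gm g0 in \<open>auto simp: U0 V0 X0 Y0 memQ\<close>)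
  obtain q where q: "H10_pair g q" by (rule E.final_trace_H10)
  have uTg: "AE x in lborel. 0 < x \<and> x < 1 \<longrightarrow> u\<^sub>T x = g x"
  proof -
    obtain w where w: "\<And>t. t \<in> {0..T} \<Longrightarrow> w t \<in> L2w_space a"
      and lim: "\<forall>t\<in>{0..T}. ((\<lambda>\<tau>. L2w_normsq a (\<lambda>x. w \<tau> x - w t x)) \<longlongrightarrow> 0) (at t within {0..T})"
      and wu: "AE t in lborel. 0 < t \<and> t < T \<longrightarrow> (AE x in lborel. 0 < x \<and> x < 1 \<longrightarrow> w t x = u (x, t))"
      and uT: "AE x in lborel. 0 < x \<and> x < 1 \<longrightarrow> u\<^sub>T x = w T x"
      using trace unfolding has_time_trace_def AEt AEx by blast
    have limT: "((\<lambda>\<tau>. L2w_normsq a (\<lambda>x. w \<tau> x - w T x)) \<longlongrightarrow> 0) (at T within {0..T})"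
      using lim T by simp
    have wU: "AE t in lborel. 0 < t \<and> t < T \<longrightarrow> (AE x in lborel. 0 < x \<and> x < 1 \<longrightarrow> w t x = U (x, t))"
      using wu slice[OF uU]
    proof eventually_elim
      case (elim t)
      show ?case
      proof
        assume t: "0 < t \<and> t < T"
        show "AE x in lborel. 0 < x \<and> x < 1 \<longrightarrow> w t x = U (x, t)"
          using elim(1)[rule_format, OF t] elim(2)[rule_format, OF t] by eventually_elim auto
      qed
    qed
    show ?thesis
      using uT E.trace_eq_final_value[OF _ w limT wU] aa' by (auto elim!: eventually_elim2)
  qed
  define Q2 where "Q2 = (\<integral>x. (q x)\<^sup>2 \<partial>lborel)"
  define G2 where "G2 = (\<integral>x. (g x)\<^sup>2 / a' x \<partial>lborel)"
  have Q2: "0 \<le> Q2" and G2: "0 \<le> G2" using a'0 by (auto simp: Q2_def G2_def less_imp_le)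
  have nG: "L2w_normsq a u\<^sub>T = ennreal G2"
  proof -
    have "L2w_normsq a u\<^sub>T = (\<integral>\<^sup>+x. ennreal ((g x)\<^sup>2 / a' x) \<partial>lborel)"
      unfolding L2w_normsq_def
    proof (rule nn)
      show "AE x in lborel. 0 < x \<and> x < 1 \<longrightarrow> ennreal ((u\<^sub>T x)\<^sup>2 / a x) = ennreal ((g x)\<^sup>2 / a' x)"
        using uTg by eventually_elim (auto simp: aa')
    qed (simp add: g0)
    also have "\<dots> = ennreal G2"
      unfolding G2_def using a'0 by (intro nn_integral_eq_integral E.g_int) (auto simp: less_imp_le)
    finally show ?thesis .
  qed
  have nQ: "L2_normsq (wderiv u\<^sub>T) = ennreal Q2"
  proof -
    have wd: "has_weak_deriv 0 1 u\<^sub>T q" by (rule H10_pair_has_weak_deriv[OF q uTg])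
    have ae: "AE x in lborel. 0 < x \<and> x < 1 \<longrightarrow> wderiv u\<^sub>T x = q x"
      by (rule has_weak_deriv_unique[OF zero_less_one has_weak_deriv_wderiv[OF wd] wd])
    have "L2_normsq (wderiv u\<^sub>T) = (\<integral>\<^sup>+x. ennreal ((q x)\<^sup>2) \<partial>lborel)"
      unfolding L2_normsq_def
    proof (rule nn)
      show "AE x in lborel. 0 < x \<and> x < 1 \<longrightarrow> ennreal ((wderiv u\<^sub>T x)\<^sup>2) = ennreal ((q x)\<^sup>2)"
        using ae by eventually_elim auto
    qed (use q in \<open>auto simp: H10_pair_def\<close>)
    also have "\<dots> = ennreal Q2"
      unfolding Q2_def using q by (intro nn_integral_eq_integral) (auto simp: H10_pair_def)
    finally show ?thesis .
  qed
  \<comment> \<open>A Borel representative of the source term, assembled from the equation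
    itself.\<close>
  define F' where "F' z = V z + a' (fst z) * Y z + b' z * X z" for z
  have F'm: "F' \<in> borel_measurable borel" unfolding F'_def by measurable
  have F'0: "F' z = 0" if "z \<notin> QT T" for z using that by (simp add: F'_def V0 Y0 X0)
  have eqz: "AE z in lborel. z \<in> QT T \<longrightarrow> u\<^sub>t z + a (fst z) * u\<^sub>x\<^sub>x z + b z * u\<^sub>x z = F z"
    using eq by (simp add: AE_lebesgue_on[OF QT_borel] case_prod_beta')
  have bKz: "AE z in lborel. z \<in> QT T \<longrightarrow> \<bar>b z\<bar> \<le> K * sqrt (a (fst z))"
    using bK by (simp add: AE_lebesgue_on[OF QT_borel] case_prod_beta')
  have Qa: "a' (fst z) = a (fst z)" if "z \<in> QT T" for z using that by (auto simp: QT_def aa')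
  have FF': "AE z in lborel. z \<in> QT T \<longrightarrow> F z = F' z"
    using eqz uV uY bb uX by eventually_elim (auto simp: F'_def Qa)
  have dev: "AE z in lborel. \<bar>F' z - (V z + a' (fst z) * Y z)\<bar> \<le> K * sqrt (a' (fst z)) * \<bar>X z\<bar>"
    using bKz bb
  proof eventually_elim
    case (elim z)
    show ?case
    proof (cases "z \<in> QT T")
      case True
      then have "\<bar>b' z\<bar> * \<bar>X z\<bar> \<le> K * sqrt (a' (fst z)) * \<bar>X z\<bar>"
        using elim by (intro mult_right_mono) (auto simp: Qa)
      then show ?thesis by (simp add: F'_def abs_mult)
    qed (simp add: F'_def X0 V0 Y0)
  qed
  define \<phi> where "\<phi> t = exp (lam * t)" for t
  have \<phi>: "carleman_phi lam t = \<phi> t" "\<phi> t > 0" for t by (auto simp: carleman_phi_def \<phi>_def)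
  have s0: "s > 0" "lam > 0" using s1 lam by auto
  \<comment> \<open>With \<lambda> > 1 the condition s \<ge> 2 K^2 is enough for the absorption of
    the drift.\<close>
  have "s * 1 \<le> s * lam" using s0 lam by (intro mult_left_mono) auto
  then have sl: "2 * K\<^sup>2 \<le> s * lam" using sK by simp
  note CE = E.carleman_estimate[OF q F'm _ dev s0 sl, folded \<phi>_def Q2_def G2_def]
  have F'0': "\<not> (0 < x \<and> x < 1 \<and> 0 < t \<and> t < T) \<Longrightarrow> F' (x, t) = 0" for x t by (intro F'0) (simp add: memQ)
  define L where "L z = ((V z)\<^sup>2 / a' (fst z) + a' (fst z) * (Y z)\<^sup>2 + s * lam * \<phi> (snd z) * (X z)\<^sup>2
      + s\<^sup>2 * lam\<^sup>2 * (\<phi> (snd z))\<^sup>2 / a' (fst z) * (U z)\<^sup>2) * exp (2 * s * \<phi> (snd z))" for z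
  have Li: "integrable lborel L" unfolding L_def[abs_def] by (rule CE(1)[OF F'0'])
  define I where "I = (\<integral>z. exp (2 * s * \<phi> (snd z)) * ((F' z)\<^sup>2 / a' (fst z)) \<partial>lborel)"
  have iF: "integrable lborel (\<lambda>z. exp (2 * s * \<phi> (snd z)) * ((F' z)\<^sup>2 / a' (fst z)))" by (rule CE(2)[OF F'0'])
  have main: "(\<integral>z. L z \<partial>lborel) \<le> 6 * I + 3 * (exp (2 * s * \<phi> T) * (Q2 + s * lam * \<phi> T * G2))"
    unfolding L_def I_def by (rule CE(3)[OF F'0'])
  have L0: "0 \<le> L z" for z
    unfolding L_def using a'0[of "fst z"] \<phi>(2)[of "snd z"] s0 by (intro mult_nonneg_nonneg add_nonneg_nonneg) auto
  have I0: "0 \<le> I" unfolding I_def using a'0 by (intro Bochner_Integration.integral_nonneg) (auto simp: less_imp_le)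
  have lhs: "(\<integral>\<^sup>+ (x, t). ennreal
          ((1 / a x * \<bar>u\<^sub>t (x, t)\<bar>\<^sup>2 + a x * \<bar>u\<^sub>x\<^sub>x (x, t)\<bar>\<^sup>2
            + s * lam * carleman_phi lam t * \<bar>u\<^sub>x (x, t)\<bar>\<^sup>2
            + s\<^sup>2 * lam\<^sup>2 * (carleman_phi lam t)\<^sup>2 / a x * \<bar>u (x, t)\<bar>\<^sup>2)
           * exp (2 * s * carleman_phi lam t)) \<partial>lebesgue_on (QT T)) = ennreal (\<integral>z. L z \<partial>lborel)"
  proof -
    have "(\<integral>\<^sup>+ z. ennreal
          ((1 / a (fst z) * \<bar>u\<^sub>t z\<bar>\<^sup>2 + a (fst z) * \<bar>u\<^sub>x\<^sub>x z\<bar>\<^sup>2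
            + s * lam * carleman_phi lam (snd z) * \<bar>u\<^sub>x z\<bar>\<^sup>2
            + s\<^sup>2 * lam\<^sup>2 * (carleman_phi lam (snd z))\<^sup>2 / a (fst z) * \<bar>u z\<bar>\<^sup>2)
           * exp (2 * s * carleman_phi lam (snd z))) \<partial>lebesgue_on (QT T)) = (\<integral>\<^sup>+z. ennreal (L z) \<partial>lborel)"
    proof (rule nn_integral_lebesgue_on_eq[OF QT_borel])
      show "AE z in lborel. z \<in> QT T \<longrightarrow> ennreal
          ((1 / a (fst z) * \<bar>u\<^sub>t z\<bar>\<^sup>2 + a (fst z) * \<bar>u\<^sub>x\<^sub>x z\<bar>\<^sup>2
            + s * lam * carleman_phi lam (snd z) * \<bar>u\<^sub>x z\<bar>\<^sup>2
            + s\<^sup>2 * lam\<^sup>2 * (carleman_phi lam (snd z))\<^sup>2 / a (fst z) * \<bar>u z\<bar>\<^sup>2)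
           * exp (2 * s * carleman_phi lam (snd z))) = ennreal (L z)"
        using uU uV uX uY by eventually_elim (auto simp: L_def Qa \<phi>(1))
      show "ennreal (L z) = 0" if "z \<notin> QT T" for z using that by (simp add: L_def U0 V0 X0 Y0)
    qed
    also have "\<dots> = ennreal (\<integral>z. L z \<partial>lborel)" using L0 by (intro nn_integral_eq_integral Li) auto
    finally show ?thesis by (simp add: case_prod_beta')
  qed
  \<comment> \<open>For t > 0 and s \<ge> 1 the factor s \<phi> is at least 1, so the source
    integral without it is dominated by the one in the statement.\<close>
  have rhs: "ennreal I \<le> (\<integral>\<^sup>+ (x, t). ennreal
             (s * carleman_phi lam t * (1 / a x) * \<bar>F (x, t)\<bar>\<^sup>2 * exp (2 * s * carleman_phi lam t))
             \<partial>lebesgue_on (QT T))"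
  proof -
    have "ennreal I = (\<integral>\<^sup>+z. ennreal (exp (2 * s * \<phi> (snd z)) * ((F' z)\<^sup>2 / a' (fst z))) \<partial>lborel)"
      unfolding I_def using a'0 by (intro nn_integral_eq_integral[symmetric] iF) (auto simp: less_imp_le)
    also have "\<dots> \<le> (\<integral>\<^sup>+z. ennreal (s * \<phi> (snd z) * (1 / a' (fst z)) * \<bar>F' z\<bar>\<^sup>2 * exp (2 * s * \<phi> (snd z))) \<partial>lborel)"
    proof (rule nn_integral_mono, rule ennreal_leI)
      fix z
      show "exp (2 * s * \<phi> (snd z)) * ((F' z)\<^sup>2 / a' (fst z)) \<le> s * \<phi> (snd z) * (1 / a' (fst z)) * \<bar>F' z\<bar>\<^sup>2 * exp (2 * s * \<phi> (snd z))"
      proof (cases "z \<in> QT T")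
        case True
        then have "0 < snd z" by (auto simp: QT_def)
        then have "1 \<le> \<phi> (snd z)" using s0 by (simp add: \<phi>_def)
        then have "1 * 1 \<le> s * \<phi> (snd z)" using s1 by (intro mult_mono) auto
        then have "1 * (exp (2 * s * \<phi> (snd z)) * ((F' z)\<^sup>2 / a' (fst z))) \<le> (s * \<phi> (snd z)) * (exp (2 * s * \<phi> (snd z)) * ((F' z)\<^sup>2 / a' (fst z)))"
          using a'0[of "fst z"] by (intro mult_right_mono) auto
        then show ?thesis by (simp add: ac_simps)
      qed (simp add: F'0)
    qed
    also have "\<dots> = (\<integral>\<^sup>+ z. ennreal
             (s * carleman_phi lam (snd z) * (1 / a (fst z)) * \<bar>F z\<bar>\<^sup>2 * exp (2 * s * carleman_phi lam (snd z))) \<partial>lebesgue_on (QT T))"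
    proof (rule nn_integral_lebesgue_on_eq[OF QT_borel, symmetric])
      show "AE z in lborel. z \<in> QT T \<longrightarrow> ennreal
             (s * carleman_phi lam (snd z) * (1 / a (fst z)) * \<bar>F z\<bar>\<^sup>2 * exp (2 * s * carleman_phi lam (snd z)))
           = ennreal (s * \<phi> (snd z) * (1 / a' (fst z)) * \<bar>F' z\<bar>\<^sup>2 * exp (2 * s * \<phi> (snd z)))"
        using FF' by eventually_elim (auto simp: Qa \<phi>(1))
    qed (simp add: F'0)
    finally show ?thesis by (simp add: case_prod_beta')
  qed
  \<comment> \<open>The boundary constant 3 is enlarged to 6 s, so that the same constant 6 serves
    for the source and for the boundary term. The summand \<open>G2\<close> added here completes the
    weighted H^1 norm of the trace.\<close>
  have real_le: "3 * (exp (2 * s * \<phi> T) * (Q2 + s * lam * \<phi> T * G2))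
      \<le> 6 * s * (s * lam * \<phi> T * G2 + (G2 + Q2)) * exp (2 * s * \<phi> T)"
  proof -
    define A where "A = s * lam * \<phi> T * G2"
    have A: "0 \<le> A" unfolding A_def using s0 \<phi>(2)[of T] G2 by simp
    have "3 * (Q2 + A) \<le> 6 * (A + (G2 + Q2))" using A G2 Q2 by simp
    also have "\<dots> \<le> 6 * s * (A + (G2 + Q2))" using s1 A G2 Q2 by (intro mult_right_mono) auto
    finally have "3 * (Q2 + A) * exp (2 * s * \<phi> T) \<le> 6 * s * (A + (G2 + Q2)) * exp (2 * s * \<phi> T)"
      by (rule mult_right_mono) simp
    then show ?thesis unfolding A_def by (simp add: ac_simps)
  qed
  have "ennreal (\<integral>z. L z \<partial>lborel) \<le> ennreal (6 * I + 6 * s * (s * lam * \<phi> T * G2 + (G2 + Q2)) * exp (2 * s * \<phi> T))"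
    using main real_le by (intro ennreal_leI) linarith
  also have "\<dots> = ennreal 6 * ennreal I + ennreal (6 * s) * (ennreal (s * lam * \<phi> T) * ennreal G2 + (ennreal G2 + ennreal Q2)) * ennreal (exp (2 * s * \<phi> T))"
  proof -
    have p: "0 \<le> s * lam * \<phi> T" using s0 \<phi>(2)[of T] by simp
    have p2: "0 \<le> s * lam * \<phi> T * G2" using p G2 by simp
    have "ennreal (s * lam * \<phi> T * G2 + (G2 + Q2)) = ennreal (s * lam * \<phi> T) * ennreal G2 + (ennreal G2 + ennreal Q2)"
      by (simp only: ennreal_plus[OF p2 add_nonneg_nonneg[OF G2 Q2]] ennreal_plus[OF G2 Q2] ennreal_mult[OF p G2])
    moreover have "ennreal (6 * I + 6 * s * (s * lam * \<phi> T * G2 + (G2 + Q2)) * exp (2 * s * \<phi> T))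
        = ennreal 6 * ennreal I + ennreal (6 * s) * ennreal (s * lam * \<phi> T * G2 + (G2 + Q2)) * ennreal (exp (2 * s * \<phi> T))"
      using I0 s0 p2 G2 Q2 by (subst ennreal_plus) (auto simp: ennreal_mult)
    ultimately show ?thesis by simp
  qed
  also have "\<dots> \<le> ennreal 6 * (\<integral>\<^sup>+ (x, t). ennreal
             (s * carleman_phi lam t * (1 / a x) * \<bar>F (x, t)\<bar>\<^sup>2 * exp (2 * s * carleman_phi lam t)) \<partial>lebesgue_on (QT T))
       + ennreal (6 * s) * (ennreal (s * lam * \<phi> T) * ennreal G2 + (ennreal G2 + ennreal Q2)) * ennreal (exp (2 * s * \<phi> T))"
    by (intro add_right_mono mult_left_mono rhs) simp
  finally show ?thesis
    unfolding H1w_normsq_def nG nQ \<phi>(1) lhs[unfolded \<phi>(1)] .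
qed

theorem lemma2p2:
  fixes a :: "real \<Rightarrow> real" and b :: "real \<times> real \<Rightarrow> real" and T K :: real
  assumes "T > 0"
    and "continuous_on {0..1} a" and "a C1_differentiable_on {0<..<1}"
    and "\<forall>x\<in>{0<..<1}. a x > 0" and "a 0 = 0" and "a 1 = 0"
    and "K > 0" and "b \<in> Linf_QT T"
    and "AE (x, t) in lebesgue_on (QT T). \<bar>b (x, t)\<bar> \<le> K * sqrt (a x)"
  shows "\<exists>lam\<^sub>0>0. \<forall>lam>lam\<^sub>0. \<exists>s\<^sub>0>0. \<exists>C>0. \<forall>s\<ge>s\<^sub>0.
    \<forall>(u :: real \<times> real \<Rightarrow> real) u\<^sub>t u\<^sub>x u\<^sub>x\<^sub>x (F :: real \<times> real \<Rightarrow> real) (u\<^sub>0 :: real \<Rightarrow> real) u\<^sub>T.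
      u \<in> H1_time a T \<inter> L2_time T (H2w_space a) (H2w_normsq a) \<and>
      has_weak_dt a T u u\<^sub>t \<and> has_weak_dx T u u\<^sub>x \<and> has_weak_dx T u\<^sub>x u\<^sub>x\<^sub>x \<and>
      (AE (x, t) in lebesgue_on (QT T).
         u\<^sub>t (x, t) + a x * u\<^sub>x\<^sub>x (x, t) + b (x, t) * u\<^sub>x (x, t) = F (x, t)) \<and>
      vanishes_on_lateral_boundary T u \<and>
      has_time_trace a T u T u\<^sub>T \<and> has_time_trace a T u 0 u\<^sub>0
      \<longrightarrow>
      (\<integral>\<^sup>+ (x, t). ennreal
          ((1 / a x * \<bar>u\<^sub>t (x, t)\<bar>\<^sup>2 + a x * \<bar>u\<^sub>x\<^sub>x (x, t)\<bar>\<^sup>2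
            + s * lam * carleman_phi lam t * \<bar>u\<^sub>x (x, t)\<bar>\<^sup>2
            + s\<^sup>2 * lam\<^sup>2 * (carleman_phi lam t)\<^sup>2 / a x * \<bar>u (x, t)\<bar>\<^sup>2)
           * exp (2 * s * carleman_phi lam t)) \<partial>lebesgue_on (QT T))
      \<le> ennreal C *
          (\<integral>\<^sup>+ (x, t). ennreal
             (s * carleman_phi lam t * (1 / a x) * \<bar>F (x, t)\<bar>\<^sup>2 * exp (2 * s * carleman_phi lam t))
             \<partial>lebesgue_on (QT T))
        + ennreal (C * s) *
          (ennreal (s * lam * carleman_phi lam T) * L2w_normsq a u\<^sub>T + H1w_normsq a u\<^sub>T)
          * ennreal (exp (2 * s * carleman_phi lam T))
        + ennreal (C * s) *
          (ennreal (s * lam) * L2w_normsq a u\<^sub>0 + H1w_normsq a u\<^sub>0)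
          * ennreal (exp (2 * s))"
proof (rule exI[of _ "1 :: real"], intro conjI allI impI, goal_cases)
  case (2 lam)
  \<comment> \<open>The terms at time 0 form a nonnegative extended real, by which the right-hand
    side is completed.\<close>
  have le_add: "x \<le> y + z" if "x \<le> y" for x y z :: ennreal
    using that by (simp add: add_increasing2)
  note estimate = le_add[OF carleman_estimate_ennreal[OF assms(1,2,4,8,9)]]
  show ?case
  \<comment> \<open>s \<ge> 1 provides 1 \<le> s \<phi>, and s \<ge> 2 K^2 the absorption of the
    drift; the constant 6 serves for every \<lambda> > 1.\<close>
  proof (rule exI[of _ "max 1 (2 * K\<^sup>2)"], rule conjI, simp, rule exI[of _ "6 :: real"], intro conjI allI impI, goal_cases)
    case (2 s u u\<^sub>t u\<^sub>x u\<^sub>x\<^sub>x F u\<^sub>0 u\<^sub>T)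
    then show ?case using \<open>1 < lam\<close> by (intro estimate) simp_all
  qed simp
qed simp

end
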